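(* Let $D$ be a division ring with center $F$ and let $d$ be a positive integer. Assume that $N$ is a noncentral subnormal subgroup of $D^*$ (that is, $N\not\subseteq F$). If all multiplicative commutators of the form $aba^{-1}b^{-1}$, where $a\in N$ and $b\in D^*$, are algebraic over $F$ of bounded degree $d$, then $[D:F]\le d^2$.
   Context: $D^*$ denotes the multiplicative group of $D$, and $[D:F]$ the dimension of $D$ as a vector space over $F$. A subgroup $N$ of a group $G$ is subnormal if there is a finite chain $N=N_r\trianglelefteq N_{r-1}\trianglelefteq\dots\trianglelefteq N_0=G$ with each term normal in the next larger one. Elements of a set are algebraic over $F$ of bounded degree $d$ if each such element $x$ is algebraic over $F$ with $[F(x):F]\le d$. *)

theory Defs
  imports "HOL-Algebra.Algebra"
begin

text \<open>
  HOL-Algebra's \<open>field\<close> and \<open>domain\<close> are commutative, so division rings are introduced here in the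
  style of \<open>field\<close>. The condition on the units already forces \<open>\<one> \<noteq> \<zero>\<close>.
\<close>

locale skew_field = ring R for R (structure) +
  assumes skew_field_Units: "Units R = carrier R - {\<zero>}"

definition ring_center :: "('a, 'b) ring_scheme \<Rightarrow> 'a set"
  where "ring_center R = {z \<in> carrier R. \<forall>x \<in> carrier R. z \<otimes>\<^bsub>R\<^esub> x = x \<otimes>\<^bsub>R\<^esub> z}"

text \<open>
  That every \<open>C i\<close> is a subgroup of \<open>G\<close> need not be stated: it follows by induction, as
  \<open>C (Suc i) \<lhd> G\<lparr>carrier := C i\<rparr>\<close> includes that \<open>C (Suc i)\<close> is a subgroup of \<open>C i\<close>.
\<close>

definition subnormal :: "'a set \<Rightarrow> ('a, 'b) monoid_scheme \<Rightarrow> bool"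
  where "subnormal N G \<longleftrightarrow>
    group G \<and>
    (\<exists>(r::nat) C. C 0 = carrier G \<and> C r = N \<and> (\<forall>i<r. C (Suc i) \<lhd> G\<lparr>carrier := C i\<rparr>))"

text \<open>
  In a skew field with \<open>K\<close> a central subfield, \<open>generate_field R (insert x K)\<close> is the field \<open>K(x)\<close>:
  it is the closure of \<open>K \<union> {x}\<close> under the ring operations of \<open>R\<close> and inverses of non-zero elements.
  Being algebraic over \<open>K\<close> is the library's notion: evaluation at \<open>x\<close> is not injective on
  the polynomials with coefficients in \<open>K\<close>.
\<close>

definition algebraic_of_bounded_degree ::
    "('a, 'b) ring_scheme \<Rightarrow> 'a set \<Rightarrow> nat \<Rightarrow> 'a set \<Rightarrow> bool"
  where "algebraic_of_bounded_degree R K d S \<longleftrightarrow>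
    (\<forall>x \<in> S. ring.algebraic R K x \<and>
       (\<exists>n \<le> d. ring.dimension R n K (generate_field R (insert x K))))"

lemma (in skew_field) ring_center_subfield: "subfield (ring_center R) R"
proof (rule subfieldI)
  have closed: "z \<in> carrier R" if "z \<in> ring_center R" for z
    using that unfolding ring_center_def by blast
  have comm: "z \<otimes> x = x \<otimes> z" if "z \<in> ring_center R" "x \<in> carrier R" for z x
    using that unfolding ring_center_def by blast
  have memI: "z \<in> ring_center R"
    if "z \<in> carrier R" "\<And>x. x \<in> carrier R \<Longrightarrow> z \<otimes> x = x \<otimes> z" for z
    using that unfolding ring_center_def by blast
  show "subcring (ring_center R) R"
  proof (rule subcringI)
    show "subring (ring_center R) R"
    proof (rule subringI)
      fix y z assume yz: "y \<in> ring_center R" "z \<in> ring_center R"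
      note c = yz[THEN closed]
      show "y \<otimes> z \<in> ring_center R"
      proof (rule memI)
        fix x assume x: "x \<in> carrier R"
        have "y \<otimes> z \<otimes> x = y \<otimes> (x \<otimes> z)"
          using x c by (simp add: m_assoc comm[OF yz(2) x])
        also have "\<dots> = x \<otimes> y \<otimes> z"
          using x c by (simp add: m_assoc[symmetric] comm[OF yz(1) x])
        finally show "y \<otimes> z \<otimes> x = x \<otimes> (y \<otimes> z)" using x c by (simp add: m_assoc)
      qed (use c in simp)
      show "y \<oplus> z \<in> ring_center R"
        using c by (intro memI) (simp_all add: l_distr r_distr comm yz)
    next
      fix z assume z: "z \<in> ring_center R"
      show "\<ominus> z \<in> ring_center R"
        using closed[OF z] by (intro memI) (simp_all add: l_minus r_minus comm z)
    next
      show "ring_center R \<subseteq> carrier R" using closed by blast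
      show "\<one> \<in> ring_center R" by (rule memI) simp_all
    qed
  qed (use comm closed in blast)
  show "Units (R\<lparr>carrier := ring_center R\<rparr>) = ring_center R - {\<zero>}"
  proof (intro equalityI subsetI)
    fix z assume "z \<in> Units (R\<lparr>carrier := ring_center R\<rparr>)"
    then obtain y where z: "z \<in> ring_center R" and y: "y \<in> ring_center R"
      and "y \<otimes> z = \<one>" "z \<otimes> y = \<one>"
      unfolding Units_def by auto
    then have "z \<in> Units R" using closed unfolding Units_def by blast
    then show "z \<in> ring_center R - {\<zero>}" using z skew_field_Units by blast
  next
    fix z assume z: "z \<in> ring_center R - {\<zero>}"
    then have u: "z \<in> Units R" using skew_field_Units closed by blast
    have c: "z \<in> carrier R" "inv z \<in> carrier R" using u by auto
    have "inv z \<in> ring_center R"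
    proof (rule memI)
      fix x assume x: "x \<in> carrier R"
      have zx: "z \<otimes> x = x \<otimes> z" using z x comm by blast
      have "inv z \<otimes> x = inv z \<otimes> (x \<otimes> z) \<otimes> inv z"
        using u c x by (simp add: m_assoc)
      also have "\<dots> = inv z \<otimes> z \<otimes> x \<otimes> inv z"
        using c x by (simp add: zx[symmetric] m_assoc)
      finally show "inv z \<otimes> x = x \<otimes> inv z" using u x by simp
    qed (use c in simp)
    then show "z \<in> Units (R\<lparr>carrier := ring_center R\<rparr>)"
      using z Units_l_inv[OF u] Units_r_inv[OF u] unfolding Units_def by auto
  qed
qed

end

(*
  Fix a in N outside the center F and put ad a r = a r - r a.  The inverse of a b a^-1 b^-1 - 1 is
  b a (ad a b)^-1, and here b may be changed by any c in the centralizer of a without changing ad a b.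
  So the commutators provide the line b f + z f (z in F) of elements of degree at most d, with
  f = a (ad a b)^-1.

  If F is infinite, the direction f of that line has degree at most d as well, and so does every
  element of ad a D.  Among such elements choose x of maximal degree k not commuting with a.  As the
  degree does not grow in the directions ad a r, the derivative of the minimal polynomial of x in
  these directions lies in F(x); if u centralized x without lying in F(x), this would be a nontrivial
  relation with coefficients u x^l a, u x^l, x^l a, x^l, which are linearly independent.  So F(x)
  is its own centralizer, and [D:F] <= k^2.

  If F is finite, the elements of degree at most d have bounded exponent, so the polynomial
  (b f + c f)^M - 1 has only finitely many zeros c that commute with a and b: every element
  commuting with two noncommuting elements a in N and b has finite order.  Subnormality then yields a
  noncentral torsion element of N, on which some b acts by b a b^-1 = a^s.  They generate a
  finite cyclic algebra, which has zero divisors because norms of finite fields are surjective.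
*)
theory Submission
  imports Defs
begin

section \<open>Sums and linear systems over skew fields\<close>

text \<open>Degrees are expressed as linear dependence of powers (\<open>pow_dep\<close>), which
  avoids polynomials over a skew field. The obstacle is that the relations for
  \<open>x \<oplus> z \<otimes> y\<close> depend on \<open>z\<close> in an uncontrolled way, so they
  can neither be specialized at z = 0 nor differentiated. Instead, finitely many of them are added
  with central weights chosen to annihilate prescribed powers of \<open>z\<close>; this replaces
  both operations and is where infinitely many central elements are consumed.

  In the final count one factor k is the degree of F(x) over F, the other bounds the rank of D as a
  right vector space over F(x).

  With a finite center no bound can be the outcome: it would make D finite, hence commutative by
  Wedderburn's theorem, although N is noncentral. That case therefore has to end in a contradiction.
  There the elements put into the line are noncentral; they only commute with the two elements
  defining it, and what comes out is torsion instead of a degree.\<close>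

lemma (in ring) finsum_minus:
  assumes "f \<in> A \<rightarrow> carrier R" "g \<in> A \<rightarrow> carrier R"
  shows "(\<Oplus>i\<in>A. f i \<ominus> g i) = (\<Oplus>i\<in>A. f i) \<ominus> (\<Oplus>i\<in>A. g i)"
proof -
  have "(\<Oplus>i\<in>A. f i \<ominus> g i) \<oplus> (\<Oplus>i\<in>A. g i) = (\<Oplus>i\<in>A. (f i \<ominus> g i) \<oplus> g i)"
    using assms by (intro finsum_addf[symmetric]) (auto intro!: minus_closed)
  also have "\<dots> = (\<Oplus>i\<in>A. f i)"
    using assms by (intro finsum_cong') (auto simp: a_minus_def a_assoc l_neg Pi_def)
  finally have e: "(\<Oplus>i\<in>A. f i) = (\<Oplus>i\<in>A. f i \<ominus> g i) \<oplus> (\<Oplus>i\<in>A. g i)" by simp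
  have "(\<Oplus>i\<in>A. f i \<ominus> g i) \<in> carrier R" "(\<Oplus>i\<in>A. g i) \<in> carrier R"
    using assms by (auto intro!: finsum_closed minus_closed)
  then show ?thesis unfolding e by (simp add: a_minus_def a_assoc r_neg)
qed

lemma (in ring) finsum_swap:
  assumes "finite A" "finite B" "\<And>i j. i \<in> A \<Longrightarrow> j \<in> B \<Longrightarrow> f i j \<in> carrier R"
  shows "(\<Oplus>i\<in>A. \<Oplus>j\<in>B. f i j) = (\<Oplus>j\<in>B. \<Oplus>i\<in>A. f i j)"
  using assms(1,3)
proof (induction A rule: finite_induct)
  case empty
  then show ?case by simp
next
  case (insert a A)
  have 1: "(\<Oplus>j\<in>B. f i j) \<in> carrier R" if "i \<in> insert a A" for i
    using insert(4) that by (auto intro!: finsum_closed)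
  have 2: "(\<Oplus>i\<in>A. f i j) \<in> carrier R" if "j \<in> B" for j
    using insert(4) that by (auto intro!: finsum_closed)
  have "(\<Oplus>i\<in>insert a A. \<Oplus>j\<in>B. f i j) = (\<Oplus>j\<in>B. f a j) \<oplus> (\<Oplus>j\<in>B. \<Oplus>i\<in>A. f i j)"
    using insert 1 by (subst finsum_insert) auto
  also have "\<dots> = (\<Oplus>j\<in>B. f a j \<oplus> (\<Oplus>i\<in>A. f i j))"
    using insert 2 by (intro finsum_addf[symmetric]) auto
  also have "\<dots> = (\<Oplus>j\<in>B. \<Oplus>i\<in>insert a A. f i j)"
    using insert 2 by (intro finsum_cong' refl) (auto simp: finsum_insert Pi_def)
  finally show ?case .
qed

lemma (in ring) finsum_remove:
  assumes "finite A" "a \<in> A" "f \<in> A \<rightarrow> carrier R"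
  shows "(\<Oplus>i\<in>A. f i) = f a \<oplus> (\<Oplus>i\<in>A - {a}. f i)"
proof -
  have "(\<Oplus>i\<in>A. f i) = (\<Oplus>i\<in>insert a (A - {a}). f i)" using assms(2) by (simp add: insert_absorb)
  also have "\<dots> = f a \<oplus> (\<Oplus>i\<in>A - {a}. f i)"
    using assms by (intro finsum_insert) auto
  finally show ?thesis .
qed

lemma (in ring) finsum_in_subring:
  assumes "subring E R" "\<And>i. i \<in> A \<Longrightarrow> f i \<in> E"
  shows "(\<Oplus>i\<in>A. f i) \<in> E"
proof (cases "finite A")
  case True
  note E = subringE[OF assms(1)]
  show ?thesis using True assms(2)
  proof (induction A rule: finite_induct)
    case empty
    then show ?case using E by simp
  next
    case (insert a A)
    then have "(\<Oplus>i\<in>insert a A. f i) = f a \<oplus> (\<Oplus>i\<in>A. f i)"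
      using E(1) by (intro finsum_insert) auto
    then show ?case using insert E by auto
  qed
qed (use subringE[OF assms(1)] in simp)

context skew_field
begin

lemma nonzero_Units: "x \<in> carrier R \<Longrightarrow> x \<noteq> \<zero> \<Longrightarrow> x \<in> Units R"
  using skew_field_Units by blast

lemma one_neq_zero [simp]: "\<one> \<noteq> \<zero>"
  using Units_one_closed skew_field_Units by blast

lemma nonzero_inv [simp]:
  assumes "x \<in> carrier R" "x \<noteq> \<zero>"
  shows "inv x \<in> carrier R" "inv x \<otimes> x = \<one>" "x \<otimes> inv x = \<one>" "inv x \<noteq> \<zero>" "inv (inv x) = x"
  using nonzero_Units[OF assms] skew_field_Units Units_inv_Units by auto

lemma nonzero_inv_cancel [simp]:
  assumes "x \<in> carrier R" "x \<noteq> \<zero>" "y \<in> carrier R"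
  shows "inv x \<otimes> (x \<otimes> y) = y" "x \<otimes> (inv x \<otimes> y) = y" "y \<otimes> x \<otimes> inv x = y" "y \<otimes> inv x \<otimes> x = y"
  using assms by (simp_all add: m_assoc[symmetric]) (simp_all add: m_assoc)

lemma integral_iff [simp]:
  assumes "x \<in> carrier R" "y \<in> carrier R"
  shows "x \<otimes> y = \<zero> \<longleftrightarrow> x = \<zero> \<or> y = \<zero>"
proof
  assume "x \<otimes> y = \<zero>"
  then have "y = inv x \<otimes> \<zero>" if "x \<noteq> \<zero>" using nonzero_inv_cancel(1)[OF assms(1) that assms(2)] by simp
  then show "x = \<zero> \<or> y = \<zero>" using assms by auto
qed (use assms in auto)

lemma mult_left_cancel:
  assumes "x \<in> carrier R" "x \<noteq> \<zero>" "y \<in> carrier R" "z \<in> carrier R"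
  shows "x \<otimes> y = x \<otimes> z \<longleftrightarrow> y = z"
  using assms by (metis nonzero_inv_cancel(1))

lemma mult_right_cancel:
  assumes "x \<in> carrier R" "x \<noteq> \<zero>" "y \<in> carrier R" "z \<in> carrier R"
  shows "y \<otimes> x = z \<otimes> x \<longleftrightarrow> y = z"
  using assms by (metis nonzero_inv_cancel(3))

lemma pow_nonzero [simp]: "x \<in> carrier R \<Longrightarrow> x \<noteq> \<zero> \<Longrightarrow> x [^] (n::nat) \<noteq> \<zero>"
  by (induction n) auto

text \<open>Gaussian elimination, with the unknowns to the right of the coefficients. The skew
  subfield \<open>E\<close> is a parameter because some applications need a solution in the center
  and another one works in all of \<open>R\<close>.\<close>

lemma homogeneous_system:
  fixes A :: "'i \<Rightarrow> 'j \<Rightarrow> 'a"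
  assumes E: "subring E R" "\<And>x. x \<in> E \<Longrightarrow> x \<noteq> \<zero> \<Longrightarrow> inv x \<in> E"
    and "finite I" "finite J" "card I < card J" "\<And>i j. i \<in> I \<Longrightarrow> j \<in> J \<Longrightarrow> A i j \<in> E"
  shows "\<exists>w. (\<forall>j. w j \<in> E) \<and> (\<exists>j\<in>J. w j \<noteq> \<zero>) \<and> (\<forall>i\<in>I. (\<Oplus>j\<in>J. A i j \<otimes> w j) = \<zero>)"
  using assms(3-6)
proof (induction I arbitrary: J A rule: finite_induct)
  case empty
  then have "J \<noteq> {}" by auto
  then show ?case using subringE(3)[OF E(1)] by (intro exI[of _ "\<lambda>_. \<one>"]) auto
next
  case (insert a I)
  note ES = subringE[OF E(1)]
  have EC: "x \<in> carrier R" if "x \<in> E" for x using that ES(1) by blast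
  show ?case
  proof (cases "\<forall>j\<in>J. A a j = \<zero>")
    case True
    have "card I < card J" using insert by simp
    moreover have "\<And>i j. i \<in> I \<Longrightarrow> j \<in> J \<Longrightarrow> A i j \<in> E" using insert by blast
    ultimately obtain w where w: "\<forall>j. w j \<in> E" "\<exists>j\<in>J. w j \<noteq> \<zero>"
        "\<forall>i\<in>I. (\<Oplus>j\<in>J. A i j \<otimes> w j) = \<zero>"
      using insert.IH[OF insert.prems(1)] by blast
    have "(\<Oplus>j\<in>J. A a j \<otimes> w j) = \<zero>"
      using True w(1) EC by (intro add.finprod_one_eqI) auto
    then show ?thesis using w by (intro exI[of _ w]) auto
  next
    case False
    then obtain q where q: "q \<in> J" "A a q \<noteq> \<zero>" by blast
    \<comment> \<open>Row \<open>a\<close> is solved for the unknown with index \<open>q\<close>;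
      \<open>B\<close> is the system left for the other rows after column \<open>q\<close> has been
      cleared.\<close>
    define p where "p = inv (A a q)"
    have Aq: "A a q \<in> E" using insert q by auto
    have p: "p \<in> E" "A a q \<otimes> p = \<one>" unfolding p_def using E(2) Aq q EC by auto
    define J' where "J' = J - {q}"
    have J': "finite J'" "card I < card J'" "J' \<subseteq> J" using insert q by (auto simp: J'_def)
    define B where "B i j = A i j \<ominus> A i q \<otimes> p \<otimes> A a j" for i j
    have AE: "A i j \<in> E" if "i \<in> insert a I" "j \<in> J" for i j using insert.prems that by blast
    have BE: "B i j \<in> E" if "i \<in> I" "j \<in> J'" for i j
      unfolding B_def a_minus_def using that J' q p AE ES by auto
    obtain w where w: "\<forall>j. w j \<in> E" "\<exists>j\<in>J'. w j \<noteq> \<zero>" "\<forall>i\<in>I. (\<Oplus>j\<in>J'. B i j \<otimes> w j) = \<zero>"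
      using insert.IH[of J' B] J' BE by blast
    define s where "s = (\<Oplus>j\<in>J'. A a j \<otimes> w j)"
    have s: "s \<in> E" unfolding s_def using w AE J' ES by (intro finsum_in_subring[OF E(1)]) auto
    \<comment> \<open>Back substitution: this value at \<open>q\<close> makes row \<open>a\<close>
      hold.\<close>
    define v where "v = w(q := \<ominus> (p \<otimes> s))"
    have v: "v j \<in> E" for j unfolding v_def using w s p ES by auto
    have split: "(\<Oplus>j\<in>J. A i j \<otimes> v j) = \<ominus> (A i q \<otimes> p \<otimes> s) \<oplus> (\<Oplus>j\<in>J'. A i j \<otimes> w j)"
      if i: "i \<in> insert a I" for i
    proof -
      have "(\<Oplus>j\<in>J. A i j \<otimes> v j) = A i q \<otimes> v q \<oplus> (\<Oplus>j\<in>J'. A i j \<otimes> v j)"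
        unfolding J'_def using insert(4) q i v AE EC by (intro finsum_remove) auto
      also have "A i q \<otimes> v q = \<ominus> (A i q \<otimes> p \<otimes> s)"
        using i q AE p s EC by (simp add: v_def r_minus m_assoc)
      also have "(\<Oplus>j\<in>J'. A i j \<otimes> v j) = (\<Oplus>j\<in>J'. A i j \<otimes> w j)"
        by (rule finsum_cong') (use i AE EC w J' in \<open>auto simp: v_def J'_def\<close>)
      finally show ?thesis .
    qed
    have "(\<Oplus>j\<in>J. A i j \<otimes> v j) = \<zero>" if i: "i \<in> insert a I" for i
    proof (cases "i = a")
      case True
      then show ?thesis using split[OF i] p s EC Aq by (simp add: s_def[symmetric] l_neg)
    next
      case False
      then have i': "i \<in> I" using i by auto
      have "\<zero> = (\<Oplus>j\<in>J'. B i j \<otimes> w j)" using w i' by auto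
      also have "\<dots> = (\<Oplus>j\<in>J'. A i j \<otimes> w j \<ominus> A i q \<otimes> p \<otimes> (A a j \<otimes> w j))"
      proof (rule finsum_cong')
        fix j assume j: "j \<in> J'"
        then have "A i j \<in> carrier R" "A i q \<in> carrier R" "A a j \<in> carrier R" "w j \<in> carrier R"
          "p \<in> carrier R" using i q J' AE EC w p by auto
        then show "B i j \<otimes> w j = A i j \<otimes> w j \<ominus> A i q \<otimes> p \<otimes> (A a j \<otimes> w j)"
          unfolding B_def a_minus_def by (simp add: l_distr l_minus m_assoc)
      qed (use i q J' AE EC w p in auto)
      also have "\<dots> = (\<Oplus>j\<in>J'. A i j \<otimes> w j) \<ominus> (\<Oplus>j\<in>J'. A i q \<otimes> p \<otimes> (A a j \<otimes> w j))"
        using i q J' AE EC w p by (intro finsum_minus) auto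
      also have "(\<Oplus>j\<in>J'. A i q \<otimes> p \<otimes> (A a j \<otimes> w j)) = A i q \<otimes> p \<otimes> s"
        unfolding s_def using i q J' AE EC w p by (intro finsum_rdistr[symmetric]) auto
      finally have e: "(\<Oplus>j\<in>J'. A i j \<otimes> w j) \<ominus> A i q \<otimes> p \<otimes> s = \<zero>" by simp
      have "(\<Oplus>j\<in>J'. A i j \<otimes> w j) \<in> carrier R" "A i q \<otimes> p \<otimes> s \<in> carrier R"
        using i q J' AE EC w p s by (auto intro!: finsum_closed)
      then show ?thesis using e split[OF i] by (simp add: a_minus_def a_comm)
    qed
    moreover have "\<exists>j\<in>J. v j \<noteq> \<zero>" using w(2) J' by (auto simp: v_def J'_def)
    ultimately show ?thesis using v by blast
  qed
qed

text \<open>If \<open>w\<close> has minimal support and a coefficient \<open>\<one>\<close>, then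
  all its coefficients commute with \<open>C\<close>: otherwise \<open>c' w - w c'\<close> would
  have smaller support.\<close>

lemma bimodule_relation:
  fixes u w :: "'i \<Rightarrow> 'a"
  assumes "finite I" "\<And>i. i \<in> I \<Longrightarrow> u i \<in> carrier R" "\<And>i. i \<in> I \<Longrightarrow> w i \<in> carrier R"
    and C: "C \<subseteq> carrier R" "\<one> \<in> C" "\<And>c c'. c \<in> C \<Longrightarrow> c' \<in> C \<Longrightarrow> c \<otimes> c' \<in> C"
    and "\<And>c. c \<in> C \<Longrightarrow> (\<Oplus>i\<in>I. u i \<otimes> c \<otimes> w i) = \<zero>"
    and "\<exists>i\<in>I. w i \<noteq> \<zero>"
  shows "\<exists>\<zeta>. (\<forall>i\<in>I. \<zeta> i \<in> carrier R \<and> (\<forall>c\<in>C. c \<otimes> \<zeta> i = \<zeta> i \<otimes> c)) \<and> (\<exists>i\<in>I. \<zeta> i \<noteq> \<zero>) \<and>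
    (\<Oplus>i\<in>I. u i \<otimes> \<zeta> i) = \<zero>"
  using assms(3,7,8)
proof (induction "card {i\<in>I. w i \<noteq> \<zero>}" arbitrary: w rule: less_induct)
  case less
  obtain q where q: "q \<in> I" "w q \<noteq> \<zero>" using less.prems by blast
  note u = assms(2)
  have wq: "w q \<in> carrier R" "inv (w q) \<in> carrier R" using less.prems q by auto
  define v where "v i = w i \<otimes> inv (w q)" for i
  have v: "v i \<in> carrier R" if "i \<in> I" for i using that less.prems wq by (auto simp: v_def)
  have vq: "v q = \<one>" using wq q by (simp add: v_def)
  have v0: "v i = \<zero> \<longleftrightarrow> w i = \<zero>" if "i \<in> I" for i using that less.prems wq q by (simp add: v_def)
  have rel: "(\<Oplus>i\<in>I. u i \<otimes> c \<otimes> v i) = \<zero>" if c: "c \<in> C" for c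
  proof -
    have cc: "c \<in> carrier R" using c C by auto
    have "(\<Oplus>i\<in>I. u i \<otimes> c \<otimes> v i) = (\<Oplus>i\<in>I. (u i \<otimes> c \<otimes> w i) \<otimes> inv (w q))"
      using cc u less.prems(1) wq by (intro finsum_cong') (auto simp: v_def m_assoc)
    also have "\<dots> = (\<Oplus>i\<in>I. u i \<otimes> c \<otimes> w i) \<otimes> inv (w q)"
      using cc u less.prems(1) wq assms(1) by (intro finsum_ldistr[symmetric]) auto
    finally show ?thesis using less.prems(2)[OF c] wq by simp
  qed
  show ?case
  proof (cases "\<forall>i\<in>I. \<forall>c\<in>C. c \<otimes> v i = v i \<otimes> c")
    case True
    have "(\<Oplus>i\<in>I. u i \<otimes> v i) = (\<Oplus>i\<in>I. u i \<otimes> \<one> \<otimes> v i)"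
      using u v by (intro finsum_cong') auto
    then have "(\<Oplus>i\<in>I. u i \<otimes> v i) = \<zero>" using rel[OF C(2)] by simp
    moreover have "\<exists>i\<in>I. v i \<noteq> \<zero>" using q vq by (intro bexI[of _ q]) auto
    ultimately show ?thesis using True v by blast
  next
    case False
    then obtain k c' where k: "k \<in> I" "c' \<in> C" "c' \<otimes> v k \<noteq> v k \<otimes> c'" by blast
    have cc': "c' \<in> carrier R" using k C by auto
    define w' where "w' i = c' \<otimes> v i \<ominus> v i \<otimes> c'" for i
    have w': "w' i \<in> carrier R" if "i \<in> I" for i using that v cc' by (auto simp: w'_def)
    have "w' q = \<zero>" using vq cc' by (simp add: w'_def a_minus_def r_neg)
    moreover have w0: "w' i = \<zero>" if "i \<in> I" "w i = \<zero>" for i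
      using that v0[of i] cc' by (simp add: w'_def a_minus_def)
    ultimately have "{i\<in>I. w' i \<noteq> \<zero>} \<subset> {i\<in>I. w i \<noteq> \<zero>}" using q by blast
    then have "card {i\<in>I. w' i \<noteq> \<zero>} < card {i\<in>I. w i \<noteq> \<zero>}"
      using assms(1) by (intro psubset_card_mono) auto
    \<comment> \<open>The relation for \<open>c \<otimes> c'\<close> minus the relation for
      \<open>c\<close> multiplied by \<open>c'\<close> on the right; this is why \<open>C\<close>
      must be closed under products.\<close>
    moreover have "(\<Oplus>i\<in>I. u i \<otimes> c \<otimes> w' i) = \<zero>" if c: "c \<in> C" for c
    proof -
      have cc: "c \<in> carrier R" using c C by auto
      have "(\<Oplus>i\<in>I. u i \<otimes> c \<otimes> w' i)
          = (\<Oplus>i\<in>I. u i \<otimes> (c \<otimes> c') \<otimes> v i \<ominus> (u i \<otimes> c \<otimes> v i) \<otimes> c')"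
        using cc cc' u v by (intro finsum_cong') (auto simp: w'_def a_minus_def r_distr r_minus m_assoc)
      also have "\<dots> = (\<Oplus>i\<in>I. u i \<otimes> (c \<otimes> c') \<otimes> v i) \<ominus> (\<Oplus>i\<in>I. (u i \<otimes> c \<otimes> v i) \<otimes> c')"
        using cc cc' u v by (intro finsum_minus) auto
      also have "(\<Oplus>i\<in>I. (u i \<otimes> c \<otimes> v i) \<otimes> c') = (\<Oplus>i\<in>I. u i \<otimes> c \<otimes> v i) \<otimes> c'"
        using cc cc' u v assms(1) by (intro finsum_ldistr[symmetric]) auto
      finally show ?thesis using rel[OF c] rel[OF C(3)[OF c k(2)]] cc' by (simp add: a_minus_def)
    qed
    moreover have "\<exists>i\<in>I. w' i \<noteq> \<zero>"
      using k v cc' by (intro bexI[of _ k]) (auto simp: w'_def r_right_minus_eq)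
    ultimately show ?thesis using less.hyps[of w'] w' by blast
  qed
qed

end

section \<open>Linear dependence over the center\<close>

text \<open>Indexed families instead of sets, so that a repetition among the powers of a torsion
  element counts as a dependence.\<close>

definition (in ring) lin_dep :: "'a set \<Rightarrow> 'i set \<Rightarrow> ('i \<Rightarrow> 'a) \<Rightarrow> bool"
  where "lin_dep K J v \<longleftrightarrow>
    (\<exists>\<alpha>. (\<forall>j. \<alpha> j \<in> K) \<and> (\<exists>j\<in>J. \<alpha> j \<noteq> \<zero>) \<and> (\<Oplus>j\<in>J. \<alpha> j \<otimes> v j) = \<zero>)"

definition (in ring) lin_span :: "'a set \<Rightarrow> 'i set \<Rightarrow> ('i \<Rightarrow> 'a) \<Rightarrow> 'a set"
  where "lin_span K I v = {\<Oplus>i\<in>I. \<alpha> i \<otimes> v i | \<alpha>. \<forall>i. \<alpha> i \<in> K}"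

lemma (in ring) finsum_nested:
  assumes "finite I" "finite J" "\<And>j. j \<in> J \<Longrightarrow> c j \<in> carrier R"
    "\<And>i j. i \<in> I \<Longrightarrow> j \<in> J \<Longrightarrow> A j i \<in> carrier R" "\<And>i. i \<in> I \<Longrightarrow> v i \<in> carrier R"
  shows "(\<Oplus>j\<in>J. c j \<otimes> (\<Oplus>i\<in>I. A j i \<otimes> v i)) = (\<Oplus>i\<in>I. (\<Oplus>j\<in>J. c j \<otimes> A j i) \<otimes> v i)"
proof -
  have "(\<Oplus>j\<in>J. c j \<otimes> (\<Oplus>i\<in>I. A j i \<otimes> v i)) = (\<Oplus>j\<in>J. \<Oplus>i\<in>I. c j \<otimes> A j i \<otimes> v i)"
  proof (rule finsum_cong')
    fix j assume j: "j \<in> J"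
    have "c j \<otimes> (\<Oplus>i\<in>I. A j i \<otimes> v i) = (\<Oplus>i\<in>I. c j \<otimes> (A j i \<otimes> v i))"
      using assms j by (intro finsum_rdistr) auto
    also have "\<dots> = (\<Oplus>i\<in>I. c j \<otimes> A j i \<otimes> v i)"
      using assms j by (intro finsum_cong') (auto simp: m_assoc)
    finally show "c j \<otimes> (\<Oplus>i\<in>I. A j i \<otimes> v i) = (\<Oplus>i\<in>I. c j \<otimes> A j i \<otimes> v i)" .
  qed (use assms in \<open>auto intro!: finsum_closed\<close>)
  also have "\<dots> = (\<Oplus>i\<in>I. \<Oplus>j\<in>J. c j \<otimes> A j i \<otimes> v i)"
    using assms by (intro finsum_swap) auto
  also have "\<dots> = (\<Oplus>i\<in>I. (\<Oplus>j\<in>J. c j \<otimes> A j i) \<otimes> v i)"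
  proof (rule finsum_cong')
    fix i assume i: "i \<in> I"
    show "(\<Oplus>j\<in>J. c j \<otimes> A j i \<otimes> v i) = (\<Oplus>j\<in>J. c j \<otimes> A j i) \<otimes> v i"
      using assms i by (intro finsum_ldistr[symmetric]) auto
  qed (use assms in \<open>auto intro!: finsum_closed\<close>)
  finally show ?thesis .
qed

context skew_field
begin

abbreviation Z where "Z \<equiv> ring_center R"

lemma Z_subring: "subring Z R"
  using subfieldE(1)[OF ring_center_subfield] subcring.axioms(1) by blast

lemma Z_carrier [simp]: "z \<in> Z \<Longrightarrow> z \<in> carrier R"
  by (simp add: ring_center_def)

lemma Z_comm: "z \<in> Z \<Longrightarrow> x \<in> carrier R \<Longrightarrow> x \<otimes> z = z \<otimes> x"
  unfolding ring_center_def by (rule sym) blast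

lemma Z_lcomm: "z \<in> Z \<Longrightarrow> x \<in> carrier R \<Longrightarrow> y \<in> carrier R \<Longrightarrow> x \<otimes> (z \<otimes> y) = z \<otimes> (x \<otimes> y)"
  by (simp add: m_assoc[symmetric] Z_comm[of z x])

lemma Z_I: "z \<in> carrier R \<Longrightarrow> (\<And>x. x \<in> carrier R \<Longrightarrow> z \<otimes> x = x \<otimes> z) \<Longrightarrow> z \<in> Z"
  unfolding ring_center_def by blast

lemma Z_closed [simp]:
  "\<zero> \<in> Z" "\<one> \<in> Z" "x \<in> Z \<Longrightarrow> \<ominus> x \<in> Z" "x \<in> Z \<Longrightarrow> y \<in> Z \<Longrightarrow> x \<oplus> y \<in> Z" "x \<in> Z \<Longrightarrow> y \<in> Z \<Longrightarrow> x \<otimes> y \<in> Z"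
  "x \<in> Z \<Longrightarrow> y \<in> Z \<Longrightarrow> x \<ominus> y \<in> Z"
  using subringE[OF Z_subring] by (auto simp: a_minus_def)

lemma Z_inv [simp]: "x \<in> Z \<Longrightarrow> x \<noteq> \<zero> \<Longrightarrow> inv x \<in> Z"
  using subfield_m_inv(1)[OF ring_center_subfield] by blast

lemma Z_pow [simp]: "x \<in> Z \<Longrightarrow> x [^] (n::nat) \<in> Z"
  by (induction n) auto

lemma Z_finsum [simp]: "(\<And>i. i \<in> A \<Longrightarrow> f i \<in> Z) \<Longrightarrow> (\<Oplus>i\<in>A. f i) \<in> Z"
  by (rule finsum_in_subring[OF Z_subring])

lemma lin_span_carrier: "(\<And>i. i \<in> I \<Longrightarrow> v i \<in> carrier R) \<Longrightarrow> lin_span Z I v \<subseteq> carrier R"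
  by (auto simp: lin_span_def intro!: finsum_closed)

lemma lin_span_zero:
  assumes "\<And>i. i \<in> I \<Longrightarrow> v i \<in> carrier R"
  shows "\<zero> \<in> lin_span Z I v"
proof -
  have "(\<Oplus>i\<in>I. \<zero> \<otimes> v i) = \<zero>" using assms by (intro add.finprod_one_eqI) auto
  then show ?thesis unfolding lin_span_def by (intro CollectI exI[of _ "\<lambda>_. \<zero>"]) auto
qed

lemma lin_span_add:
  assumes "\<And>i. i \<in> I \<Longrightarrow> v i \<in> carrier R" "p \<in> lin_span Z I v" "q \<in> lin_span Z I v"
  shows "p \<oplus> q \<in> lin_span Z I v"
proof -
  obtain \<alpha> \<beta> where a: "\<And>i. \<alpha> i \<in> Z" "p = (\<Oplus>i\<in>I. \<alpha> i \<otimes> v i)" and b: "\<And>i. \<beta> i \<in> Z" "q = (\<Oplus>i\<in>I. \<beta> i \<otimes> v i)"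
    using assms(2,3) by (auto simp: lin_span_def)
  have "p \<oplus> q = (\<Oplus>i\<in>I. \<alpha> i \<otimes> v i \<oplus> \<beta> i \<otimes> v i)"
    unfolding a b using a(1) b(1) assms(1) by (intro finsum_addf[symmetric]) auto
  also have "\<dots> = (\<Oplus>i\<in>I. (\<alpha> i \<oplus> \<beta> i) \<otimes> v i)"
    using a(1) b(1) assms(1) by (intro finsum_cong') (auto simp: l_distr)
  finally show ?thesis using a(1) b(1) unfolding lin_span_def
    by (intro CollectI exI[of _ "\<lambda>i. \<alpha> i \<oplus> \<beta> i"]) auto
qed

lemma lin_span_smult:
  assumes "\<And>i. i \<in> I \<Longrightarrow> v i \<in> carrier R" "finite I" "p \<in> lin_span Z I v" "c \<in> Z"
  shows "c \<otimes> p \<in> lin_span Z I v"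
proof -
  obtain \<alpha> where a: "\<And>i. \<alpha> i \<in> Z" "p = (\<Oplus>i\<in>I. \<alpha> i \<otimes> v i)"
    using assms(3) by (auto simp: lin_span_def)
  have "c \<otimes> p = (\<Oplus>i\<in>I. c \<otimes> (\<alpha> i \<otimes> v i))"
    unfolding a using a(1) assms by (intro finsum_rdistr) auto
  also have "\<dots> = (\<Oplus>i\<in>I. (c \<otimes> \<alpha> i) \<otimes> v i)"
    using a(1) assms by (intro finsum_cong') (auto simp: m_assoc)
  finally show ?thesis using a(1) assms(4) unfolding lin_span_def
    by (intro CollectI exI[of _ "\<lambda>i. c \<otimes> \<alpha> i"]) auto
qed

lemma lin_span_base:
  assumes "\<And>i. i \<in> I \<Longrightarrow> v i \<in> carrier R" "finite I" "k \<in> I"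
  shows "v k \<in> lin_span Z I v"
proof -
  have "(\<Oplus>i\<in>I. (if k = i then \<one> else \<zero>) \<otimes> v i) = (\<Oplus>i\<in>I. if k = i then v i else \<zero>)"
    using assms by (intro finsum_cong') auto
  also have "\<dots> = v k" using assms by (intro finsum_singleton) auto
  finally show ?thesis unfolding lin_span_def
    by (intro CollectI exI[of _ "\<lambda>i. if k = i then \<one> else \<zero>"]) auto
qed

lemma lin_span_finsum:
  assumes "\<And>i. i \<in> I \<Longrightarrow> v i \<in> carrier R" "\<And>j. j \<in> J \<Longrightarrow> p j \<in> lin_span Z I v"
  shows "(\<Oplus>j\<in>J. p j) \<in> lin_span Z I v"
proof (cases "finite J")
  case True
  have c: "p j \<in> carrier R" if "j \<in> J" for j
    using assms(2)[OF that] lin_span_carrier[of I v] assms(1) by auto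
  show ?thesis using True assms(2) c
  proof (induction J rule: finite_induct)
    case (insert a J)
    then have "(\<Oplus>j\<in>insert a J. p j) = p a \<oplus> (\<Oplus>j\<in>J. p j)"
      by (intro finsum_insert) auto
    then show ?case using insert assms(1) by (auto intro!: lin_span_add)
  qed (use lin_span_zero[OF assms(1)] in simp)
qed (use lin_span_zero[OF assms(1)] in simp)

text \<open>The coordinates of the \<open>w j\<close> form \<open>card I\<close> central equations
  in \<open>card J\<close> unknowns.\<close>

lemma lin_dep_of_span:
  assumes "finite I" "finite J" "card I < card J" "\<And>i. i \<in> I \<Longrightarrow> v i \<in> carrier R"
    "\<And>j. j \<in> J \<Longrightarrow> w j \<in> lin_span Z I v"
  shows "lin_dep Z J w"
proof -
  have "\<forall>j\<in>J. \<exists>\<alpha>. (\<forall>i. \<alpha> i \<in> Z) \<and> w j = (\<Oplus>i\<in>I. \<alpha> i \<otimes> v i)"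
    using assms(5) by (auto simp: lin_span_def)
  then obtain A where "\<forall>j\<in>J. (\<forall>i. A j i \<in> Z) \<and> w j = (\<Oplus>i\<in>I. A j i \<otimes> v i)"
    by (rule bchoice[THEN exE])
  then have A: "\<And>j i. j \<in> J \<Longrightarrow> A j i \<in> Z" "\<And>j. j \<in> J \<Longrightarrow> w j = (\<Oplus>i\<in>I. A j i \<otimes> v i)"
    by auto
  obtain c where c: "\<forall>j. c j \<in> Z" "\<exists>j\<in>J. c j \<noteq> \<zero>" "\<forall>i\<in>I. (\<Oplus>j\<in>J. A j i \<otimes> c j) = \<zero>"
    using homogeneous_system[OF Z_subring Z_inv assms(1-3), of "\<lambda>i j. A j i"] A by blast
  have "(\<Oplus>j\<in>J. c j \<otimes> w j) = (\<Oplus>j\<in>J. c j \<otimes> (\<Oplus>i\<in>I. A j i \<otimes> v i))"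
    using A c assms(4) by (intro finsum_cong') (auto intro!: finsum_closed)
  also have "\<dots> = (\<Oplus>i\<in>I. (\<Oplus>j\<in>J. c j \<otimes> A j i) \<otimes> v i)"
    using A c assms by (intro finsum_nested) auto
  also have "\<dots> = \<zero>"
  proof (rule add.finprod_one_eqI)
    fix i assume i: "i \<in> I"
    have "(\<Oplus>j\<in>J. c j \<otimes> A j i) = (\<Oplus>j\<in>J. A j i \<otimes> c j)"
      using A c by (intro finsum_cong') (auto simp: Z_comm)
    then show "(\<Oplus>j\<in>J. c j \<otimes> A j i) \<otimes> v i = \<zero>\<^bsub>R\<^esub>" using c i assms(4) by simp
  qed
  finally show ?thesis using c unfolding lin_dep_def by blast
qed

lemma lin_dep_mono:
  assumes "lin_dep Z I v" "I \<subseteq> J" "finite J" "\<And>j. j \<in> J \<Longrightarrow> v j \<in> carrier R"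
  shows "lin_dep Z J v"
proof -
  obtain \<alpha> where a: "\<forall>j. \<alpha> j \<in> Z" "\<exists>j\<in>I. \<alpha> j \<noteq> \<zero>" "(\<Oplus>j\<in>I. \<alpha> j \<otimes> v j) = \<zero>"
    using assms(1) unfolding lin_dep_def by blast
  define \<beta> where "\<beta> j = (if j \<in> I then \<alpha> j else \<zero>)" for j
  have "(\<Oplus>j\<in>I. \<alpha> j \<otimes> v j) = (\<Oplus>j\<in>J. \<beta> j \<otimes> v j)"
    using assms a by (intro add.finprod_mono_neutral_cong_left) (auto simp: \<beta>_def subset_iff)
  then show ?thesis using a assms(2) unfolding lin_dep_def by (intro exI[of _ \<beta>]) (auto simp: \<beta>_def)
qed

section \<open>Powers of a single element and the field F(x)\<close>

abbreviation pow_sum :: "nat \<Rightarrow> (nat \<Rightarrow> 'a) \<Rightarrow> 'a \<Rightarrow> 'a"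
  where "pow_sum n \<alpha> x \<equiv> \<Oplus>i\<in>{..<n}. \<alpha> i \<otimes> x [^] i"

text \<open>Degree at most \<open>n\<close> over the center is \<open>pow_dep (Suc
  n)\<close>.\<close>

abbreviation pow_dep :: "nat \<Rightarrow> 'a \<Rightarrow> bool"
  where "pow_dep n x \<equiv> lin_dep Z {..<n} (\<lambda>i. x [^] i)"

text \<open>When \<open>k\<close> is the degree of \<open>x\<close>, that is, under
  \<open>pow_dep (Suc k) x\<close> and \<open>\<not> pow_dep k x\<close>,
  \<open>pow_span k x\<close> is the field F(x): see \<open>pow_span_mult\<close> and
  \<open>pow_span_div\<close>.\<close>

abbreviation pow_span :: "nat \<Rightarrow> 'a \<Rightarrow> 'a set"
  where "pow_span n x \<equiv> lin_span Z {..<n} (\<lambda>i. x [^] i)"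

lemma pow_dep_0 [simp]: "\<not> pow_dep 0 x"
  by (simp add: lin_dep_def)

lemma pow_dep_mono: "pow_dep n x \<Longrightarrow> n \<le> m \<Longrightarrow> x \<in> carrier R \<Longrightarrow> pow_dep m x"
  by (rule lin_dep_mono) auto

lemma lin_span_commute:
  assumes "u \<in> carrier R" "\<And>i. i \<in> I \<Longrightarrow> v i \<in> carrier R" "\<And>i. i \<in> I \<Longrightarrow> u \<otimes> v i = v i \<otimes> u"
    and "p \<in> lin_span Z I v" "finite I"
  shows "u \<otimes> p = p \<otimes> u"
proof -
  obtain \<alpha> where a: "\<And>i. \<alpha> i \<in> Z" "p = (\<Oplus>i\<in>I. \<alpha> i \<otimes> v i)"
    using assms(4) by (auto simp: lin_span_def)
  have "u \<otimes> p = (\<Oplus>i\<in>I. u \<otimes> (\<alpha> i \<otimes> v i))"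
    unfolding a using a(1) assms by (intro finsum_rdistr) auto
  also have "\<dots> = (\<Oplus>i\<in>I. (\<alpha> i \<otimes> v i) \<otimes> u)"
  proof (rule finsum_cong')
    fix i assume i: "i \<in> I"
    show "u \<otimes> (\<alpha> i \<otimes> v i) = (\<alpha> i \<otimes> v i) \<otimes> u"
      using Z_lcomm[of "\<alpha> i" u "v i"] a(1) assms(1-3) i by (simp add: m_assoc)
  qed (use a(1) assms in auto)
  also have "\<dots> = p \<otimes> u"
    unfolding a using a(1) assms by (intro finsum_ldistr[symmetric]) auto
  finally show ?thesis .
qed

lemma pow_commute:
  assumes "x \<in> carrier R" "u \<in> carrier R" "u \<otimes> x = x \<otimes> u"
  shows "u \<otimes> x [^] (i::nat) = x [^] i \<otimes> u"
proof (induction i)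
  case (Suc i)
  have "u \<otimes> (x [^] i \<otimes> x) = (u \<otimes> x [^] i) \<otimes> x" using assms by (simp add: m_assoc)
  also have "\<dots> = x [^] i \<otimes> (u \<otimes> x)" unfolding Suc using assms by (simp add: m_assoc)
  finally show ?case using assms by (simp add: m_assoc)
qed (use assms in simp)

lemma pow_span_commute:
  assumes "x \<in> carrier R" "u \<in> carrier R" "u \<otimes> x = x \<otimes> u" "p \<in> pow_span k x"
  shows "u \<otimes> p = p \<otimes> u"
  using assms by (intro lin_span_commute[OF _ _ _ assms(4)] pow_commute) auto

lemma pow_span_carrier [simp]: "p \<in> pow_span k x \<Longrightarrow> x \<in> carrier R \<Longrightarrow> p \<in> carrier R"
  using lin_span_carrier[of "{..<k}" "\<lambda>i. x [^] i"] by auto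

lemma pow_relation_lead:
  assumes "x \<in> carrier R" "\<not> pow_dep k x"
    "\<And>i. \<alpha> i \<in> Z" "\<exists>i<Suc k. \<alpha> i \<noteq> \<zero>" "pow_sum (Suc k) \<alpha> x = \<zero>"
  shows "\<alpha> k \<noteq> \<zero>"
proof
  assume 0: "\<alpha> k = \<zero>"
  have "pow_sum (Suc k) \<alpha> x = \<alpha> k \<otimes> x [^] k \<oplus> pow_sum k \<alpha> x"
    unfolding lessThan_Suc using assms by (intro finsum_insert) auto
  then have "pow_sum k \<alpha> x = \<zero>" using assms 0 by (simp add: finsum_closed)
  moreover have "\<exists>i\<in>{..<k}. \<alpha> i \<noteq> \<zero>" using assms(4) 0 by (auto simp: less_Suc_eq)
  ultimately have "pow_dep k x" unfolding lin_dep_def using assms(3) by blast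
  then show False using assms by simp
qed

lemma monic_relation:
  assumes "x \<in> carrier R" "pow_dep (Suc k) x" "\<not> pow_dep k x"
  shows "\<exists>\<mu>. (\<forall>i. \<mu> i \<in> Z) \<and> \<mu> k = \<one> \<and> pow_sum (Suc k) \<mu> x = \<zero>"
proof -
  obtain \<alpha> where a: "\<And>i. \<alpha> i \<in> Z" "\<exists>i<Suc k. \<alpha> i \<noteq> \<zero>" "pow_sum (Suc k) \<alpha> x = \<zero>"
    using assms(2) unfolding lin_dep_def by blast
  have ak: "\<alpha> k \<noteq> \<zero>" by (rule pow_relation_lead[OF assms(1,3) a])
  define \<mu> where "\<mu> i = inv (\<alpha> k) \<otimes> \<alpha> i" for i
  have m: "\<mu> i \<in> Z" for i using a ak by (simp add: \<mu>_def)
  have "pow_sum (Suc k) \<mu> x = (\<Oplus>i\<in>{..<Suc k}. inv (\<alpha> k) \<otimes> (\<alpha> i \<otimes> x [^] i))"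
    using a ak assms by (intro finsum_cong') (auto simp: \<mu>_def m_assoc)
  also have "\<dots> = inv (\<alpha> k) \<otimes> pow_sum (Suc k) \<alpha> x"
    using a ak assms by (intro finsum_rdistr[symmetric]) auto
  finally show ?thesis using a ak m by (intro exI[of _ \<mu>]) (auto simp: \<mu>_def)
qed

lemma pow_span_pow:
  assumes "x \<in> carrier R" "pow_dep (Suc k) x" "\<not> pow_dep k x"
  shows "x [^] k \<in> pow_span k x"
proof -
  obtain \<mu> where m: "\<And>i. \<mu> i \<in> Z" "\<mu> k = \<one>" "pow_sum (Suc k) \<mu> x = \<zero>"
    using monic_relation[OF assms] by blast
  have "pow_sum (Suc k) \<mu> x = \<mu> k \<otimes> x [^] k \<oplus> pow_sum k \<mu> x"
    unfolding lessThan_Suc using assms m by (intro finsum_insert) auto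
  moreover have s: "pow_sum k \<mu> x \<in> pow_span k x"
    using m unfolding lin_span_def by blast
  ultimately have "x [^] k \<oplus> pow_sum k \<mu> x = \<zero>" using assms m by simp
  then have "\<ominus> pow_sum k \<mu> x = x [^] k"
    using assms s by (intro minus_equality) auto
  then have "x [^] k = \<ominus> \<one> \<otimes> pow_sum k \<mu> x"
    using assms s by (simp add: l_minus)
  then show ?thesis using s assms by (auto intro!: lin_span_smult)
qed

lemma pow_span_mult:
  assumes x: "x \<in> carrier R" and k: "pow_dep (Suc k) x" "\<not> pow_dep k x"
    and pq: "p \<in> pow_span k x" "q \<in> pow_span k x"
  shows "p \<otimes> q \<in> pow_span k x"
proof -
  have 1: "x \<otimes> r \<in> pow_span k x" if r: "r \<in> pow_span k x" for r
  proof -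
    obtain \<alpha> where a: "\<And>i. \<alpha> i \<in> Z" "r = pow_sum k \<alpha> x"
      using r by (auto simp: lin_span_def)
    have "x \<otimes> r = (\<Oplus>i\<in>{..<k}. x \<otimes> (\<alpha> i \<otimes> x [^] i))"
      unfolding a using a(1) x by (intro finsum_rdistr) auto
    also have "\<dots> = (\<Oplus>i\<in>{..<k}. \<alpha> i \<otimes> x [^] Suc i)"
    proof (rule finsum_cong')
      fix i :: nat
      show "x \<otimes> (\<alpha> i \<otimes> x [^] i) = \<alpha> i \<otimes> x [^] Suc i"
        using Z_lcomm[of "\<alpha> i" x "x [^] i"] a(1) x pow_commute[of x x i] by simp
    qed (use a(1) x in auto)
    also have "\<dots> \<in> pow_span k x"
    proof (intro lin_span_finsum lin_span_smult)
      fix i assume "i \<in> {..<k}"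
      then show "x [^] Suc i \<in> pow_span k x"
        using pow_span_pow[OF x k] lin_span_base[of "{..<k}" "\<lambda>i. x [^] i" "Suc i"] x
        by (cases "Suc i = k") auto
    qed (use a x in auto)
    finally show ?thesis .
  qed
  have qc: "q \<in> carrier R" using pq x by simp
  have 2: "x [^] i \<otimes> q \<in> pow_span k x" for i :: nat
  proof (induction i)
    case (Suc i)
    have "x [^] Suc i \<otimes> q = x \<otimes> (x [^] i \<otimes> q)" using x qc nat_pow_Suc2[OF x, of i] by (simp add: m_assoc[symmetric])
    then show ?case using 1[OF Suc] by simp
  qed (use pq qc in simp)
  obtain \<alpha> where a: "\<And>i. \<alpha> i \<in> Z" "p = pow_sum k \<alpha> x"
    using pq by (auto simp: lin_span_def)
  have "p \<otimes> q = (\<Oplus>i\<in>{..<k}. \<alpha> i \<otimes> x [^] i \<otimes> q)"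
    unfolding a using a(1) x qc by (intro finsum_ldistr) auto
  also have "\<dots> = (\<Oplus>i\<in>{..<k}. \<alpha> i \<otimes> (x [^] i \<otimes> q))"
    using a(1) x qc by (intro finsum_cong') (auto simp: m_assoc)
  also have "\<dots> \<in> pow_span k x"
  proof (rule lin_span_finsum)
    fix i
    show "\<alpha> i \<otimes> (x [^] i \<otimes> q) \<in> pow_span k x" by (rule lin_span_smult) (use 2 a x in auto)
  qed (use x in auto)
  finally show ?thesis .
qed

text \<open>The \<open>k\<close> products \<open>q \<otimes> x [^] i\<close> together with
  \<open>p\<close> are \<open>k + 1\<close> elements in the span of \<open>k\<close> powers. In a
  dependence among them \<open>p\<close> must occur, since \<open>q \<otimes> t = \<zero>\<close>
  would force \<open>t = \<zero>\<close>, a relation shorter than the degree permits. Solving for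
  \<open>p\<close> gives the quotient.\<close>

lemma pow_span_div:
  assumes x: "x \<in> carrier R" and k: "pow_dep (Suc k) x" "\<not> pow_dep k x"
    and pq: "p \<in> pow_span k x" "q \<in> pow_span k x" "q \<noteq> \<zero>"
  shows "\<exists>s\<in>pow_span k x. p = q \<otimes> s"
proof -
  define w where "w i = (if i < k then q \<otimes> x [^] i else p)" for i
  have qc: "q \<in> carrier R" "p \<in> carrier R" using pq x by auto
  have "lin_dep Z {..<Suc k} w"
  proof (rule lin_dep_of_span[where I = "{..<k}" and v = "\<lambda>i. x [^] i"])
    fix j assume "j \<in> {..<Suc k}"
    show "w j \<in> pow_span k x" unfolding w_def
      using x pq by (auto intro!: pow_span_mult[OF x k] lin_span_base[where v = "\<lambda>i. x [^] i"])
  qed (use x in auto)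
  then obtain c where c: "\<And>j. c j \<in> Z" "\<exists>j<Suc k. c j \<noteq> \<zero>" "(\<Oplus>j\<in>{..<Suc k}. c j \<otimes> w j) = \<zero>"
    unfolding lin_dep_def by blast
  define t where "t = pow_sum k c x"
  have tL: "t \<in> pow_span k x" using c unfolding lin_span_def t_def by blast
  then have tc: "t \<in> carrier R" using x by simp
  have wc: "w i \<in> carrier R" for i using qc x by (simp add: w_def)
  have "(\<Oplus>j\<in>{..<Suc k}. c j \<otimes> w j) = c k \<otimes> w k \<oplus> (\<Oplus>j\<in>{..<k}. c j \<otimes> w j)"
    unfolding lessThan_Suc using c wc by (intro finsum_insert) auto
  also have "(\<Oplus>j\<in>{..<k}. c j \<otimes> w j) = (\<Oplus>j\<in>{..<k}. q \<otimes> (c j \<otimes> x [^] j))"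
    using c(1) wc x qc by (intro finsum_cong') (auto simp: w_def intro: Z_lcomm[symmetric])
  also have "\<dots> = q \<otimes> t" unfolding t_def using c x qc by (intro finsum_rdistr[symmetric]) auto
  finally have e: "c k \<otimes> p \<oplus> q \<otimes> t = \<zero>" using c by (simp add: w_def)
  have ck: "c k \<noteq> \<zero>"
  proof
    assume 0: "c k = \<zero>"
    then have "t = \<zero>" using e qc tc pq by simp
    then have "pow_sum k c x = \<zero>" by (simp add: t_def)
    moreover have "\<exists>j\<in>{..<k}. c j \<noteq> \<zero>" using c(2) 0 by (auto simp: less_Suc_eq)
    ultimately have "pow_dep k x" unfolding lin_dep_def using c(1) by blast
    then show False using k by simp
  qed
  define s where "s = \<ominus> (inv (c k)) \<otimes> t"
  have "c k \<otimes> p = \<ominus> (q \<otimes> t)" using e c(1) qc tc minus_equality[of "c k \<otimes> p" "q \<otimes> t"] by simp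
  then have "inv (c k) \<otimes> (c k \<otimes> p) = inv (c k) \<otimes> (\<ominus> (q \<otimes> t))" by simp
  then have "p = inv (c k) \<otimes> (\<ominus> (q \<otimes> t))" using ck c(1) qc by simp
  also have "\<dots> = q \<otimes> s" unfolding s_def
    using ck c(1) qc tc Z_lcomm[of "inv (c k)" q t] by (simp add: r_minus l_minus)
  finally have "p = q \<otimes> s" .
  moreover have "s \<in> pow_span k x" unfolding s_def by (rule lin_span_smult) (use tL ck c(1) x in auto)
  ultimately show ?thesis by blast
qed

end

section \<open>Lines of algebraic elements\<close>

lemma (in ring) finsum_product:
  assumes "finite I" "finite J" "\<And>i j. i \<in> I \<Longrightarrow> j \<in> J \<Longrightarrow> f (i, j) \<in> carrier R"
  shows "(\<Oplus>p\<in>I \<times> J. f p) = (\<Oplus>i\<in>I. \<Oplus>j\<in>J. f (i, j))"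
  using assms(1,3)
proof (induction I rule: finite_induct)
  case (insert a I)
  have "(\<Oplus>p\<in>insert a I \<times> J. f p) = (\<Oplus>p\<in>Pair a ` J \<union> I \<times> J. f p)"
    by (rule arg_cong[where f = "finsum R f"]) auto
  also have "\<dots> = (\<Oplus>p\<in>Pair a ` J. f p) \<oplus> (\<Oplus>p\<in>I \<times> J. f p)"
    using insert assms(2) by (intro finsum_Un_disjoint) auto
  also have "(\<Oplus>p\<in>Pair a ` J. f p) = (\<Oplus>j\<in>J. f (a, j))"
    using insert by (intro finsum_reindex) (auto simp: inj_on_def)
  also have "(\<Oplus>p\<in>I \<times> J. f p) = (\<Oplus>i\<in>I. \<Oplus>j\<in>J. f (i, j))" using insert by auto
  also have "(\<Oplus>j\<in>J. f (a, j)) \<oplus> (\<Oplus>i\<in>I. \<Oplus>j\<in>J. f (i, j)) = (\<Oplus>i\<in>insert a I. \<Oplus>j\<in>J. f (i, j))"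
    using insert by (intro finsum_insert[symmetric]) (auto intro!: finsum_closed)
  finally show ?case .
qed simp

text \<open>\<open>pow_coeff x y i j\<close> is the coefficient of \<open>z\<^sup>j\<close> in
  \<open>(x + z y)\<^sup>i\<close> for \<open>z\<close> commuting with \<open>x\<close> and
  \<open>y\<close>.\<close>

fun (in ring) pow_coeff :: "'a \<Rightarrow> 'a \<Rightarrow> nat \<Rightarrow> nat \<Rightarrow> 'a" where
  "pow_coeff x y 0 j = (if j = 0 then \<one> else \<zero>)"
| "pow_coeff x y (Suc i) j =
    pow_coeff x y i j \<otimes> x \<oplus> (case j of 0 \<Rightarrow> \<zero> | Suc j' \<Rightarrow> pow_coeff x y i j' \<otimes> y)"

context ring
begin

lemma pow_coeff_closed [simp]:
  "x \<in> carrier R \<Longrightarrow> y \<in> carrier R \<Longrightarrow> pow_coeff x y i j \<in> carrier R"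
  by (induction i arbitrary: j) (auto split: nat.split)

lemma pow_coeff_gt:
  "x \<in> carrier R \<Longrightarrow> y \<in> carrier R \<Longrightarrow> i < j \<Longrightarrow> pow_coeff x y i j = \<zero>"
  by (induction i arbitrary: j) (auto split: nat.split)

lemma pow_coeff_0:
  "x \<in> carrier R \<Longrightarrow> y \<in> carrier R \<Longrightarrow> pow_coeff x y i 0 = x [^] i"
  by (induction i) auto

lemma pow_coeff_top:
  "x \<in> carrier R \<Longrightarrow> y \<in> carrier R \<Longrightarrow> pow_coeff x y i i = y [^] i"
  by (induction i) (auto simp: pow_coeff_gt)

lemma pow_coeff_commute:
  assumes "x \<in> carrier R" "y \<in> carrier R" "z \<in> carrier R" "z \<otimes> x = x \<otimes> z" "z \<otimes> y = y \<otimes> z"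
  shows "z \<otimes> pow_coeff x y i j = pow_coeff x y i j \<otimes> z"
proof (induction i arbitrary: j)
  case (Suc i)
  have *: "z \<otimes> (pow_coeff x y i l \<otimes> v) = pow_coeff x y i l \<otimes> v \<otimes> z"
    if "v \<in> carrier R" "z \<otimes> v = v \<otimes> z" for l v
  proof -
    have "z \<otimes> (pow_coeff x y i l \<otimes> v) = (z \<otimes> pow_coeff x y i l) \<otimes> v"
      using assms that by (simp add: m_assoc)
    also have "\<dots> = pow_coeff x y i l \<otimes> (z \<otimes> v)"
      unfolding Suc using assms that by (simp add: m_assoc)
    finally show ?thesis using assms that by (simp add: m_assoc)
  qed
  show ?case using assms by (auto simp: r_distr l_distr * split: nat.split)
qed (use assms in auto)

text \<open>All exponents share the range \<open>{..Suc g}\<close>, so that expansions for different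
  \<open>i\<close> can be added coefficientwise; the surplus coefficients vanish. It is enough that
  \<open>z\<close> commutes with \<open>x\<close> and \<open>y\<close>: later also noncentral
  elements are substituted.\<close>

lemma pow_add_expand:
  assumes "x \<in> carrier R" "y \<in> carrier R" "z \<in> carrier R" "z \<otimes> x = x \<otimes> z" "z \<otimes> y = y \<otimes> z"
  shows "i \<le> Suc g \<Longrightarrow> (x \<oplus> z \<otimes> y) [^] i = (\<Oplus>j\<in>{..Suc g}. z [^] j \<otimes> pow_coeff x y i j)"
proof (induction i)
  case 0
  have "(\<Oplus>j\<in>{..Suc g}. z [^] j \<otimes> pow_coeff x y 0 j) = (\<Oplus>j\<in>{..Suc g}. if 0 = j then \<one> else \<zero>)"
    using assms by (intro finsum_cong') auto
  also have "\<dots> = \<one>" by (intro finsum_singleton) auto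
  finally show ?case using assms by simp
next
  case (Suc i)
  let ?X = "pow_coeff x y i"
  let ?t = "\<lambda>j. z [^] j \<otimes> (case j of 0 \<Rightarrow> \<zero> | Suc j' \<Rightarrow> ?X j' \<otimes> y)"
  have X: "?X j \<in> carrier R" for j using assms by simp
  have tc: "?t j \<in> carrier R" for j using assms X by (auto split: nat.split)
  have "(x \<oplus> z \<otimes> y) [^] Suc i = (\<Oplus>j\<in>{..Suc g}. z [^] j \<otimes> ?X j) \<otimes> (x \<oplus> z \<otimes> y)"
    using Suc by simp
  also have "\<dots> = (\<Oplus>j\<in>{..Suc g}. z [^] j \<otimes> ?X j \<otimes> (x \<oplus> z \<otimes> y))"
    using assms X by (intro finsum_ldistr) auto
  also have "\<dots> = (\<Oplus>j\<in>{..Suc g}. z [^] j \<otimes> (?X j \<otimes> x) \<oplus> z [^] Suc j \<otimes> (?X j \<otimes> y))"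
  proof (rule finsum_cong')
    fix j
    have "?X j \<otimes> (z \<otimes> y) = (z \<otimes> ?X j) \<otimes> y"
      using pow_coeff_commute[OF assms, of i j] assms X by (simp add: m_assoc)
    then show "z [^] j \<otimes> ?X j \<otimes> (x \<oplus> z \<otimes> y) = z [^] j \<otimes> (?X j \<otimes> x) \<oplus> z [^] Suc j \<otimes> (?X j \<otimes> y)"
      using assms X by (simp add: r_distr m_assoc)
  qed (use assms X in auto)
  also have "\<dots> = (\<Oplus>j\<in>{..Suc g}. z [^] j \<otimes> (?X j \<otimes> x)) \<oplus> (\<Oplus>j\<in>{..Suc g}. z [^] Suc j \<otimes> (?X j \<otimes> y))"
    using assms X by (intro finsum_addf) auto
  \<comment> \<open>The last term drops out because \<open>i < Suc g\<close>; this leaves room for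
    the shift of the index by one.\<close>
  also have "(\<Oplus>j\<in>{..Suc g}. z [^] Suc j \<otimes> (?X j \<otimes> y)) = (\<Oplus>j\<in>{..g}. z [^] Suc j \<otimes> (?X j \<otimes> y))"
    using assms X Suc.prems by (subst finsum_Suc) (auto simp: pow_coeff_gt intro!: finsum_closed)
  also have "\<dots> = (\<Oplus>j\<in>{..g}. ?t (Suc j)) \<oplus> ?t 0"
    using assms X by (simp add: finsum_closed)
  also have "\<dots> = (\<Oplus>j\<in>{..Suc g}. ?t j)"
    using tc by (intro finsum_Suc2[symmetric]) auto
  also have "(\<Oplus>j\<in>{..Suc g}. z [^] j \<otimes> (?X j \<otimes> x)) \<oplus> (\<Oplus>j\<in>{..Suc g}. ?t j)
      = (\<Oplus>j\<in>{..Suc g}. z [^] j \<otimes> (?X j \<otimes> x) \<oplus> ?t j)"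
    using assms X tc by (intro finsum_addf[symmetric]) auto
  also have "\<dots> = (\<Oplus>j\<in>{..Suc g}. z [^] j \<otimes> pow_coeff x y (Suc i) j)"
    using assms X by (intro finsum_cong') (auto simp: r_distr split: nat.split)
  finally show ?case .
qed

end

context skew_field
begin

section \<open>Moments: combining the relations at many points of a line\<close>

text \<open>If the moments from \<open>0\<close> to \<open>g\<close> all vanish, the weights
  \<open>c z (1/z - 1/q)\<close> have vanishing moments from \<open>1\<close> to \<open>g\<close>
  and smaller support.\<close>

lemma moment_vector_aux:
  fixes \<alpha> :: "'a \<Rightarrow> nat \<Rightarrow> 'a" and g n :: nat
  assumes "finite T" "T \<noteq> {}" "T \<subseteq> Z - {\<zero>}" "\<And>z. z \<in> T \<Longrightarrow> c z \<in> Z - {\<zero>}"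
    and "\<And>z i. z \<in> T \<Longrightarrow> \<alpha> z i \<in> Z" "\<And>z. z \<in> T \<Longrightarrow> \<exists>i<n. \<alpha> z i \<noteq> \<zero>" "1 \<le> g"
    and "\<And>j i. 1 \<le> j \<Longrightarrow> j \<le> g \<Longrightarrow> i < n \<Longrightarrow> (\<Oplus>z\<in>T. c z \<otimes> (z [^] j \<otimes> \<alpha> z i)) = \<zero>"
  shows "\<exists>T' c. T' \<subseteq> T \<and> (\<forall>z\<in>T'. c z \<in> Z) \<and>
    (\<forall>j i. 1 \<le> j \<longrightarrow> j \<le> g \<longrightarrow> i < n \<longrightarrow> (\<Oplus>z\<in>T'. c z \<otimes> (z [^] j \<otimes> \<alpha> z i)) = \<zero>) \<and>
    (\<exists>i<n. (\<Oplus>z\<in>T'. c z \<otimes> (z [^] (0::nat) \<otimes> \<alpha> z i)) \<noteq> \<zero>)"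
  using assms(1-6,8)
proof (induction "card T" arbitrary: T c rule: less_induct)
  case less
  note prems = less.prems
  have cz: "c z \<in> Z" "c z \<noteq> \<zero>" "z \<in> Z" "z \<noteq> \<zero>" if "z \<in> T" for z
    using prems(3) prems(4)[OF that] that by auto
  let ?M = "\<lambda>(j::nat) i. \<Oplus>z\<in>T. c z \<otimes> (z [^] j \<otimes> \<alpha> z i)"
  show ?case
  proof (cases "\<exists>i<n. ?M (0::nat) i \<noteq> \<zero>")
    case True
    then show ?thesis using prems(7) cz by (intro exI[of _ T] exI[of _ c]) auto
  next
    case False
    then have M: "?M j i = \<zero>" if "j \<le> g" "i < n" for j i
      using prems(7)[of j i] that by (cases j) auto
    obtain q where q: "q \<in> T" using prems(2) by blast
    define T' where "T' = T - {q}"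
    define c' where "c' z = c z \<otimes> (inv z \<ominus> inv q)" for z
    have T': "finite T'" "T' \<subseteq> T" "card T' < card T"
      using prems(1) q card_Diff1_less[of T q] unfolding T'_def by auto
    have c': "c' z \<in> Z - {\<zero>}" if z: "z \<in> T'" for z
    proof -
      have zT: "z \<in> T" "z \<noteq> q" using z by (auto simp: T'_def)
      then have "inv z \<noteq> inv q" using cz[OF zT(1)] cz[OF q] by (metis Z_carrier nonzero_inv(5))
      then have "inv z \<ominus> inv q \<noteq> \<zero>" using cz[OF zT(1)] cz[OF q] by (simp add: r_right_minus_eq)
      then show ?thesis unfolding c'_def using cz[OF zT(1)] cz[OF q] by simp
    qed
    \<comment> \<open>The descent cannot exhaust the support: at a single point the first moment is
      a product of nonzero factors for some \<open>i\<close>, and \<open>1 \<le> g\<close> says that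
      it vanishes.\<close>
    have T'ne: "T' \<noteq> {}"
    proof
      assume "T' = {}"
      then have T: "T = {q}" using q by (auto simp: T'_def)
      obtain i where i: "i < n" "\<alpha> q i \<noteq> \<zero>" using prems(6)[OF q] by blast
      have "?M 1 i = c q \<otimes> (q [^] (1::nat) \<otimes> \<alpha> q i)"
        unfolding T using prems(5)[OF q] cz[OF q] by (subst finsum_insert) auto
      moreover have "\<dots> \<noteq> \<zero>" using i prems(5)[OF q] cz[OF q] by simp
      ultimately show False using M[of 1 i] i assms(7) by simp
    qed
    have M': "(\<Oplus>z\<in>T'. c' z \<otimes> (z [^] j \<otimes> \<alpha> z i)) = \<zero>" if j: "1 \<le> j" "j \<le> g" "i < n" for j i
    proof -
      obtain l where l: "j = Suc l" using j by (cases j) auto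
      have "(\<Oplus>z\<in>T'. c' z \<otimes> (z [^] j \<otimes> \<alpha> z i)) = (\<Oplus>z\<in>T. c' z \<otimes> (z [^] j \<otimes> \<alpha> z i))"
      proof (rule add.finprod_mono_neutral_cong_left)
        show "c' z \<otimes> (z [^] j \<otimes> \<alpha> z i) = \<zero>" if "z \<in> T - T'" for z
          using that q cz prems(5) by (auto simp: T'_def c'_def a_minus_def r_neg)
      qed (use prems(1,5) cz q T'(2) in \<open>auto simp: c'_def a_minus_def\<close>)
      also have "\<dots> = (\<Oplus>z\<in>T. c z \<otimes> (z [^] l \<otimes> \<alpha> z i) \<ominus> inv q \<otimes> (c z \<otimes> (z [^] j \<otimes> \<alpha> z i)))"
      proof (rule finsum_cong')
        fix z assume z: "z \<in> T"
        note zz = cz[OF z] cz[OF q] prems(5)[OF z, of i]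
        have "inv z \<otimes> (z [^] j \<otimes> \<alpha> z i) = z [^] l \<otimes> \<alpha> z i"
          unfolding l using zz nat_pow_Suc2[of z l] by (simp add: m_assoc)
        moreover have "c z \<otimes> (inv q \<otimes> (z [^] j \<otimes> \<alpha> z i)) = inv q \<otimes> (c z \<otimes> (z [^] j \<otimes> \<alpha> z i))"
          using zz by (intro Z_lcomm) auto
        moreover have "inv z \<in> carrier R" "inv q \<in> carrier R" "c z \<in> carrier R" "z [^] j \<otimes> \<alpha> z i \<in> carrier R"
          using zz by auto
        ultimately show "c' z \<otimes> (z [^] j \<otimes> \<alpha> z i)
            = c z \<otimes> (z [^] l \<otimes> \<alpha> z i) \<ominus> inv q \<otimes> (c z \<otimes> (z [^] j \<otimes> \<alpha> z i))"
          unfolding c'_def a_minus_def by (simp add: m_assoc l_distr r_distr l_minus r_minus)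
      qed (use cz q prems(5) in auto)
      also have "\<dots> = ?M l i \<ominus> (\<Oplus>z\<in>T. inv q \<otimes> (c z \<otimes> (z [^] j \<otimes> \<alpha> z i)))"
        using cz q prems(5) by (intro finsum_minus) auto
      also have "(\<Oplus>z\<in>T. inv q \<otimes> (c z \<otimes> (z [^] j \<otimes> \<alpha> z i))) = inv q \<otimes> ?M j i"
        using cz q prems(1,5) by (intro finsum_rdistr[symmetric]) auto
      also have "?M l i \<ominus> inv q \<otimes> ?M j i = \<zero>"
        using M[of l i] M[of j i] j l cz[OF q] by (simp add: a_minus_def)
      finally show ?thesis .
    qed
    have "\<exists>U c. U \<subseteq> T' \<and> (\<forall>z\<in>U. c z \<in> Z) \<and>
      (\<forall>j i. 1 \<le> j \<longrightarrow> j \<le> g \<longrightarrow> i < n \<longrightarrow> (\<Oplus>z\<in>U. c z \<otimes> (z [^] j \<otimes> \<alpha> z i)) = \<zero>) \<and>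
      (\<exists>i<n. (\<Oplus>z\<in>U. c z \<otimes> (z [^] (0::nat) \<otimes> \<alpha> z i)) \<noteq> \<zero>)"
      using less.hyps[OF T'(3,1) T'ne, of c'] T'(2) prems(3,5,6) c' M' by blast
    then show ?thesis using T'(2) by (meson subset_trans)
  qed
qed

text \<open>There are \<open>g * n\<close> moment equations, so one more point than that leaves a
  nonzero solution in central weights. \<open>moment_vector_aux\<close> then turns it into one whose
  zeroth moment survives, that is, into a substitute for evaluation at z = 0.\<close>

lemma moment_vector:
  fixes \<alpha> :: "'a \<Rightarrow> nat \<Rightarrow> 'a" and g n :: nat
  assumes "infinite S" "S \<subseteq> Z - {\<zero>}" "1 \<le> g"
    and "\<And>z i. z \<in> S \<Longrightarrow> \<alpha> z i \<in> Z" "\<And>z. z \<in> S \<Longrightarrow> \<exists>i<n. \<alpha> z i \<noteq> \<zero>"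
  shows "\<exists>T c. finite T \<and> T \<subseteq> S \<and> (\<forall>z\<in>T. c z \<in> Z) \<and>
    (\<forall>j i. 1 \<le> j \<longrightarrow> j \<le> g \<longrightarrow> i < n \<longrightarrow> (\<Oplus>z\<in>T. c z \<otimes> (z [^] j \<otimes> \<alpha> z i)) = \<zero>) \<and>
    (\<exists>i<n. (\<Oplus>z\<in>T. c z \<otimes> (z [^] (0::nat) \<otimes> \<alpha> z i)) \<noteq> \<zero>)"
proof -
  define I where "I = {1..g} \<times> {..<n}"
  have I: "finite I" by (simp add: I_def)
  obtain T where T: "finite T" "card T = Suc (card I)" "T \<subseteq> S"
    using infinite_arbitrarily_large[OF assms(1)] by blast
  have zT: "z \<in> Z" "z \<noteq> \<zero>" "\<alpha> z i \<in> Z" if "z \<in> T" for z i using that T assms by auto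
  have "\<exists>c. (\<forall>z. c z \<in> Z) \<and> (\<exists>z\<in>T. c z \<noteq> \<zero>) \<and>
      (\<forall>p\<in>I. (\<Oplus>z\<in>T. (z [^] fst p \<otimes> \<alpha> z (snd p)) \<otimes> c z) = \<zero>)"
    by (rule homogeneous_system[OF Z_subring Z_inv I T(1)]) (use T zT in auto)
  then obtain c where c: "\<forall>z. c z \<in> Z" "\<exists>z\<in>T. c z \<noteq> \<zero>"
      "\<forall>p\<in>I. (\<Oplus>z\<in>T. (z [^] fst p \<otimes> \<alpha> z (snd p)) \<otimes> c z) = \<zero>" by blast
  \<comment> \<open>Points of weight zero are discarded, as the descent starts from nonzero weights
    on the whole support.\<close>
  define U where "U = {z\<in>T. c z \<noteq> \<zero>}"
  have UT: "U \<subseteq> T" by (auto simp: U_def)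
  then have "U \<subseteq> Z - {\<zero>}" using T(3) assms(2) by blast
  with UT have U: "finite U" "U \<noteq> {}" "U \<subseteq> T" "U \<subseteq> Z - {\<zero>}"
    using T(1) c(2) finite_subset[OF UT] by (auto simp: U_def)
  have "(\<Oplus>z\<in>U. c z \<otimes> (z [^] j \<otimes> \<alpha> z i)) = \<zero>" if j: "1 \<le> j" "j \<le> g" "i < n" for j i
  proof -
    have "(\<Oplus>z\<in>U. c z \<otimes> (z [^] j \<otimes> \<alpha> z i)) = (\<Oplus>z\<in>T. (z [^] j \<otimes> \<alpha> z i) \<otimes> c z)"
      using T U c zT by (intro add.finprod_mono_neutral_cong_left) (auto simp: U_def Z_comm)
    then show ?thesis using c(3) j by (auto simp: I_def)
  qed
  then have "\<exists>T' c. T' \<subseteq> U \<and> (\<forall>z\<in>T'. c z \<in> Z) \<and>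
    (\<forall>j i. 1 \<le> j \<longrightarrow> j \<le> g \<longrightarrow> i < n \<longrightarrow> (\<Oplus>z\<in>T'. c z \<otimes> (z [^] j \<otimes> \<alpha> z i)) = \<zero>) \<and>
    (\<exists>i<n. (\<Oplus>z\<in>T'. c z \<otimes> (z [^] (0::nat) \<otimes> \<alpha> z i)) \<noteq> \<zero>)"
    using U c(1) assms T by (intro moment_vector_aux) (auto simp: U_def)
  then show ?thesis using U(1,3) T(3) by (meson finite_subset subset_trans)
qed

text \<open>The weighted sum of the relations over \<open>z \<in> T\<close>, sorted by powers of
  \<open>z\<close>: the coefficients of the relations enter only through their moments.\<close>

lemma pencil_sum:
  fixes \<alpha> :: "'a \<Rightarrow> nat \<Rightarrow> 'a" and B :: "nat \<Rightarrow> nat \<Rightarrow> 'a"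
  assumes "finite T" "T \<subseteq> Z" "\<And>z. z \<in> T \<Longrightarrow> c z \<in> Z" "\<And>z i. z \<in> T \<Longrightarrow> \<alpha> z i \<in> Z"
    "\<And>i j. B i j \<in> carrier R"
    "\<And>z. z \<in> T \<Longrightarrow> (\<Oplus>i\<in>{..<n}. \<alpha> z i \<otimes> (\<Oplus>j\<in>{..g}. z [^] j \<otimes> B i j)) = \<zero>"
  shows "(\<Oplus>j\<in>{..g}. \<Oplus>i\<in>{..<n}. (\<Oplus>z\<in>T. c z \<otimes> (z [^] j \<otimes> \<alpha> z i)) \<otimes> B i j) = \<zero>"
proof -
  let ?P = "{..g} \<times> {..<n}"
  let ?A = "\<lambda>z p. z [^] fst p \<otimes> \<alpha> z (snd p)"
  let ?v = "\<lambda>p. B (snd p) (fst p)"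
  have zT: "z \<in> Z" "c z \<in> Z" "\<alpha> z i \<in> Z" if "z \<in> T" for z i using that assms by auto
  have *: "(\<Oplus>p\<in>?P. ?A z p \<otimes> ?v p) = \<zero>" if z: "z \<in> T" for z
  proof -
    have "(\<Oplus>p\<in>?P. ?A z p \<otimes> ?v p) = (\<Oplus>j\<in>{..g}. \<Oplus>i\<in>{..<n}. z [^] j \<otimes> \<alpha> z i \<otimes> B i j)"
      using zT[OF z] assms(5) by (subst finsum_product) auto
    also have "\<dots> = (\<Oplus>i\<in>{..<n}. \<Oplus>j\<in>{..g}. z [^] j \<otimes> \<alpha> z i \<otimes> B i j)"
      using zT[OF z] assms(5) by (intro finsum_swap) auto
    also have "\<dots> = (\<Oplus>i\<in>{..<n}. \<alpha> z i \<otimes> (\<Oplus>j\<in>{..g}. z [^] j \<otimes> B i j))"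
    proof (rule finsum_cong')
      fix i
      have "(\<Oplus>j\<in>{..g}. z [^] j \<otimes> \<alpha> z i \<otimes> B i j) = (\<Oplus>j\<in>{..g}. \<alpha> z i \<otimes> (z [^] j \<otimes> B i j))"
        using zT[OF z] assms(5) by (intro finsum_cong') (auto simp: m_assoc[symmetric] Z_comm)
      also have "\<dots> = \<alpha> z i \<otimes> (\<Oplus>j\<in>{..g}. z [^] j \<otimes> B i j)"
        using zT[OF z] assms(5) by (intro finsum_rdistr[symmetric]) auto
      finally show "(\<Oplus>j\<in>{..g}. z [^] j \<otimes> \<alpha> z i \<otimes> B i j) = \<alpha> z i \<otimes> (\<Oplus>j\<in>{..g}. z [^] j \<otimes> B i j)" .
    qed (use zT[OF z] assms(5) in \<open>auto intro!: finsum_closed\<close>)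
    finally show ?thesis using assms(6)[OF z] by simp
  qed
  have "(\<Oplus>j\<in>{..g}. \<Oplus>i\<in>{..<n}. (\<Oplus>z\<in>T. c z \<otimes> (z [^] j \<otimes> \<alpha> z i)) \<otimes> B i j)
      = (\<Oplus>p\<in>?P. (\<Oplus>z\<in>T. c z \<otimes> ?A z p) \<otimes> ?v p)"
    using zT assms(5) by (subst finsum_product) (auto intro!: finsum_closed)
  also have "\<dots> = (\<Oplus>z\<in>T. c z \<otimes> (\<Oplus>p\<in>?P. ?A z p \<otimes> ?v p))"
    using zT assms by (intro finsum_nested[symmetric]) auto
  also have "\<dots> = \<zero>" using * zT by (intro add.finprod_one_eqI) auto
  finally show ?thesis .
qed

text \<open>A relation for \<open>x + z y\<close> at infinitely many \<open>z\<close> yields a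
  relation for \<open>x\<close> together with its first-order variation in the direction
  \<open>y\<close>. Weighting the given relations by a moment vector isolates the coefficient of
  \<open>z\<^sup>0\<close>; weights divided by \<open>z\<close> isolate those of
  \<open>z\<^sup>0\<close> and \<open>z\<^sup>1\<close>.\<close>

lemma curve_relation:
  assumes x: "x \<in> carrier R" "y \<in> carrier R" and S: "infinite S" "S \<subseteq> Z - {\<zero>}"
    and dep: "\<And>z. z \<in> S \<Longrightarrow> pow_dep n (x \<oplus> z \<otimes> y)"
  shows "\<exists>w \<nu>. (\<forall>i. w i \<in> Z) \<and> (\<forall>i. \<nu> i \<in> Z) \<and> (\<exists>i<n. w i \<noteq> \<zero>) \<and>
    pow_sum n w x = \<zero> \<and>
    pow_sum n \<nu> x \<oplus> (\<Oplus>i\<in>{..<n}. w i \<otimes> pow_coeff x y i 1) = \<zero>"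
proof -
  \<comment> \<open>The powers occurring have degree below \<open>n\<close> in \<open>z\<close>; the
    larger value ensures \<open>1 \<le> g\<close> and gives the range the form
    \<open>{..Suc n}\<close>, from which the term of index zero can be split off.\<close>
  define g where "g = Suc n"
  have "\<forall>z\<in>S. \<exists>\<alpha>. (\<forall>i. \<alpha> i \<in> Z) \<and> (\<exists>i\<in>{..<n}. \<alpha> i \<noteq> \<zero>) \<and>
      (\<Oplus>i\<in>{..<n}. \<alpha> i \<otimes> (x \<oplus> z \<otimes> y) [^] i) = \<zero>"
    using dep unfolding lin_dep_def by blast
  then obtain \<alpha> where "\<forall>z\<in>S. (\<forall>i. \<alpha> z i \<in> Z) \<and> (\<exists>i\<in>{..<n}. \<alpha> z i \<noteq> \<zero>) \<and>
      (\<Oplus>i\<in>{..<n}. \<alpha> z i \<otimes> (x \<oplus> z \<otimes> y) [^] i) = \<zero>"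
    by (rule bchoice[THEN exE])
  then have \<alpha>: "\<And>z i. z \<in> S \<Longrightarrow> \<alpha> z i \<in> Z" "\<And>z. z \<in> S \<Longrightarrow> \<exists>i<n. \<alpha> z i \<noteq> \<zero>"
      "\<And>z. z \<in> S \<Longrightarrow> (\<Oplus>i\<in>{..<n}. \<alpha> z i \<otimes> (x \<oplus> z \<otimes> y) [^] i) = \<zero>"
    by auto
  obtain T c where T: "finite T" "T \<subseteq> S" and c: "\<forall>z\<in>T. c z \<in> Z"
      "\<forall>j i. 1 \<le> j \<longrightarrow> j \<le> g \<longrightarrow> i < n \<longrightarrow> (\<Oplus>z\<in>T. c z \<otimes> (z [^] j \<otimes> \<alpha> z i)) = \<zero>"
      "\<exists>i<n. (\<Oplus>z\<in>T. c z \<otimes> (z [^] (0::nat) \<otimes> \<alpha> z i)) \<noteq> \<zero>"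
    using moment_vector[OF S, of g \<alpha> n] \<alpha> by (auto simp: g_def)
  have zT: "z \<in> Z" "z \<noteq> \<zero>" "c z \<in> Z" "\<alpha> z i \<in> Z" if "z \<in> T" for z i using that T S \<alpha> c by auto
  let ?X = "pow_coeff x y"
  have rel: "(\<Oplus>i\<in>{..<n}. \<alpha> z i \<otimes> (\<Oplus>j\<in>{..g}. z [^] j \<otimes> ?X i j)) = \<zero>" if z: "z \<in> T" for z
  proof -
    have "(x \<oplus> z \<otimes> y) [^] i = (\<Oplus>j\<in>{..g}. z [^] j \<otimes> ?X i j)" if "i < n" for i
      unfolding g_def using x zT[OF z] that by (intro pow_add_expand) (auto intro: Z_comm[symmetric])
    moreover have "(\<Oplus>i\<in>{..<n}. \<alpha> z i \<otimes> (x \<oplus> z \<otimes> y) [^] i) = \<zero>" using \<alpha>(3) z T by auto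
    ultimately have "(\<Oplus>i\<in>{..<n}. \<alpha> z i \<otimes> (\<Oplus>j\<in>{..g}. z [^] j \<otimes> ?X i j))
        = (\<Oplus>i\<in>{..<n}. \<alpha> z i \<otimes> (x \<oplus> z \<otimes> y) [^] i)"
      using x zT[OF z] by (intro finsum_cong') auto
    then show ?thesis using \<alpha>(3) z T by auto
  qed
  let ?M = "\<lambda>c j i. \<Oplus>z\<in>T. c z \<otimes> (z [^] (j::nat) \<otimes> \<alpha> z i)"
  have sum: "(\<Oplus>j\<in>{..g}. \<Oplus>i\<in>{..<n}. ?M e j i \<otimes> ?X i j) = \<zero>" if "\<And>z. z \<in> T \<Longrightarrow> e z \<in> Z" for e
    using T zT x that rel by (intro pencil_sum) auto
  have MZ: "?M e j i \<in> Z" if "\<And>z. z \<in> T \<Longrightarrow> e z \<in> Z" for e j i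
    using zT that by (intro Z_finsum) auto
  define e where "e z = c z \<otimes> inv z" for z
  have eZ: "e z \<in> Z" if "z \<in> T" for z using zT that by (simp add: e_def)
  have eM: "?M e (Suc j) i = ?M c j i" for j i
  proof (rule finsum_cong')
    fix z assume z: "z \<in> T"
    note zz = zT[OF z]
    have "inv z \<otimes> (z [^] Suc j \<otimes> \<alpha> z i) = z [^] j \<otimes> \<alpha> z i"
      using zz(1-2) zz(4)[of i] nat_pow_Suc2[of z j] by (simp add: m_assoc)
    then show "e z \<otimes> (z [^] Suc j \<otimes> \<alpha> z i) = c z \<otimes> (z [^] j \<otimes> \<alpha> z i)"
      unfolding e_def using zz(1-3) zz(4)[of i] by (simp add: m_assoc del: nat_pow_Suc)
  qed (use zT in auto)
  \<comment> \<open>Dividing the weights by \<open>z\<close> shifts moments by one, so the first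
    moment of \<open>e\<close> is \<open>w\<close> again. Hence the same \<open>w\<close> stands in
    the relation for \<open>x\<close> and in front of the first-order terms.\<close>
  define w where "w i = ?M c 0 i" for i
  define \<nu> where "\<nu> i = ?M e 0 i" for i
  have wZ: "w i \<in> Z" "\<nu> i \<in> Z" for i unfolding w_def \<nu>_def using zT eZ by (auto intro!: MZ)
  have tail: "(\<Oplus>j\<in>{..n}. \<Oplus>i\<in>{..<n}. ?M c (Suc j) i \<otimes> ?X i (Suc j)) = \<zero>"
  proof (intro add.finprod_one_eqI)
    fix j i assume "j \<in> {..n}" "i \<in> {..<n}"
    then have "?M c (Suc j) i = \<zero>" using c(2) by (auto simp: g_def)
    then show "?M c (Suc j) i \<otimes> ?X i (Suc j) = \<zero>\<^bsub>R\<^esub>" using x by simp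
  qed
  have "\<zero> = (\<Oplus>j\<in>{..Suc n}. \<Oplus>i\<in>{..<n}. ?M c j i \<otimes> ?X i j)"
    using sum[of c] zT unfolding g_def by simp
  also have "\<dots> = (\<Oplus>j\<in>{..n}. \<Oplus>i\<in>{..<n}. ?M c (Suc j) i \<otimes> ?X i (Suc j)) \<oplus> (\<Oplus>i\<in>{..<n}. ?M c 0 i \<otimes> ?X i 0)"
    using zT x by (intro finsum_Suc2) (auto intro!: finsum_closed)
  also have "\<dots> = pow_sum n w x"
    unfolding tail w_def[symmetric] using x wZ by (simp add: pow_coeff_0 finsum_closed)
  finally have 1: "pow_sum n w x = \<zero>" by simp
  have tail2: "(\<Oplus>j\<in>{..n}. \<Oplus>i\<in>{..<n}. ?M e (Suc j) i \<otimes> ?X i (Suc j)) = (\<Oplus>i\<in>{..<n}. w i \<otimes> ?X i 1)"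
  proof -
    have "(\<Oplus>j\<in>{..n}. \<Oplus>i\<in>{..<n}. ?M e (Suc j) i \<otimes> ?X i (Suc j))
        = (\<Oplus>j\<in>{..n}. if 0 = j then (\<Oplus>i\<in>{..<n}. w i \<otimes> ?X i 1) else \<zero>)"
    proof (rule finsum_cong')
      fix j assume j: "j \<in> {..n}"
      show "(\<Oplus>i\<in>{..<n}. ?M e (Suc j) i \<otimes> ?X i (Suc j))
          = (if 0 = j then (\<Oplus>i\<in>{..<n}. w i \<otimes> ?X i 1) else \<zero>)"
      proof (cases j)
        case 0
        show ?thesis unfolding 0 eM w_def by simp
      next
        case (Suc l)
        have "?M e (Suc j) i \<otimes> ?X i (Suc j) = \<zero>" if "i < n" for i
        proof -
          have "1 \<le> j" "j \<le> g" using Suc j by (auto simp: g_def)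
          then have "?M c j i = \<zero>" using c(2) that by blast
          then show ?thesis unfolding eM using x by simp
        qed
        then show ?thesis using Suc by (auto intro!: add.finprod_one_eqI)
      qed
    qed (use wZ x in \<open>auto intro!: finsum_closed\<close>)
    also have "\<dots> = (\<Oplus>i\<in>{..<n}. w i \<otimes> ?X i 1)"
      using wZ x by (intro finsum_singleton[of 0 "{..n}" "\<lambda>_. \<Oplus>i\<in>{..<n}. w i \<otimes> ?X i 1"]) (auto intro!: finsum_closed)
    finally show ?thesis .
  qed
  have "\<zero> = (\<Oplus>j\<in>{..Suc n}. \<Oplus>i\<in>{..<n}. ?M e j i \<otimes> ?X i j)"
    using sum[of e] eZ unfolding g_def by simp
  also have "\<dots> = (\<Oplus>j\<in>{..n}. \<Oplus>i\<in>{..<n}. ?M e (Suc j) i \<otimes> ?X i (Suc j)) \<oplus> (\<Oplus>i\<in>{..<n}. ?M e 0 i \<otimes> ?X i 0)"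
    using zT eZ x by (intro finsum_Suc2) (auto intro!: finsum_closed)
  also have "\<dots> = (\<Oplus>i\<in>{..<n}. w i \<otimes> ?X i 1) \<oplus> pow_sum n \<nu> x"
    unfolding tail2 \<nu>_def[symmetric] using x by (simp add: pow_coeff_0)
  finally have 2: "pow_sum n \<nu> x \<oplus> (\<Oplus>i\<in>{..<n}. w i \<otimes> ?X i 1) = \<zero>"
    using wZ x by (subst a_comm) (auto intro!: finsum_closed)
  have 3: "\<exists>i<n. w i \<noteq> \<zero>" using c(3) by (simp add: w_def)
  show ?thesis
    by (intro exI[of _ w] exI[of _ \<nu>] conjI) (use wZ 1 2 3 in auto)
qed

text \<open>Semicontinuity: a degree bound at infinitely many nonzero \<open>z\<close> persists at z
  = 0. It is used to bound the degree of the direction of a line, and in the other direction to move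
  off a point without lowering its degree.\<close>

corollary pow_dep_limit:
  assumes "x \<in> carrier R" "y \<in> carrier R" "infinite S" "S \<subseteq> Z - {\<zero>}"
    "\<And>z. z \<in> S \<Longrightarrow> pow_dep n (x \<oplus> z \<otimes> y)"
  shows "pow_dep n x"
  using curve_relation[OF assms] unfolding lin_dep_def by blast

end

section \<open>Centralizers of elements of maximal degree\<close>

definition (in ring) centralizer :: "'a \<Rightarrow> 'a set"
  where "centralizer x = {u \<in> carrier R. u \<otimes> x = x \<otimes> u}"

context skew_field
begin

lemma centralizer_carrier: "u \<in> centralizer x \<Longrightarrow> u \<in> carrier R"
  by (simp add: centralizer_def)

lemma centralizer_commute: "u \<in> centralizer x \<Longrightarrow> u \<otimes> x = x \<otimes> u"
  unfolding centralizer_def by blast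

lemma centralizerI: "u \<in> carrier R \<Longrightarrow> u \<otimes> x = x \<otimes> u \<Longrightarrow> u \<in> centralizer x"
  unfolding centralizer_def by blast

lemma centralizer_sym: "x \<in> carrier R \<Longrightarrow> u \<in> centralizer x \<Longrightarrow> x \<in> centralizer u"
  using centralizerI[OF _ centralizer_commute[symmetric]] by blast

lemma centralizer_mult:
  assumes "x \<in> carrier R" "u \<in> centralizer x" "v \<in> centralizer x"
  shows "u \<otimes> v \<in> centralizer x"
proof (rule centralizerI)
  have c: "u \<in> carrier R" "v \<in> carrier R" using assms centralizer_carrier by blast+
  then show "u \<otimes> v \<in> carrier R" by simp
  have "u \<otimes> v \<otimes> x = u \<otimes> (x \<otimes> v)"
    using c assms(1) centralizer_commute[OF assms(3)] by (simp add: m_assoc)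
  also have "\<dots> = u \<otimes> x \<otimes> v" using c assms(1) by (simp add: m_assoc)
  also have "\<dots> = x \<otimes> (u \<otimes> v)"
    using c assms(1) centralizer_commute[OF assms(2)] by (simp add: m_assoc)
  finally show "u \<otimes> v \<otimes> x = x \<otimes> (u \<otimes> v)" .
qed

lemma centralizer_subring:
  assumes "x \<in> carrier R"
  shows "subring (centralizer x) R"
proof (rule subringI)
  fix u v assume uv: "u \<in> centralizer x" "v \<in> centralizer x"
  note c = uv[THEN centralizer_carrier]
  show "u \<otimes> v \<in> centralizer x" by (rule centralizer_mult[OF assms uv])
  show "u \<oplus> v \<in> centralizer x"
    using assms c centralizer_commute[OF uv(1)] centralizer_commute[OF uv(2)]
    by (intro centralizerI) (auto simp: l_distr r_distr)
next
  fix u assume u: "u \<in> centralizer x"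
  show "\<ominus> u \<in> centralizer x"
    using assms centralizer_carrier[OF u] centralizer_commute[OF u] by (intro centralizerI) (auto simp: l_minus r_minus)
qed (use assms in \<open>auto intro: centralizerI dest: centralizer_carrier\<close>)

lemma centralizer_inv:
  assumes "x \<in> carrier R" "u \<in> centralizer x" "u \<noteq> \<zero>"
  shows "inv u \<in> centralizer x"
proof (rule centralizerI)
  have c: "u \<in> carrier R" using assms centralizer_carrier by blast
  then show "inv u \<in> carrier R" using assms by simp
  have "inv u \<otimes> x = inv u \<otimes> (x \<otimes> u) \<otimes> inv u" using c assms by (simp add: m_assoc)
  also have "\<dots> = inv u \<otimes> (u \<otimes> x) \<otimes> inv u" using centralizer_commute[OF assms(2)] by simp
  also have "\<dots> = x \<otimes> inv u" using c assms by simp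
  finally show "inv u \<otimes> x = x \<otimes> inv u" .
qed

lemma centralizer_closed [simp]:
  assumes "x \<in> carrier R"
  shows "\<zero> \<in> centralizer x" "\<one> \<in> centralizer x" "x \<in> centralizer x"
    "u \<in> centralizer x \<Longrightarrow> \<ominus> u \<in> centralizer x"
    "u \<in> centralizer x \<Longrightarrow> v \<in> centralizer x \<Longrightarrow> u \<oplus> v \<in> centralizer x"
    "u \<in> centralizer x \<Longrightarrow> v \<in> centralizer x \<Longrightarrow> u \<ominus> v \<in> centralizer x"
    "u \<in> centralizer x \<Longrightarrow> v \<in> centralizer x \<Longrightarrow> u \<otimes> v \<in> centralizer x"
  using subringE[OF centralizer_subring[OF assms]] assms by (auto simp: a_minus_def intro: centralizerI)

lemma centralizer_pow [simp]:
  "x \<in> carrier R \<Longrightarrow> u \<in> centralizer x \<Longrightarrow> u [^] (n::nat) \<in> centralizer x"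
  by (induction n) auto

lemma Z_centralizer [simp]: "x \<in> carrier R \<Longrightarrow> z \<in> Z \<Longrightarrow> z \<in> centralizer x"
  by (intro centralizerI) (auto intro: Z_comm[symmetric])

lemma centralizer_finsum:
  "x \<in> carrier R \<Longrightarrow> (\<And>i. i \<in> A \<Longrightarrow> f i \<in> centralizer x) \<Longrightarrow> (\<Oplus>i\<in>A. f i) \<in> centralizer x"
  by (rule finsum_in_subring[OF centralizer_subring])

lemma pow_span_centralizer:
  assumes "x \<in> carrier R" "p \<in> pow_span k x"
  shows "p \<in> centralizer x"
  using pow_span_commute[OF assms(1,1) refl assms(2)] assms by (intro centralizerI) auto

section \<open>First-order variation of a polynomial relation\<close>

text \<open>The derivative of \<open>\<Sum>\<^sub>i \<mu>\<^sub>i x\<^sup>i\<close> in the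
  direction \<open>y\<close>, sorted by the power of \<open>x\<close> to the left of
  \<open>y\<close>.\<close>

lemma derivative_expand:
  assumes x: "x \<in> carrier R" and \<mu>: "\<And>i. \<mu> i \<in> Z"
  shows "\<exists>f. (\<forall>l. f l \<in> pow_span k x) \<and> (0 < k \<longrightarrow> f (k - 1) = \<mu> k) \<and>
    (\<forall>y\<in>carrier R. (\<Oplus>i\<in>{..<Suc k}. \<mu> i \<otimes> pow_coeff x y i 1) = (\<Oplus>l\<in>{..<k}. x [^] l \<otimes> y \<otimes> f l))"
proof -
  \<comment> \<open>The first-order part of the \<open>i\<close>-th power is the sum of the words
    \<open>x [^] l \<otimes> y \<otimes> x [^] (i - 1 - l)\<close>. The value zero for
    \<open>i \<le> l\<close> lets every \<open>i\<close> use the same range of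
    \<open>l\<close>.\<close>
  define h where "h l i = (if l < i then x [^] (i - 1 - l) else \<zero>)" for l i :: nat
  have h: "h l i \<in> carrier R" for l i using x by (simp add: h_def)
  have hS: "h l (Suc i) = h l i \<otimes> x \<oplus> (if i = l then \<one> else \<zero>)" for l i
  proof (cases "l < i")
    case True
    then have "i - l = Suc (i - 1 - l)" by simp
    then show ?thesis using True x by (simp add: h_def)
  qed (use x in \<open>auto simp: h_def\<close>)
  have coeff: "pow_coeff x y i 1 = (\<Oplus>l\<in>{..<k}. x [^] l \<otimes> y \<otimes> h l i)"
    if y: "y \<in> carrier R" and i: "i \<le> k" for y i
    using i
  proof (induction i)
    case 0
    then show ?case using x y by (auto simp: h_def intro!: add.finprod_one_eqI[symmetric])
  next
    case (Suc i)
    have "(\<Oplus>l\<in>{..<k}. x [^] l \<otimes> y \<otimes> h l (Suc i))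
        = (\<Oplus>l\<in>{..<k}. x [^] l \<otimes> y \<otimes> h l i \<otimes> x \<oplus> (if i = l then x [^] l \<otimes> y else \<zero>))"
      using x y h by (intro finsum_cong') (auto simp: hS r_distr m_assoc)
    also have "\<dots> = (\<Oplus>l\<in>{..<k}. x [^] l \<otimes> y \<otimes> h l i \<otimes> x) \<oplus> (\<Oplus>l\<in>{..<k}. if i = l then x [^] l \<otimes> y else \<zero>)"
      using x y h by (intro finsum_addf) auto
    also have "(\<Oplus>l\<in>{..<k}. x [^] l \<otimes> y \<otimes> h l i \<otimes> x) = (\<Oplus>l\<in>{..<k}. x [^] l \<otimes> y \<otimes> h l i) \<otimes> x"
      using x y h by (intro finsum_ldistr[symmetric]) auto
    also have "(\<Oplus>l\<in>{..<k}. if i = l then x [^] l \<otimes> y else \<zero>) = x [^] i \<otimes> y"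
      using x y Suc by (intro finsum_singleton) auto
    finally show ?case using Suc x y by (simp add: pow_coeff_0)
  qed
  define f where "f l = (\<Oplus>i\<in>{..<Suc k}. \<mu> i \<otimes> h l i)" for l
  have fL: "f l \<in> pow_span k x" for l
    unfolding f_def
  proof (rule lin_span_finsum)
    fix i assume i: "i \<in> {..<Suc k}"
    have "h l i \<in> pow_span k x"
    proof (cases "l < i")
      case True
      then have "i - 1 - l < k" using i by auto
      then show ?thesis using x True lin_span_base[of "{..<k}" "\<lambda>i. x [^] i" "i - 1 - l"] by (simp add: h_def)
    qed (use x lin_span_zero[of "{..<k}" "\<lambda>i. x [^] i"] in \<open>simp add: h_def\<close>)
    then show "\<mu> i \<otimes> h l i \<in> pow_span k x" by (rule lin_span_smult[rotated 2]) (use x \<mu> in auto)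
  qed (use x in auto)
  have fc: "f l \<in> carrier R" for l using pow_span_carrier[OF fL x] .
  have top: "f (k - 1) = \<mu> k" if "0 < k"
  proof -
    have "f (k - 1) = (\<Oplus>i\<in>{..<Suc k}. if k = i then \<mu> i else \<zero>)"
      unfolding f_def using \<mu> x that by (intro finsum_cong') (auto simp: h_def)
    also have "\<dots> = \<mu> k" using \<mu> by (intro finsum_singleton) auto
    finally show ?thesis .
  qed
  have "(\<Oplus>i\<in>{..<Suc k}. \<mu> i \<otimes> pow_coeff x y i 1) = (\<Oplus>l\<in>{..<k}. x [^] l \<otimes> y \<otimes> f l)"
    if y: "y \<in> carrier R" for y
  proof -
    have "(\<Oplus>i\<in>{..<Suc k}. \<mu> i \<otimes> pow_coeff x y i 1) = (\<Oplus>i\<in>{..<Suc k}. \<Oplus>l\<in>{..<k}. x [^] l \<otimes> y \<otimes> (\<mu> i \<otimes> h l i))"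
    proof (rule finsum_cong')
      fix i assume "i \<in> {..<Suc k}"
      then have i: "i \<le> k" by simp
      have "\<mu> i \<otimes> pow_coeff x y i 1 = (\<Oplus>l\<in>{..<k}. \<mu> i \<otimes> (x [^] l \<otimes> y \<otimes> h l i))"
        unfolding coeff[OF y i] using \<mu> x y h by (intro finsum_rdistr) auto
      also have "\<dots> = (\<Oplus>l\<in>{..<k}. x [^] l \<otimes> y \<otimes> (\<mu> i \<otimes> h l i))"
        using \<mu> x y h by (intro finsum_cong') (auto intro: Z_lcomm[symmetric])
      finally show "\<mu> i \<otimes> pow_coeff x y i 1 = (\<Oplus>l\<in>{..<k}. x [^] l \<otimes> y \<otimes> (\<mu> i \<otimes> h l i))" .
    qed (use \<mu> x y h in \<open>auto intro!: finsum_closed\<close>)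
    also have "\<dots> = (\<Oplus>l\<in>{..<k}. \<Oplus>i\<in>{..<Suc k}. x [^] l \<otimes> y \<otimes> (\<mu> i \<otimes> h l i))"
      using \<mu> x y h by (intro finsum_swap) auto
    also have "\<dots> = (\<Oplus>l\<in>{..<k}. x [^] l \<otimes> y \<otimes> f l)"
    proof (rule finsum_cong')
      fix l
      show "(\<Oplus>i\<in>{..<Suc k}. x [^] l \<otimes> y \<otimes> (\<mu> i \<otimes> h l i)) = x [^] l \<otimes> y \<otimes> f l"
        unfolding f_def using \<mu> x y h by (intro finsum_rdistr[symmetric]) auto
    qed (use fc x y in auto)
    finally show ?thesis .
  qed
  then show ?thesis using fL top by (intro exI[of _ f]) auto
qed

text \<open>The elements \<open>u\<close> and \<open>\<one>\<close> are independent over F(x): if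
  \<open>P\<close> were nonzero, then \<open>Q = P \<otimes> s\<close> with \<open>s\<close> in
  F(x), and \<open>(u \<oplus> s) \<otimes> P = \<zero>\<close> would put \<open>u\<close> into
  F(x).\<close>

lemma pow_span_relation:
  assumes x: "x \<in> carrier R" and k: "pow_dep (Suc k) x" "\<not> pow_dep k x"
    and u: "u \<in> centralizer x" "u \<notin> pow_span k x"
    and PQ: "P \<in> pow_span k x" "Q \<in> pow_span k x" "u \<otimes> P \<oplus> Q = \<zero>"
  shows "P = \<zero> \<and> Q = \<zero>"
proof -
  have c: "u \<in> carrier R" "P \<in> carrier R" "Q \<in> carrier R"     by (rule centralizer_carrier[OF u(1)] pow_span_carrier[OF PQ(1) x] pow_span_carrier[OF PQ(2) x])+
  have "P = \<zero>"
  proof (rule ccontr)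
    assume P: "P \<noteq> \<zero>"
    then obtain s where s: "s \<in> pow_span k x" "Q = P \<otimes> s" using pow_span_div[OF x k PQ(2,1)] by blast
    have sc: "s \<in> carrier R" by (rule pow_span_carrier[OF s(1) x])
    have "P \<otimes> s = s \<otimes> P"
      by (rule pow_span_commute[OF x c(2) centralizer_commute[OF pow_span_centralizer[OF x PQ(1)]] s(1)])
    then have "(u \<oplus> s) \<otimes> P = \<zero>" using PQ(3) s(2) c sc by (simp add: l_distr)
    then have "u \<oplus> s = \<zero>" using P c sc by simp
    then have "u = \<ominus> s" using c sc minus_equality[of u s] by simp
    moreover have "\<ominus> \<one> \<otimes> s \<in> pow_span k x" by (rule lin_span_smult) (use s(1) x in auto)
    ultimately show False using u(2) sc by (simp add: l_minus)
  qed
  then show ?thesis using PQ c by simp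
qed

text \<open>The hypothesis \<open>dep\<close> says that the degree \<open>k\<close> of
  \<open>x\<close> does not increase along any line in a direction
  \<open>a \<otimes> r \<ominus> r \<otimes> a\<close>. For an element \<open>u\<close> of the
  centralizer outside F(x), this becomes a relation linear in an arbitrary \<open>r\<close>, to
  which \<open>bimodule_relation\<close> applies with all of \<open>R\<close> in the middle.\<close>

theorem maximal_degree_centralizer:
  assumes x: "x \<in> carrier R" "a \<in> carrier R" "a \<notin> centralizer x"
    and k: "pow_dep (Suc k) x" "\<not> pow_dep k x" and inf: "infinite Z"
    and dep: "\<And>r z. r \<in> carrier R \<Longrightarrow> z \<in> Z \<Longrightarrow> pow_dep (Suc k) (x \<oplus> z \<otimes> (a \<otimes> r \<ominus> r \<otimes> a))"
  shows "centralizer x \<subseteq> pow_span k x"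
proof (rule subsetI, rule ccontr)
  fix u assume u: "u \<in> centralizer x" "u \<notin> pow_span k x"
  have uc: "u \<in> carrier R" using u centralizer_carrier by blast
  obtain \<mu> where m: "\<And>i. \<mu> i \<in> Z" "\<mu> k = \<one>" "pow_sum (Suc k) \<mu> x = \<zero>"
    using monic_relation[OF x(1) k] by blast
  have k0: "0 < k"
  proof (rule ccontr)
    assume "\<not> 0 < k"
    then have "pow_sum (Suc k) \<mu> x = \<one>" using m(1,2) x by (simp add: lessThan_Suc finsum_insert)
    then show False using m(3) one_neq_zero by simp
  qed
  obtain f where f: "\<And>l. f l \<in> pow_span k x" "f (k - 1) = \<mu> k"
    "\<And>y. y \<in> carrier R \<Longrightarrow> (\<Oplus>i\<in>{..<Suc k}. \<mu> i \<otimes> pow_coeff x y i 1) = (\<Oplus>l\<in>{..<k}. x [^] l \<otimes> y \<otimes> f l)"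
    using derivative_expand[of x \<mu> k, OF x(1) m(1)] k0 m(2) by blast
  have fc: "f l \<in> carrier R" for l using pow_span_carrier[OF f(1) x(1)] .
  let ?\<Phi> = "\<lambda>y. \<Oplus>l\<in>{..<k}. x [^] l \<otimes> y \<otimes> f l"
  \<comment> \<open>Here \<open>?\<Phi>\<close> is the derivative of the minimal polynomial. By
    \<open>curve_relation\<close> its value is a central combination of powers of \<open>x\<close>,
    and \<open>u\<close> commutes with those.\<close>
  have comm: "u \<otimes> ?\<Phi> (a \<otimes> r \<ominus> r \<otimes> a) = ?\<Phi> (a \<otimes> r \<ominus> r \<otimes> a) \<otimes> u" if r: "r \<in> carrier R" for r
  proof -
    define y where "y = a \<otimes> r \<ominus> r \<otimes> a"
    have y: "y \<in> carrier R" using r x by (simp add: y_def)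
    let ?X = "\<lambda>i. pow_coeff x y i 1"
    have "infinite (Z - {\<zero>})" using inf by simp
    then have "\<exists>w \<nu>. (\<forall>i. w i \<in> Z) \<and> (\<forall>i. \<nu> i \<in> Z) \<and> (\<exists>i<Suc k. w i \<noteq> \<zero>) \<and>
        pow_sum (Suc k) w x = \<zero> \<and>
        pow_sum (Suc k) \<nu> x \<oplus> (\<Oplus>i\<in>{..<Suc k}. w i \<otimes> ?X i) = \<zero>"
      by (intro curve_relation[of x y "Z - {\<zero>}"]) (use x y dep[OF r] in \<open>auto simp: y_def\<close>)
    then obtain w \<nu> where w: "\<And>i. w i \<in> Z" "\<And>i. \<nu> i \<in> Z" "\<exists>i<Suc k. w i \<noteq> \<zero>"
        "pow_sum (Suc k) w x = \<zero>"
        "pow_sum (Suc k) \<nu> x \<oplus> (\<Oplus>i\<in>{..<Suc k}. w i \<otimes> ?X i) = \<zero>" by blast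
    have wk: "w k \<noteq> \<zero>" by (rule pow_relation_lead[OF x(1) k(2) w(1,3,4)])
    \<comment> \<open>Both sides are relations of length \<open>Suc k\<close> for \<open>x\<close>
      with the same leading coefficient. Their difference has leading coefficient zero, so by the
      minimality of \<open>k\<close> it is zero throughout.\<close>
    have w\<mu>: "w i = w k \<otimes> \<mu> i" if i: "i < Suc k" for i
    proof (rule ccontr)
      assume ne: "w i \<noteq> w k \<otimes> \<mu> i"
      define \<tau> where "\<tau> i = w i \<ominus> w k \<otimes> \<mu> i" for i
      have \<tau>: "\<tau> i \<in> Z" for i using w m by (simp add: \<tau>_def)
      have "pow_sum (Suc k) \<tau> x = (\<Oplus>i\<in>{..<Suc k}. w i \<otimes> x [^] i \<ominus> w k \<otimes> (\<mu> i \<otimes> x [^] i))"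
        using w(1) m(1) x by (intro finsum_cong') (auto simp: \<tau>_def a_minus_def l_distr l_minus m_assoc)
      also have "\<dots> = pow_sum (Suc k) w x \<ominus> (\<Oplus>i\<in>{..<Suc k}. w k \<otimes> (\<mu> i \<otimes> x [^] i))"
        using w(1) m(1) x by (intro finsum_minus) auto
      also have "(\<Oplus>i\<in>{..<Suc k}. w k \<otimes> (\<mu> i \<otimes> x [^] i)) = w k \<otimes> pow_sum (Suc k) \<mu> x"
        using w(1) m(1) x by (intro finsum_rdistr[symmetric]) auto
      finally have 0: "pow_sum (Suc k) \<tau> x = \<zero>" using w(1,4) m(3) by (simp add: a_minus_def)
      have "\<tau> i \<noteq> \<zero>" using ne w(1) m(1) by (simp add: \<tau>_def r_right_minus_eq)
      then have "\<tau> k \<noteq> \<zero>" using pow_relation_lead[OF x(1) k(2) \<tau> _ 0] i by blast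
      then show False using w(1)[of k] m(2) by (simp add: \<tau>_def a_minus_def r_neg)
    qed
    have "(\<Oplus>i\<in>{..<Suc k}. w i \<otimes> ?X i) = (\<Oplus>i\<in>{..<Suc k}. w k \<otimes> (\<mu> i \<otimes> ?X i))"
    proof (rule finsum_cong')
      fix i assume "i \<in> {..<Suc k}"
      then have "w i = w k \<otimes> \<mu> i" by (intro w\<mu>) simp
      then show "w i \<otimes> ?X i = w k \<otimes> (\<mu> i \<otimes> ?X i)" using w(1)[of k] m(1) x(1) y by (simp add: m_assoc)
    qed (use w(1) m(1) x(1) y in auto)
    also have "\<dots> = w k \<otimes> (\<Oplus>i\<in>{..<Suc k}. \<mu> i \<otimes> ?X i)"
      using w(1) m(1) x y by (intro finsum_rdistr[symmetric]) auto
    also have "\<dots> = w k \<otimes> ?\<Phi> y" using f(3)[OF y] by simp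
    finally have e: "pow_sum (Suc k) \<nu> x \<oplus> w k \<otimes> ?\<Phi> y = \<zero>" using w(5) by simp
    define t where "t = pow_sum (Suc k) \<nu> x"
    have \<Phi>c: "?\<Phi> y \<in> carrier R" using x y fc by (intro finsum_closed) auto
    have "x \<in> centralizer u" using centralizer_sym[OF x(1) u(1)] .
    then have tu: "t \<in> centralizer u" unfolding t_def using w(2) uc by (intro centralizer_finsum) auto
    then have "t \<in> carrier R" by (rule centralizer_carrier)
    then have "w k \<otimes> ?\<Phi> y = \<ominus> t" using e \<Phi>c w(1)[of k] minus_equality[of "w k \<otimes> ?\<Phi> y" t]
      by (simp add: t_def[symmetric] a_comm)
    then have "inv (w k) \<otimes> (w k \<otimes> ?\<Phi> y) = inv (w k) \<otimes> (\<ominus> t)" by simp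
    then have "?\<Phi> y = inv (w k) \<otimes> (\<ominus> t)" using wk w(1)[of k] \<Phi>c by simp
    then have "?\<Phi> y \<in> centralizer u" using tu wk w(1)[of k] uc by simp
    then show ?thesis using centralizer_commute[of "?\<Phi> y" u] by (simp add: y_def)
  qed
  \<comment> \<open>For each \<open>l\<close>, the commutator of \<open>u\<close> with \<open>x [^]
    l \<otimes> (a \<otimes> r \<ominus> r \<otimes> a) \<otimes> f l\<close> expands into four
    terms. The index \<open>t\<close> numbers them, \<open>U\<close> is what stands to the left of
    \<open>r\<close>, and \<open>W\<close> is what stands to its right, including the sign.\<close>
  define U where "U p = (case p of (l, t) \<Rightarrow> (if t = 0 then u \<otimes> x [^] l \<otimes> a else if t = 1 then u \<otimes> x [^] l
      else if t = 2 then x [^] l \<otimes> a else x [^] l))" for p :: "nat \<times> nat"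
  define W where "W p = (case p of (l, t) \<Rightarrow> (if t = 0 then f l else if t = 1 then \<ominus> (a \<otimes> f l)
      else if t = 2 then \<ominus> (f l \<otimes> u) else a \<otimes> f l \<otimes> u))" for p :: "nat \<times> nat"
  let ?I = "{..<k} \<times> {0, 1, 2, 3 :: nat}"
  have Uc: "U p \<in> carrier R" and Wc: "W p \<in> carrier R" for p
    using x uc fc by (auto simp: U_def W_def split: prod.split)
  have rel: "(\<Oplus>p\<in>?I. U p \<otimes> r \<otimes> W p) = \<zero>" if r: "r \<in> carrier R" for r
  proof -
    define y where "y = a \<otimes> r \<ominus> r \<otimes> a"
    have y: "y \<in> carrier R" using r x by (simp add: y_def)
    have "(\<Oplus>p\<in>?I. U p \<otimes> r \<otimes> W p) = (\<Oplus>l\<in>{..<k}. \<Oplus>t\<in>{0,1,2,3}. U (l, t) \<otimes> r \<otimes> W (l, t))"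
      using Uc Wc r by (intro finsum_product) auto
    also have "\<dots> = (\<Oplus>l\<in>{..<k}. u \<otimes> (x [^] l \<otimes> y \<otimes> f l) \<ominus> (x [^] l \<otimes> y \<otimes> f l) \<otimes> u)"
    proof (rule finsum_cong')
      fix l
      define V F where "V = x [^] l" and "F = f l"
      have VF: "V \<in> carrier R" "F \<in> carrier R" using x fc by (auto simp: V_def F_def)
      have "(\<Oplus>t\<in>{0,1,2,3}. U (l, t) \<otimes> r \<otimes> W (l, t))
          = u \<otimes> V \<otimes> a \<otimes> r \<otimes> F \<oplus> (u \<otimes> V \<otimes> r \<otimes> (\<ominus> (a \<otimes> F)) \<oplus>
            (V \<otimes> a \<otimes> r \<otimes> (\<ominus> (F \<otimes> u)) \<oplus> V \<otimes> r \<otimes> (a \<otimes> F \<otimes> u)))"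
        using x uc fc r VF by (simp add: finsum_insert U_def W_def V_def F_def)
      also have "\<dots> = u \<otimes> (V \<otimes> y \<otimes> F) \<ominus> (V \<otimes> y \<otimes> F) \<otimes> u"
        unfolding y_def using x(1,2) uc r VF by algebra
      finally show "(\<Oplus>t\<in>{0,1,2,3}. U (l, t) \<otimes> r \<otimes> W (l, t))
          = u \<otimes> (x [^] l \<otimes> y \<otimes> f l) \<ominus> (x [^] l \<otimes> y \<otimes> f l) \<otimes> u" by (simp add: V_def F_def)
    qed (use x uc fc y in auto)
    also have "\<dots> = (\<Oplus>l\<in>{..<k}. u \<otimes> (x [^] l \<otimes> y \<otimes> f l)) \<ominus> (\<Oplus>l\<in>{..<k}. (x [^] l \<otimes> y \<otimes> f l) \<otimes> u)"
      using x uc fc y by (intro finsum_minus) auto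
    also have "(\<Oplus>l\<in>{..<k}. u \<otimes> (x [^] l \<otimes> y \<otimes> f l)) = u \<otimes> ?\<Phi> y"
      using x uc fc y by (intro finsum_rdistr[symmetric]) auto
    also have "(\<Oplus>l\<in>{..<k}. (x [^] l \<otimes> y \<otimes> f l) \<otimes> u) = ?\<Phi> y \<otimes> u"
      using x uc fc y by (intro finsum_ldistr[symmetric]) auto
    also have "u \<otimes> ?\<Phi> y \<ominus> ?\<Phi> y \<otimes> u = \<zero>"
      using comm[OF r] x uc fc y by (simp add: y_def[symmetric] r_right_minus_eq finsum_closed)
    finally show ?thesis .
  qed
  have "\<exists>\<zeta>. (\<forall>p\<in>?I. \<zeta> p \<in> carrier R \<and> (\<forall>c\<in>carrier R. c \<otimes> \<zeta> p = \<zeta> p \<otimes> c)) \<and> (\<exists>p\<in>?I. \<zeta> p \<noteq> \<zero>) \<and>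
      (\<Oplus>p\<in>?I. U p \<otimes> \<zeta> p) = \<zero>"
  proof (rule bimodule_relation)
    \<comment> \<open>The coefficient \<open>f (k - 1)\<close> is the leading coefficient of the
      monic minimal polynomial.\<close>
    show "\<exists>p\<in>?I. W p \<noteq> \<zero>" using k0 f(2) m(2) by (intro bexI[of _ "(k - 1, 0)"]) (auto simp: W_def)
  qed (use Uc Wc rel in auto)
  then obtain \<zeta> where "(\<forall>p\<in>?I. \<zeta> p \<in> carrier R \<and> (\<forall>c\<in>carrier R. c \<otimes> \<zeta> p = \<zeta> p \<otimes> c)) \<and>
      (\<exists>p\<in>?I. \<zeta> p \<noteq> \<zero>) \<and> (\<Oplus>p\<in>?I. U p \<otimes> \<zeta> p) = \<zero>" ..
  then have \<zeta>: "\<And>p. p \<in> ?I \<Longrightarrow> \<zeta> p \<in> carrier R"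
      "\<And>p c. p \<in> ?I \<Longrightarrow> c \<in> carrier R \<Longrightarrow> c \<otimes> \<zeta> p = \<zeta> p \<otimes> c"
      "\<exists>p\<in>?I. \<zeta> p \<noteq> \<zero>" "(\<Oplus>p\<in>?I. U p \<otimes> \<zeta> p) = \<zero>" by blast+
  define \<beta> where "\<beta> t l = (if l < k then \<zeta> (l, t) else \<zero>)" for t l
  have \<beta>Z: "\<beta> t l \<in> Z" if "t \<in> {0,1,2,3}" for t l
  proof (cases "l < k")
    case True
    then have I: "(l, t) \<in> ?I" using that by auto
    have "\<zeta> (l, t) \<in> Z" by (rule Z_I[OF \<zeta>(1)[OF I] \<zeta>(2)[OF I, symmetric]])
    then show ?thesis using True by (simp add: \<beta>_def)
  qed (simp add: \<beta>_def)
  \<comment> \<open>The central coefficients of each of the four types are gathered into one element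
    of F(x).\<close>
  define P where "P t = (\<Oplus>l\<in>{..<k}. \<beta> t l \<otimes> x [^] l)" for t
  have PL: "P t \<in> pow_span k x" if "t \<in> {0,1,2,3}" for t
    unfolding P_def lin_span_def using \<beta>Z[OF that] by blast
  have Pc: "P t \<in> carrier R" if "t \<in> {0,1,2,3}" for t using PL[OF that] x by simp
  have P0: "\<beta> t l = \<zero>" if "P t = \<zero>" "t \<in> {0,1,2,3}" "l < k" for t l
    using k(2) that \<beta>Z[OF that(2)] unfolding P_def lin_dep_def by blast
  have sumP: "(\<Oplus>l\<in>{..<k}. v \<otimes> x [^] l \<otimes> v' \<otimes> \<beta> t l) = v \<otimes> P t \<otimes> v'"
    if "t \<in> {0,1,2,3}" "v \<in> carrier R" "v' \<in> carrier R" for t v v'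
  proof -
    have "(\<Oplus>l\<in>{..<k}. v \<otimes> x [^] l \<otimes> v' \<otimes> \<beta> t l) = (\<Oplus>l\<in>{..<k}. v \<otimes> (\<beta> t l \<otimes> x [^] l) \<otimes> v')"
    proof (rule finsum_cong')
      fix l
      have b: "\<beta> t l \<in> Z" "\<beta> t l \<in> carrier R" "x [^] l \<in> carrier R" using \<beta>Z[OF that(1)] x by auto
      have "v \<otimes> x [^] l \<otimes> v' \<otimes> \<beta> t l = \<beta> t l \<otimes> (v \<otimes> x [^] l \<otimes> v')"
        using b that by (intro Z_comm) auto
      also have "\<dots> = (\<beta> t l \<otimes> (v \<otimes> x [^] l)) \<otimes> v'" using b that by (simp add: m_assoc)
      also have "\<beta> t l \<otimes> (v \<otimes> x [^] l) = v \<otimes> (\<beta> t l \<otimes> x [^] l)" using b that by (intro Z_lcomm[symmetric]) auto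
      finally show "v \<otimes> x [^] l \<otimes> v' \<otimes> \<beta> t l = v \<otimes> (\<beta> t l \<otimes> x [^] l) \<otimes> v'" .
    qed (use \<beta>Z[OF that(1)] x that in auto)
    also have "\<dots> = (\<Oplus>l\<in>{..<k}. v \<otimes> (\<beta> t l \<otimes> x [^] l)) \<otimes> v'"
      using \<beta>Z[OF that(1)] x that by (intro finsum_ldistr[symmetric]) auto
    also have "(\<Oplus>l\<in>{..<k}. v \<otimes> (\<beta> t l \<otimes> x [^] l)) = v \<otimes> P t"
      unfolding P_def using \<beta>Z[OF that(1)] x that by (intro finsum_rdistr[symmetric]) auto
    finally show ?thesis .
  qed
  have "\<zero> = (\<Oplus>l\<in>{..<k}. \<Oplus>t\<in>{0,1,2,3}. U (l, t) \<otimes> \<zeta> (l, t))"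
    using \<zeta>(4) finsum_product[of "{..<k}" "{0,1,2,3}" "\<lambda>p. U p \<otimes> \<zeta> p"] Uc \<zeta>(1) by simp
  also have "\<dots> = (\<Oplus>l\<in>{..<k}. u \<otimes> x [^] l \<otimes> a \<otimes> \<beta> 0 l \<oplus> (u \<otimes> x [^] l \<otimes> \<one> \<otimes> \<beta> 1 l \<oplus>
      (\<one> \<otimes> x [^] l \<otimes> a \<otimes> \<beta> 2 l \<oplus> \<one> \<otimes> x [^] l \<otimes> \<one> \<otimes> \<beta> 3 l)))"
    using \<beta>Z x uc \<zeta>(1) by (intro finsum_cong') (auto simp: finsum_insert U_def \<beta>_def)
  also have "\<dots> = u \<otimes> P 0 \<otimes> a \<oplus> (u \<otimes> P 1 \<otimes> \<one> \<oplus> (\<one> \<otimes> P 2 \<otimes> a \<oplus> \<one> \<otimes> P 3 \<otimes> \<one>))"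
    using \<beta>Z x uc by (simp add: finsum_addf sumP[symmetric] Pi_def)
  also have "\<dots> = (u \<otimes> P 0 \<oplus> P 2) \<otimes> a \<oplus> (u \<otimes> P 1 \<oplus> P 3)"
    using Pc[of 0] Pc[of 1] Pc[of 2] Pc[of 3] x uc by (simp add: l_distr a_ac)
  finally have e: "(u \<otimes> P 0 \<oplus> P 2) \<otimes> a \<oplus> (u \<otimes> P 1 \<oplus> P 3) = \<zero>" by simp
  \<comment> \<open>Both commute with \<open>x\<close>. As \<open>a\<close> does not, it cannot be a
    quotient of the two, and \<open>G \<otimes> a \<oplus> H = \<zero>\<close> leaves only
    \<open>G = H = \<zero>\<close>.\<close>
  define G H where "G = u \<otimes> P 0 \<oplus> P 2" and "H = u \<otimes> P 1 \<oplus> P 3"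
  have eGH: "G \<otimes> a \<oplus> H = \<zero>" using e by (simp only: G_def H_def)
  have GH: "G \<in> centralizer x" "H \<in> centralizer x" unfolding G_def H_def
    using u x PL[THEN pow_span_centralizer[OF x(1)]] by auto
  have G0: "G = \<zero>"
  proof (rule ccontr)
    assume G: "G \<noteq> \<zero>"
    have c: "G \<in> carrier R" "H \<in> carrier R" using GH centralizer_carrier by blast+
    have "G \<otimes> a = \<ominus> H" using eGH c x minus_equality[of "G \<otimes> a" H] by simp
    then have "inv G \<otimes> (G \<otimes> a) = inv G \<otimes> (\<ominus> H)" by simp
    then have "a = inv G \<otimes> (\<ominus> H)" using G c x by simp
    then have "a \<in> centralizer x" using centralizer_inv[OF x(1) GH(1) G] GH x by simp
    then show False using x by simp
  qed
  then have H0: "H = \<zero>"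
    using eGH GH(2)[THEN centralizer_carrier] x by simp
  have "P 0 = \<zero> \<and> P 2 = \<zero>" "P 1 = \<zero> \<and> P 3 = \<zero>"
    by (rule pow_span_relation[OF x(1) k u PL PL G0[unfolded G_def]], simp, simp)
      (rule pow_span_relation[OF x(1) k u PL PL H0[unfolded H_def]], simp, simp)
  then have "P t = \<zero>" if "t \<in> {0,1,2,3}" for t using that by auto
  then have "\<beta> t l = \<zero>" if "t \<in> {0,1,2,3}" "l < k" for t l using P0 that by blast
  then have "\<zeta> p = \<zero>" if "p \<in> ?I" for p using that by (auto simp: \<beta>_def)
  then show False using \<zeta>(3) by blast
qed

section \<open>Dimension over the center\<close>


text \<open>Bridge from the list-based \<open>combine\<close>, which underlies \<open>Span\<close>
  and \<open>dimension\<close>, to sums over an index set.\<close>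

lemma combine_eq_finsum:
  assumes "\<And>i. i < n \<Longrightarrow> \<alpha> i \<in> carrier R" "\<And>i. i < n \<Longrightarrow> v i \<in> carrier R"
  shows "combine (map \<alpha> [0..<n]) (map v [0..<n]) = (\<Oplus>i\<in>{..<n}. \<alpha> i \<otimes> v i)"
  using assms
proof (induction n)
  case (Suc n)
  have "combine (map \<alpha> [0..<Suc n]) (map v [0..<Suc n])
      = combine (map \<alpha> [0..<n]) (map v [0..<n]) \<oplus> combine [\<alpha> n] [v n]"
    using Suc.prems by (simp del: combine.simps) (rule combine_append[symmetric], auto)
  also have "\<dots> = \<alpha> n \<otimes> v n \<oplus> (\<Oplus>i\<in>{..<n}. \<alpha> i \<otimes> v i)"
    using Suc by (simp add: a_comm finsum_closed)
  also have "\<dots> = (\<Oplus>i\<in>{..<Suc n}. \<alpha> i \<otimes> v i)"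
    unfolding lessThan_Suc using Suc.prems by (intro finsum_insert[symmetric]) auto
  finally show ?case .
qed simp

lemma Span_subset_lin_span:
  assumes "set Vs \<subseteq> carrier R"
  shows "Span Z Vs \<subseteq> lin_span Z {..<length Vs} (\<lambda>i. Vs ! i)"
proof
  fix p assume "p \<in> Span Z Vs"
  then obtain Ks where Ks: "length Ks = length Vs" "set Ks \<subseteq> Z" "p = combine Ks Vs"
    using Span_eq_combine_set_length_version[OF ring_center_subfield assms] by blast
  have K: "Ks ! i \<in> Z" if "i < length Vs" for i using Ks that nth_mem by fastforce
  have V: "Vs ! i \<in> carrier R" if "i < length Vs" for i using assms that nth_mem by blast
  define \<alpha> where "\<alpha> i = (if i < length Vs then Ks ! i else \<zero>)" for i
  have "combine Ks Vs = combine (map \<alpha> [0..<length Vs]) (map (\<lambda>i. Vs ! i) [0..<length Vs])"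
    using Ks(1) by (intro arg_cong2[where f = combine] nth_equalityI) (auto simp: \<alpha>_def)
  also have "\<dots> = (\<Oplus>i\<in>{..<length Vs}. \<alpha> i \<otimes> Vs ! i)"
    using K V by (intro combine_eq_finsum) (auto simp: \<alpha>_def)
  finally show "p \<in> lin_span Z {..<length Vs} (\<lambda>i. Vs ! i)"
    unfolding Ks(3) lin_span_def using K by (intro CollectI exI[of _ \<alpha>]) (auto simp: \<alpha>_def)
qed

text \<open>This converts the hypothesis on the dimension of F(x) into \<open>pow_dep\<close>, not
  only for \<open>x\<close> but for every element of that field.\<close>

lemma dimension_lin_dep:
  assumes "dimension n Z E" "\<And>j. j \<in> J \<Longrightarrow> w j \<in> E" "finite J" "n < card J"
  shows "lin_dep Z J w"
proof -
  obtain Vs where Vs: "set Vs \<subseteq> carrier R" "length Vs = n" "Span Z Vs = E"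
    using exists_base[OF ring_center_subfield assms(1)] by blast
  show ?thesis
  proof (rule lin_dep_of_span[where I = "{..<n}" and v = "\<lambda>i. Vs ! i"])
    show "w j \<in> lin_span Z {..<n} (\<lambda>i. Vs ! i)" if "j \<in> J" for j
      using Span_subset_lin_span[OF Vs(1)] Vs(2,3) assms(2)[OF that] by blast
    show "Vs ! i \<in> carrier R" if "i \<in> {..<n}" for i using Vs that nth_mem by blast
  qed (use assms in auto)
qed

text \<open>A spanning family is listed and thinned out to an independent list; a list longer than
  \<open>card P\<close> would be dependent by \<open>lin_dep_of_span\<close>.\<close>

lemma dimension_of_lin_span:
  assumes P: "finite P" "\<And>p. p \<in> P \<Longrightarrow> e p \<in> carrier R" and span: "carrier R \<subseteq> lin_span Z P e"
  shows "\<exists>n\<le>card P. dimension n Z (carrier R)"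
proof -
  obtain ps where ps: "set ps = P" using finite_list[OF P(1)] by blast
  have es: "set (map e ps) \<subseteq> carrier R" using P ps by auto
  obtain Vs where Vs: "set Vs \<subseteq> carrier R" "independent Z Vs" "Span Z Vs = Span Z (map e ps)"
    using filter_base[OF ring_center_subfield es] by blast
  note sp = Span_subgroup_props[OF ring_center_subfield es]
  have "x \<in> Span Z (map e ps)" if x: "x \<in> carrier R" for x
  proof -
    obtain \<alpha> where a: "\<And>i. \<alpha> i \<in> Z" "x = (\<Oplus>i\<in>P. \<alpha> i \<otimes> e i)"
      using span x by (auto simp: lin_span_def)
    have mem: "\<alpha> p \<otimes> e p \<in> Span Z (map e ps)" if "p \<in> P" for p
      using Span_base_incl[OF ring_center_subfield es] that ps a(1)
      by (intro Span_smult_closed[OF ring_center_subfield es]) auto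
    have "(\<Oplus>i\<in>Q. \<alpha> i \<otimes> e i) \<in> Span Z (map e ps)" if "finite Q" "Q \<subseteq> P" for Q
      using that
    proof (induction Q rule: finite_induct)
      case (insert q Q)
      then have "(\<Oplus>i\<in>insert q Q. \<alpha> i \<otimes> e i) = \<alpha> q \<otimes> e q \<oplus> (\<Oplus>i\<in>Q. \<alpha> i \<otimes> e i)"
        using a(1) P by (intro finsum_insert) auto
      then show ?case using insert mem sp(3) by auto
    qed (use sp in simp)
    then show ?thesis using a P by auto
  qed
  then have full: "Span Z Vs = carrier R" using Vs(3) sp(1) by blast
  have "length Vs \<le> card P"
  proof (rule ccontr)
    assume "\<not> length Vs \<le> card P"
    then have "lin_dep Z {..<length Vs} (\<lambda>i. Vs ! i)"
      using P span Vs(1) nth_mem by (intro lin_dep_of_span[where I = P and v = e]) fastforce+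
    then obtain \<alpha> where a: "\<And>i. \<alpha> i \<in> Z" "\<exists>i<length Vs. \<alpha> i \<noteq> \<zero>"
        "(\<Oplus>i\<in>{..<length Vs}. \<alpha> i \<otimes> Vs ! i) = \<zero>"
      unfolding lin_dep_def by blast
    have V: "Vs ! i \<in> carrier R" if "i < length Vs" for i using Vs(1) that nth_mem by blast
    have "combine (map \<alpha> [0..<length Vs]) (map (\<lambda>i. Vs ! i) [0..<length Vs]) = \<zero>"
      using a V by (subst combine_eq_finsum) auto
    then have c: "combine (map \<alpha> [0..<length Vs]) Vs = \<zero>" by (simp add: map_nth)
    have nt: "\<not> set (take (length Vs) (map \<alpha> [0..<length Vs])) \<subseteq> {\<zero>}"
    proof
      assume *: "set (take (length Vs) (map \<alpha> [0..<length Vs])) \<subseteq> {\<zero>}"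
      obtain i where i: "i < length Vs" "\<alpha> i \<noteq> \<zero>" using a(2) by blast
      then have "\<alpha> i \<in> \<alpha> ` {0..<length Vs}" by (intro imageI) simp
      moreover have "\<alpha> ` {0..<length Vs} \<subseteq> {\<zero>}" using * by simp
      ultimately have "\<alpha> i \<in> {\<zero>}" by (rule subsetD[rotated])
      then show False using i by simp
    qed
    have "dependent Z Vs"
      by (rule non_trivial_combine_imp_dependent[OF ring_center_subfield _ c nt]) (use a(1) in auto)
    then show False using Vs by simp
  qed
  then show ?thesis using dimensionI[OF ring_center_subfield Vs(2) full] by blast
qed

text \<open>More than \<open>k\<close> elements are right dependent over \<open>F(x)\<close>:
  \<open>k\<close> linear equations in more than \<open>k\<close> unknowns have a solution
  \<open>w\<close>, to which \<open>bimodule_relation\<close> applies.\<close>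

theorem dimension_le_square:
  assumes x: "x \<in> carrier R" and k: "pow_dep (Suc k) x" "\<not> pow_dep k x"
    and cent: "centralizer x \<subseteq> pow_span k x"
  shows "\<exists>n\<le>k\<^sup>2. dimension n Z (carrier R)"
proof -
  define rdep where "rdep m u \<longleftrightarrow> (\<exists>\<zeta>. (\<forall>i. \<zeta> i \<in> centralizer x) \<and> (\<exists>i<m. \<zeta> i \<noteq> \<zero>) \<and>
      (\<Oplus>i\<in>{..<m}. u i \<otimes> \<zeta> i) = \<zero>)" for m :: nat and u :: "nat \<Rightarrow> 'a"
  have cc: "centralizer x \<subseteq> carrier R" using centralizer_carrier by blast
  have many: "rdep m u" if u: "\<And>i. u i \<in> carrier R" and m: "k < m" for m u
  proof -
    \<comment> \<open>The \<open>k\<close> equations insert the powers \<open>x [^] j\<close>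
      between \<open>u i\<close> and \<open>w i\<close>. By central linearity the same sum then
      vanishes with any element of F(x), hence of \<open>centralizer x\<close>, in between.\<close>
    have "\<exists>w. (\<forall>j. w j \<in> carrier R) \<and> (\<exists>j\<in>{..<m}. w j \<noteq> \<zero>) \<and>
        (\<forall>j\<in>{..<k}. (\<Oplus>i\<in>{..<m}. u i \<otimes> x [^] j \<otimes> w i) = \<zero>)"
      by (rule homogeneous_system[OF carrier_is_subring]) (use u x m in auto)
    then obtain w where w: "\<And>j. w j \<in> carrier R" "\<exists>j\<in>{..<m}. w j \<noteq> \<zero>"
        "\<And>j. j < k \<Longrightarrow> (\<Oplus>i\<in>{..<m}. u i \<otimes> x [^] j \<otimes> w i) = \<zero>" by blast
    have rel: "(\<Oplus>i\<in>{..<m}. u i \<otimes> c \<otimes> w i) = \<zero>" if "c \<in> centralizer x" for c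
    proof -
      obtain \<alpha> where a: "\<And>i. \<alpha> i \<in> Z" "c = pow_sum k \<alpha> x"
        using cent \<open>c \<in> centralizer x\<close> by (auto simp: lin_span_def)
      have "(\<Oplus>i\<in>{..<m}. u i \<otimes> c \<otimes> w i) = (\<Oplus>i\<in>{..<m}. \<Oplus>j\<in>{..<k}. \<alpha> j \<otimes> (u i \<otimes> x [^] j \<otimes> w i))"
      proof (rule finsum_cong')
        fix i
        have "u i \<otimes> c \<otimes> w i = (\<Oplus>j\<in>{..<k}. u i \<otimes> (\<alpha> j \<otimes> x [^] j)) \<otimes> w i"
          unfolding a(2) using a(1) u[of i] x by (subst finsum_rdistr) auto
        also have "\<dots> = (\<Oplus>j\<in>{..<k}. u i \<otimes> (\<alpha> j \<otimes> x [^] j) \<otimes> w i)"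
          using a(1) u w x by (intro finsum_ldistr) auto
        also have "\<dots> = (\<Oplus>j\<in>{..<k}. \<alpha> j \<otimes> (u i \<otimes> x [^] j \<otimes> w i))"
        proof (rule finsum_cong')
          fix j
          show "u i \<otimes> (\<alpha> j \<otimes> x [^] j) \<otimes> w i = \<alpha> j \<otimes> (u i \<otimes> x [^] j \<otimes> w i)"
            using Z_lcomm[OF a(1) u[of i], of "x [^] j" j] a(1) u w x by (simp add: m_assoc)
        qed (use a(1) u w x in auto)
        finally show "u i \<otimes> c \<otimes> w i = (\<Oplus>j\<in>{..<k}. \<alpha> j \<otimes> (u i \<otimes> x [^] j \<otimes> w i))" .
      qed (use a(1) u w x in \<open>auto intro!: finsum_closed\<close>)
      also have "\<dots> = (\<Oplus>j\<in>{..<k}. \<Oplus>i\<in>{..<m}. \<alpha> j \<otimes> (u i \<otimes> x [^] j \<otimes> w i))"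
        using a(1) u w x by (intro finsum_swap) auto
      also have "\<dots> = (\<Oplus>j\<in>{..<k}. \<alpha> j \<otimes> (\<Oplus>i\<in>{..<m}. u i \<otimes> x [^] j \<otimes> w i))"
      proof (rule finsum_cong')
        fix j
        show "(\<Oplus>i\<in>{..<m}. \<alpha> j \<otimes> (u i \<otimes> x [^] j \<otimes> w i)) = \<alpha> j \<otimes> (\<Oplus>i\<in>{..<m}. u i \<otimes> x [^] j \<otimes> w i)"
          using a(1) u w(1) x by (intro finsum_rdistr[symmetric]) auto
      qed (use a(1) u w(1) x in \<open>auto intro!: finsum_closed\<close>)
      also have "\<dots> = \<zero>" using w(3) a(1) by (intro add.finprod_one_eqI) auto
      finally show ?thesis .
    qed
    \<comment> \<open>Since \<open>x\<close> belongs to its own centralizer, coefficients commuting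
      with all of it lie in \<open>centralizer x\<close> again.\<close>
    have "\<exists>\<zeta>. (\<forall>i\<in>{..<m}. \<zeta> i \<in> carrier R \<and> (\<forall>c\<in>centralizer x. c \<otimes> \<zeta> i = \<zeta> i \<otimes> c)) \<and>
        (\<exists>i\<in>{..<m}. \<zeta> i \<noteq> \<zero>) \<and> (\<Oplus>i\<in>{..<m}. u i \<otimes> \<zeta> i) = \<zero>"
      by (rule bimodule_relation[OF _ _ _ cc _ _ rel w(2)]) (use u w x in auto)
    then obtain \<zeta> where "(\<forall>i\<in>{..<m}. \<zeta> i \<in> carrier R \<and> (\<forall>c\<in>centralizer x. c \<otimes> \<zeta> i = \<zeta> i \<otimes> c)) \<and>
        (\<exists>i\<in>{..<m}. \<zeta> i \<noteq> \<zero>) \<and> (\<Oplus>i\<in>{..<m}. u i \<otimes> \<zeta> i) = \<zero>" ..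
    then have z: "\<And>i. i < m \<Longrightarrow> \<zeta> i \<in> carrier R" "\<And>i. i < m \<Longrightarrow> x \<otimes> \<zeta> i = \<zeta> i \<otimes> x"
        "\<exists>i<m. \<zeta> i \<noteq> \<zero>" "(\<Oplus>i\<in>{..<m}. u i \<otimes> \<zeta> i) = \<zero>"
      using x by auto
    define \<zeta>' where "\<zeta>' i = (if i < m then \<zeta> i else \<zero>)" for i
    have "\<zeta>' i \<in> centralizer x" for i
      using x centralizerI[OF z(1) z(2)[symmetric]] by (auto simp: \<zeta>'_def)
    moreover have "(\<Oplus>i\<in>{..<m}. u i \<otimes> \<zeta>' i) = (\<Oplus>i\<in>{..<m}. u i \<otimes> \<zeta> i)"
      using z(1) u by (intro finsum_cong') (auto simp: \<zeta>'_def)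
    ultimately show ?thesis unfolding rdep_def using z(3,4)
      by (intro exI[of _ \<zeta>']) (auto simp: \<zeta>'_def)
  qed
  \<comment> \<open>A largest right independent family has \<open>m \<le> k\<close> members. One
    more element \<open>v\<close> makes it dependent with nonzero last coefficient, so
    \<open>v\<close> lies in the span of the \<open>m * k\<close> products
    \<open>u i \<otimes> x [^] j\<close>.\<close>
  let ?Q = "\<lambda>m. \<exists>u. (\<forall>i. u i \<in> carrier R) \<and> \<not> rdep m u"
  have Q0: "?Q 0" by (intro exI[of _ "\<lambda>_. \<zero>"]) (auto simp: rdep_def)
  have Qk: "m \<le> k" if "?Q m" for m using many that by (meson not_le)
  define m where "m = Greatest ?Q"
  have Qm: "?Q m" unfolding m_def by (rule GreatestI_nat[of ?Q, OF Q0 Qk])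
  have mmax: "\<not> ?Q (Suc m)"
  proof
    assume "?Q (Suc m)"
    then have "Suc m \<le> m" unfolding m_def by (rule Greatest_le_nat[of ?Q, OF _ Qk])
    then show False by simp
  qed
  obtain u where u: "\<And>i. u i \<in> carrier R" "\<not> rdep m u" using Qm by blast
  define P where "P = {..<m} \<times> {..<k}"
  define e where "e p = u (fst p) \<otimes> x [^] snd p" for p :: "nat \<times> nat"
  have e: "e p \<in> carrier R" for p using u x by (simp add: e_def)
  have P: "finite P" by (simp add: P_def)
  have ue: "u i \<otimes> c \<in> lin_span Z P e" if i: "i < m" and c: "c \<in> pow_span k x" for i c
  proof -
    obtain \<alpha> where a: "\<And>i. \<alpha> i \<in> Z" "c = pow_sum k \<alpha> x"
      using c by (auto simp: lin_span_def)
    have "u i \<otimes> c = (\<Oplus>j\<in>{..<k}. u i \<otimes> (\<alpha> j \<otimes> x [^] j))"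
      unfolding a(2) using a(1) u x by (intro finsum_rdistr) auto
    also have "\<dots> = (\<Oplus>j\<in>{..<k}. \<alpha> j \<otimes> e (i, j))"
      using a(1) u x by (intro finsum_cong') (auto simp: e_def intro: Z_lcomm)
    also have "\<dots> \<in> lin_span Z P e"
    proof (rule lin_span_finsum)
      fix j assume "j \<in> {..<k}"
      then have "e (i, j) \<in> lin_span Z P e" using i e P by (intro lin_span_base) (auto simp: P_def)
      then show "\<alpha> j \<otimes> e (i, j) \<in> lin_span Z P e" by (rule lin_span_smult[rotated 2]) (use a e P in auto)
    qed (use e in auto)
    finally show ?thesis .
  qed
  have "v \<in> lin_span Z P e" if v: "v \<in> carrier R" for v
  proof -
    let ?u = "u(m := v)"
    have "\<forall>i. ?u i \<in> carrier R" using u v by simp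
    then have "rdep (Suc m) ?u" using mmax by blast
    then obtain \<zeta> where z: "\<And>i. \<zeta> i \<in> centralizer x" "\<exists>i<Suc m. \<zeta> i \<noteq> \<zero>"
        "(\<Oplus>i\<in>{..<Suc m}. ?u i \<otimes> \<zeta> i) = \<zero>" unfolding rdep_def by blast
    have zc: "\<zeta> i \<in> carrier R" for i using centralizer_carrier[OF z(1)] .
    have "(\<Oplus>i\<in>{..<Suc m}. ?u i \<otimes> \<zeta> i) = ?u m \<otimes> \<zeta> m \<oplus> (\<Oplus>i\<in>{..<m}. ?u i \<otimes> \<zeta> i)"
      unfolding lessThan_Suc using u v zc by (intro finsum_insert) auto
    also have "(\<Oplus>i\<in>{..<m}. ?u i \<otimes> \<zeta> i) = (\<Oplus>i\<in>{..<m}. u i \<otimes> \<zeta> i)"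
      using u v zc by (intro finsum_cong') auto
    finally have s: "v \<otimes> \<zeta> m \<oplus> (\<Oplus>i\<in>{..<m}. u i \<otimes> \<zeta> i) = \<zero>" using z(3) by simp
    have S: "(\<Oplus>i\<in>{..<m}. u i \<otimes> \<zeta> i) \<in> carrier R" using u zc by (intro finsum_closed) auto
    have zm: "\<zeta> m \<noteq> \<zero>"
    proof
      assume 0: "\<zeta> m = \<zero>"
      then have "(\<Oplus>i\<in>{..<m}. u i \<otimes> \<zeta> i) = \<zero>" using s S v by simp
      moreover have "\<exists>i<m. \<zeta> i \<noteq> \<zero>" using z(2) 0 by (auto simp: less_Suc_eq)
      ultimately have "rdep m u" unfolding rdep_def using z(1) by blast
      then show False using u by simp
    qed
    have iz: "\<ominus> (inv (\<zeta> m)) \<in> centralizer x" "inv (\<zeta> m) \<in> carrier R"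
      using centralizer_inv[OF x z(1) zm] x zm zc by auto
    have "v \<otimes> \<zeta> m = \<ominus> (\<Oplus>i\<in>{..<m}. u i \<otimes> \<zeta> i)"
      using s S v zc minus_equality[of "v \<otimes> \<zeta> m" "\<Oplus>i\<in>{..<m}. u i \<otimes> \<zeta> i"] by simp
    then have "v \<otimes> \<zeta> m \<otimes> inv (\<zeta> m) = \<ominus> (\<Oplus>i\<in>{..<m}. u i \<otimes> \<zeta> i) \<otimes> inv (\<zeta> m)" by simp
    then have "v = (\<Oplus>i\<in>{..<m}. u i \<otimes> \<zeta> i) \<otimes> (\<ominus> (inv (\<zeta> m)))"
      using v zm zc S iz by (simp add: l_minus r_minus)
    also have "\<dots> = (\<Oplus>i\<in>{..<m}. u i \<otimes> \<zeta> i \<otimes> (\<ominus> (inv (\<zeta> m))))"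
      using u zc iz by (intro finsum_ldistr) auto
    also have "\<dots> = (\<Oplus>i\<in>{..<m}. u i \<otimes> (\<zeta> i \<otimes> (\<ominus> (inv (\<zeta> m)))))"
      using u zc iz by (intro finsum_cong') (auto simp: m_assoc)
    also have "\<dots> \<in> lin_span Z P e"
    proof (rule lin_span_finsum)
      fix i assume "i \<in> {..<m}"
      moreover have "\<zeta> i \<otimes> (\<ominus> (inv (\<zeta> m))) \<in> pow_span k x"
        using cent centralizer_mult[OF x z(1) iz(1)] by blast
      ultimately show "u i \<otimes> (\<zeta> i \<otimes> (\<ominus> (inv (\<zeta> m)))) \<in> lin_span Z P e" by (intro ue) auto
    qed (use e in auto)
    finally show ?thesis .
  qed
  then have "\<exists>n\<le>card P. dimension n Z (carrier R)" using P e by (intro dimension_of_lin_span[where e = e]) auto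
  moreover have "card P \<le> k\<^sup>2" using Qk[OF Qm] by (simp add: P_def power2_eq_square)
  ultimately show ?thesis using le_trans by blast
qed

end

section \<open>Infinite center\<close>

text \<open>The inner derivation of \<open>a\<close>. Its constants form
  \<open>centralizer a\<close>, over which it is right linear.\<close>

definition (in ring) ad :: "'a \<Rightarrow> 'a \<Rightarrow> 'a"
  where "ad a r = a \<otimes> r \<ominus> r \<otimes> a"

context skew_field
begin

lemma pow_dep_scale:
  assumes x: "x \<in> carrier R" and z: "z \<in> Z" "z \<noteq> \<zero>" and dep: "pow_dep n x"
  shows "pow_dep n (z \<otimes> x)"
proof -
  obtain \<alpha> where a: "\<And>i. \<alpha> i \<in> Z" "\<exists>i<n. \<alpha> i \<noteq> \<zero>" "pow_sum n \<alpha> x = \<zero>"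
    using dep unfolding lin_dep_def by blast
  have p: "(z \<otimes> x) [^] i = z [^] i \<otimes> x [^] i" for i :: nat
  proof (induction i)
    case (Suc i)
    have "(z \<otimes> x) [^] Suc i = z [^] i \<otimes> (x [^] i \<otimes> (z \<otimes> x))" using Suc x z by (simp add: m_assoc)
    also have "x [^] i \<otimes> (z \<otimes> x) = z \<otimes> (x [^] i \<otimes> x)" using x z by (intro Z_lcomm) auto
    finally show ?case using x z by (simp add: m_assoc)
  qed simp
  define \<beta> where "\<beta> i = \<alpha> i \<otimes> inv (z [^] i)" for i :: nat
  have "(\<Oplus>i\<in>{..<n}. \<beta> i \<otimes> (z \<otimes> x) [^] i) = pow_sum n \<alpha> x"
    using a(1) x z by (intro finsum_cong') (auto simp: \<beta>_def p m_assoc)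
  then show ?thesis unfolding lin_dep_def using a z by (intro exI[of _ \<beta>]) (auto simp: \<beta>_def)
qed

text \<open>The reversed polynomial vanishes at the inverse: multiply the relation by
  \<open>inv x [^] (n - 1)\<close>.\<close>

lemma pow_dep_inv:
  assumes x: "x \<in> carrier R" "x \<noteq> \<zero>" and dep: "pow_dep n x"
  shows "pow_dep n (inv x)"
proof -
  obtain \<alpha> where a: "\<And>i. \<alpha> i \<in> Z" "\<exists>i<n. \<alpha> i \<noteq> \<zero>" "pow_sum n \<alpha> x = \<zero>"
    using dep unfolding lin_dep_def by blast
  let ?\<phi> = "\<lambda>i. n - 1 - i"
  have p: "x [^] i \<otimes> inv x [^] (n - 1) = inv x [^] (?\<phi> i)" if i: "i < n" for i
  proof -
    have "x [^] i \<otimes> inv x [^] i = \<one>"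
    proof (induction i)
      case (Suc i)
      have "x [^] Suc i \<otimes> inv x [^] Suc i = x [^] i \<otimes> (x \<otimes> (inv x \<otimes> inv x [^] i))"
        using x nat_pow_Suc2[of "inv x" i] by (simp add: m_assoc del: nonzero_inv_cancel)
      also have "\<dots> = \<one>" using x Suc by simp
      finally show ?case .
    qed simp
    moreover have "inv x [^] (n - 1) = inv x [^] i \<otimes> inv x [^] (?\<phi> i)"
      using i x by (subst nat_pow_mult) auto
    ultimately show ?thesis using x by (simp add: m_assoc[symmetric])
  qed
  have "(\<Oplus>i\<in>{..<n}. \<alpha> (?\<phi> i) \<otimes> inv x [^] i) = (\<Oplus>i\<in>?\<phi> ` {..<n}. \<alpha> (?\<phi> i) \<otimes> inv x [^] i)"
  proof -
    have "{..<n} = ?\<phi> ` {..<n}"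
    proof (intro equalityI subsetI)
      fix i assume "i \<in> {..<n}"
      then show "i \<in> ?\<phi> ` {..<n}" by (intro image_eqI[of _ _ "?\<phi> i"]) auto
    qed auto
    then show ?thesis by (rule arg_cong)
  qed
  also have "\<dots> = (\<Oplus>i\<in>{..<n}. \<alpha> (?\<phi> (?\<phi> i)) \<otimes> inv x [^] (?\<phi> i))"
    using a x by (intro finsum_reindex) (auto simp: inj_on_def)
  also have "\<dots> = (\<Oplus>i\<in>{..<n}. \<alpha> i \<otimes> x [^] i \<otimes> inv x [^] (n - 1))"
  proof (rule finsum_cong')
    fix i assume "i \<in> {..<n}"
    then have i: "i < n" by simp
    show "\<alpha> (?\<phi> (?\<phi> i)) \<otimes> inv x [^] (?\<phi> i) = \<alpha> i \<otimes> x [^] i \<otimes> inv x [^] (n - 1)"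
      unfolding p[OF i, symmetric] using i a(1) x by (simp add: m_assoc)
  qed (use a(1) x in auto)
  also have "\<dots> = pow_sum n \<alpha> x \<otimes> inv x [^] (n - 1)"
    using a(1) x by (intro finsum_ldistr[symmetric]) auto
  finally have 0: "(\<Oplus>i\<in>{..<n}. \<alpha> (?\<phi> i) \<otimes> inv x [^] i) = \<zero>" using a(3) x by simp
  obtain j where j: "j < n" "\<alpha> j \<noteq> \<zero>" using a(2) by blast
  then have "\<exists>i\<in>{..<n}. \<alpha> (?\<phi> i) \<noteq> \<zero>" by (intro bexI[of _ "?\<phi> j"]) auto
  then show ?thesis unfolding lin_dep_def using a(1) 0 by (intro exI[of _ "\<lambda>i. \<alpha> (?\<phi> i)"]) simp
qed

lemma ad_closed [simp]: "a \<in> carrier R \<Longrightarrow> r \<in> carrier R \<Longrightarrow> ad a r \<in> carrier R"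
  by (simp add: ad_def)

lemma ad_eq_zero_iff:
  assumes "a \<in> carrier R" "r \<in> carrier R"
  shows "ad a r = \<zero> \<longleftrightarrow> r \<in> centralizer a"
proof
  assume "ad a r = \<zero>"
  then have "a \<otimes> r = r \<otimes> a" using assms by (simp add: ad_def)
  then show "r \<in> centralizer a" using assms by (intro centralizerI) auto
next
  assume "r \<in> centralizer a"
  then have "r \<otimes> a = a \<otimes> r" by (rule centralizer_commute)
  then show "ad a r = \<zero>" using assms by (simp add: ad_def a_minus_def r_neg)
qed

lemma ad_add:
  assumes "a \<in> carrier R" "r \<in> carrier R" "s \<in> carrier R"
  shows "ad a (r \<oplus> s) = ad a r \<oplus> ad a s"
  unfolding ad_def using assms by algebra

lemma ad_add_centralizer:
  assumes "a \<in> carrier R" "r \<in> carrier R" "c \<in> centralizer a"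
  shows "ad a (r \<oplus> c) = ad a r"
  using assms ad_add[of a r c] ad_eq_zero_iff[of a c] centralizer_carrier[OF assms(3)] by simp

lemma ad_mult_centralizer:
  assumes "a \<in> carrier R" "r \<in> carrier R" "c \<in> centralizer a"
  shows "ad a (r \<otimes> c) = ad a r \<otimes> c"
proof -
  have c: "c \<in> carrier R" using assms centralizer_carrier by blast
  have "r \<otimes> c \<otimes> a = r \<otimes> a \<otimes> c" using centralizer_commute[OF assms(3)] assms c by (simp add: m_assoc)
  then show ?thesis unfolding ad_def using assms c by (simp add: a_minus_def l_distr l_minus m_assoc)
qed

lemma ad_smult:
  assumes "a \<in> carrier R" "r \<in> carrier R" "z \<in> Z"
  shows "ad a (z \<otimes> r) = z \<otimes> ad a r"
  using ad_mult_centralizer[of a r z] assms Z_comm[of z r] Z_comm[of z "ad a r"] by simp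

lemma ad_nonzero:
  assumes "a \<in> carrier R" "a \<notin> Z"
  shows "\<exists>r\<in>carrier R. r \<notin> centralizer a"
proof (rule ccontr)
  assume "\<not> ?thesis"
  then have "r \<otimes> a = a \<otimes> r" if "r \<in> carrier R" for r using that centralizer_commute by blast
  then have "a \<in> Z" using assms by (intro Z_I) auto
  then show False using assms by simp
qed

text \<open>Closure under all translations by \<open>ad a r\<close> makes an element of largest
  degree in \<open>M\<close> satisfy the hypothesis of \<open>maximal_degree_centralizer\<close> on
  whole lines. The family is left open because \<open>ad a\<close> applied to all of
  \<open>R\<close> does not serve when its values commute with \<open>a\<close>.\<close>

lemma bounded_degree_family:
  assumes a: "a \<in> carrier R" and inf: "infinite Z"
    and M: "M \<subseteq> carrier R" "M \<noteq> {}" "\<And>x. x \<in> M \<Longrightarrow> pow_dep (Suc d) x"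
    and closed: "\<And>x r. x \<in> M \<Longrightarrow> r \<in> carrier R \<Longrightarrow> x \<oplus> ad a r \<in> M"
    and noncomm: "\<And>x. x \<in> M \<Longrightarrow> x \<in> centralizer a \<Longrightarrow> \<exists>r\<in>carrier R. ad a r \<notin> centralizer a"
  shows "\<exists>n\<le>d\<^sup>2. dimension n Z (carrier R)"
proof -
  let ?Q = "\<lambda>k. \<exists>x\<in>M. pow_dep (Suc k) x \<and> \<not> pow_dep k x"
  have deg: "\<exists>k. pow_dep (Suc k) x \<and> \<not> pow_dep k x" if "x \<in> M" for x
  proof -
    define l where "l = (LEAST l. pow_dep l x)"
    have l: "pow_dep l x" unfolding l_def by (rule LeastI[of "\<lambda>l. pow_dep l x", OF M(3)[OF that]])
    have nl: "\<not> pow_dep k x" if "k < l" for k using that not_less_Least unfolding l_def by blast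
    have "l \<noteq> 0" using l pow_dep_0[of x] by (intro notI) (simp only: )
    then obtain k where "l = Suc k" by (cases l) auto
    then show ?thesis using l nl by blast
  qed
  have Qd: "k \<le> d" if Q: "?Q k" for k
  proof (rule ccontr)
    assume "\<not> k \<le> d"
    moreover obtain x where "x \<in> M" "\<not> pow_dep k x" using Q by blast
    ultimately show False using pow_dep_mono[OF M(3), of x k] M(1) by auto
  qed
  obtain x' where "x' \<in> M" using M by blast
  then obtain k' where k': "?Q k'" using deg by blast
  define k where "k = Greatest ?Q"
  have Qk: "?Q k" unfolding k_def by (rule GreatestI_nat[of ?Q, OF k' Qd])
  have kmax: "l \<le> k" if "?Q l" for l unfolding k_def by (rule Greatest_le_nat[of ?Q, OF that Qd])
  have Mk: "pow_dep (Suc k) x" if x: "x \<in> M" for x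
  proof -
    obtain l where "pow_dep (Suc l) x" "\<not> pow_dep l x" using deg[OF x] by blast
    then show ?thesis using kmax[of l] x M(1) pow_dep_mono[of "Suc l" x "Suc k"] by auto
  qed
  have sc: "x \<oplus> z \<otimes> ad a r \<in> M" if "x \<in> M" "r \<in> carrier R" "z \<in> Z" for x r z
    using closed[of x "z \<otimes> r"] ad_smult[OF a that(2,3)] that by simp
  obtain x0 where x0: "x0 \<in> M" "\<not> pow_dep k x0" using Qk by blast
  have x0c: "x0 \<in> carrier R" using x0 M by blast
  have "\<exists>x\<in>M. \<not> pow_dep k x \<and> x \<notin> centralizer a"
  proof (cases "x0 \<in> centralizer a")
    case True
    then obtain r where r: "r \<in> carrier R" "ad a r \<notin> centralizer a" using noncomm x0 by blast
    \<comment> \<open>Every nonzero \<open>z\<close> moves \<open>x0\<close> out of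
      \<open>centralizer a\<close>. If the degree dropped for all of them,
      \<open>pow_dep_limit\<close> would make it drop at \<open>x0\<close> too.\<close>
    have "\<exists>z\<in>Z - {\<zero>}. \<not> pow_dep k (x0 \<oplus> z \<otimes> ad a r)"
    proof (rule ccontr)
      assume "\<not> ?thesis"
      then have "pow_dep k x0"
        using inf a r(1) x0c by (intro pow_dep_limit[of x0 "ad a r" "Z - {\<zero>}"]) auto
      then show False using x0 by simp
    qed
    then obtain z where z: "z \<in> Z" "z \<noteq> \<zero>" "\<not> pow_dep k (x0 \<oplus> z \<otimes> ad a r)" by blast
    have zc: "z \<in> carrier R" "ad a r \<in> carrier R" using z a r by auto
    have "x0 \<oplus> z \<otimes> ad a r \<notin> centralizer a"
    proof
      assume "x0 \<oplus> z \<otimes> ad a r \<in> centralizer a"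
      then have "inv z \<otimes> ((x0 \<oplus> z \<otimes> ad a r) \<ominus> x0) \<in> centralizer a" using True a z by simp
      moreover have "(x0 \<oplus> z \<otimes> ad a r) \<ominus> x0 = z \<otimes> ad a r" using x0c zc by algebra
      ultimately show False using r(2) z zc by simp
    qed
    then show ?thesis using sc[OF x0(1) r(1) z(1)] z(3) by blast
  qed (use x0 in blast)
  then obtain x where x: "x \<in> M" "\<not> pow_dep k x" "x \<notin> centralizer a" by blast
  have xc: "x \<in> carrier R" using x M by blast
  have "centralizer x \<subseteq> pow_span k x"
  proof (rule maximal_degree_centralizer[OF xc a _ Mk[OF x(1)] x(2) inf])
    show "a \<notin> centralizer x" using centralizer_sym[OF xc, of a] x(3) by blast
    show "pow_dep (Suc k) (x \<oplus> z \<otimes> (a \<otimes> r \<ominus> r \<otimes> a))" if "r \<in> carrier R" "z \<in> Z" for r z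
      using Mk[OF sc[OF x(1) that]] by (simp add: ad_def)
  qed
  then have "\<exists>n\<le>k\<^sup>2. dimension n Z (carrier R)" by (rule dimension_le_square[OF xc Mk[OF x(1)] x(2)])
  moreover have "k\<^sup>2 \<le> d\<^sup>2" using Qd[OF Qk] by (simp add: power_mono)
  ultimately show ?thesis using le_trans by blast
qed

theorem infinite_center_bound:
  assumes a: "a \<in> carrier R" "a \<notin> Z" and inf: "infinite Z" and d: "0 < d"
    and dep: "\<And>b. b \<in> carrier R \<Longrightarrow> b \<notin> centralizer a \<Longrightarrow> pow_dep (Suc d) (b \<otimes> (a \<otimes> inv (ad a b)))"
  shows "\<exists>n\<le>d\<^sup>2. dimension n Z (carrier R)"
proof -
  have a0: "a \<noteq> \<zero>" using a by auto
  have ad_dep: "pow_dep (Suc d) (ad a r)" if r: "r \<in> carrier R" for r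
  proof (cases "ad a r = \<zero>")
    case True
    \<comment> \<open>Zero has degree one, with the relation X; this fits into the bound because
      \<open>0 < d\<close>.\<close>
    have "pow_dep 2 \<zero>" unfolding lin_dep_def
      by (rule exI[of _ "\<lambda>i. if i = 0 then \<zero> else \<one>"]) (auto simp: numeral_2_eq_2 lessThan_Suc finsum_insert)
    then show ?thesis using True d pow_dep_mono[of 2 "\<zero>" "Suc d"] by simp
  next
    case False
    \<comment> \<open>With this choice \<open>ad a s = ad a r \<otimes> a\<close>, and the factor
      \<open>a\<close> cancels the one in \<open>f\<close>: the inverse of \<open>f\<close> becomes
      exactly \<open>ad a r\<close>.\<close>
    define s where "s = r \<otimes> a"
    have s: "s \<in> carrier R" using r a by (simp add: s_def)
    have ads: "ad a s = ad a r \<otimes> a" unfolding s_def using a r by (intro ad_mult_centralizer) auto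
    have s0: "ad a s \<noteq> \<zero>" "ad a s \<in> carrier R" using ads False a0 a r by auto
    define f where "f = a \<otimes> inv (ad a s)"
    have f: "f \<in> carrier R" "f \<noteq> \<zero>" using a a0 s0 by (auto simp: f_def)
    have "pow_dep (Suc d) (f \<oplus> z \<otimes> (s \<otimes> f))" if z: "z \<in> Z - {\<zero>}" for z
    proof -
      have z: "z \<in> Z" "z \<noteq> \<zero>" "z \<in> carrier R" "inv z \<in> Z" "inv z \<in> carrier R" using z by auto
      \<comment> \<open>Scaling by \<open>z\<close> turns
        \<open>(s \<oplus> inv z) \<otimes> f\<close> into
        \<open>f \<oplus> z \<otimes> (s \<otimes> f)\<close>. The direction of the original line is
        now its value at z = 0, where \<open>pow_dep_limit\<close> applies.\<close>
      let ?b = "s \<oplus> inv z"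
      have ab: "ad a ?b = ad a s" using a s z by (intro ad_add_centralizer) auto
      then have "?b \<notin> centralizer a" using ad_eq_zero_iff[of a ?b] s0 a s z by auto
      then have "pow_dep (Suc d) (?b \<otimes> (a \<otimes> inv (ad a ?b)))" using s z by (intro dep) auto
      then have "pow_dep (Suc d) (?b \<otimes> f)" by (simp only: ab f_def)
      then have "pow_dep (Suc d) (z \<otimes> (?b \<otimes> f))"
        by (rule pow_dep_scale[rotated 3]) (use s f z in auto)
      moreover have "z \<otimes> (?b \<otimes> f) = f \<oplus> z \<otimes> (s \<otimes> f)"
        using z s f by (simp add: l_distr r_distr a_comm)
      ultimately show ?thesis by simp
    qed
    then have "pow_dep (Suc d) f"
      using inf f s by (intro pow_dep_limit[of f "s \<otimes> f" "Z - {\<zero>}"]) auto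
    then have "pow_dep (Suc d) (inv f)" using f by (intro pow_dep_inv) auto
    moreover have "inv f = ad a r"
    proof -
      have "ad a r \<otimes> f = ad a s \<otimes> inv (ad a s)"
        unfolding f_def ads using a r s0 by (simp add: m_assoc[symmetric] ads)
      then have "ad a r \<otimes> f = \<one>" using s0 by simp
      then have "ad a r \<otimes> f \<otimes> inv f = inv f" using f by simp
      then show ?thesis using f a r by simp
    qed
    ultimately show ?thesis by simp
  qed
  show ?thesis
  proof (cases "\<exists>r\<in>carrier R. ad a r \<notin> centralizer a")
    case True
    show ?thesis
    proof (rule bounded_degree_family[OF a(1) inf, of "ad a ` carrier R"])
      show "x \<oplus> ad a r \<in> ad a ` carrier R" if "x \<in> ad a ` carrier R" "r \<in> carrier R" for x r
        using that ad_add[OF a(1), symmetric] by auto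
    qed (use True a ad_dep in auto)
  next
    case False
    \<comment> \<open>Now \<open>ad a\<close> composed with itself is zero. For noncentral
      \<open>a\<close> this happens only in characteristic 2, since the Leibniz rule gives twice the
      product of \<open>ad a r\<close> and \<open>ad a s\<close> as zero.\<close>
    then have adC: "ad a r \<in> centralizer a" if "r \<in> carrier R" for r using that by blast
    obtain w where w: "w \<in> carrier R" "w \<notin> centralizer a" using ad_nonzero[OF a] by blast
    have w0: "ad a w \<noteq> \<zero>" using ad_eq_zero_iff[OF a(1) w(1)] w by simp
    define f where "f = a \<otimes> inv (ad a w)"
    have f: "f \<in> carrier R" "f \<noteq> \<zero>" using a a0 w w0 by (auto simp: f_def)
    have fC: "f \<in> centralizer a" "inv f \<in> centralizer a"
      using adC[OF w(1)] centralizer_inv[OF a(1)] f w0 a by (auto simp: f_def)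
    \<comment> \<open>The full line of inverses supplied by the commutators is used itself, with
      \<open>c\<close> running through \<open>centralizer a\<close>. A translation by
      \<open>ad a r\<close> only changes \<open>c\<close> by \<open>ad a r \<otimes> inv f\<close>,
      which commutes with \<open>a\<close> in this case.\<close>
    let ?M = "{(w \<oplus> c) \<otimes> f | c. c \<in> centralizer a}"
    show ?thesis
    proof (rule bounded_degree_family[OF a(1) inf, of ?M])
      show "?M \<subseteq> carrier R" using w f by (auto dest: centralizer_carrier)
      show "?M \<noteq> {}" using centralizer_closed(1)[OF a(1)] by blast
      show "pow_dep (Suc d) x" if x: "x \<in> ?M" for x
      proof -
        obtain c where c: "c \<in> centralizer a" "x = (w \<oplus> c) \<otimes> f" using x by blast
        have cc: "c \<in> carrier R" using centralizer_carrier[OF c(1)] .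
        have ab: "ad a (w \<oplus> c) = ad a w" using a w c by (intro ad_add_centralizer) auto
        then have "w \<oplus> c \<notin> centralizer a" using ad_eq_zero_iff[of a "w \<oplus> c"] w0 a w cc by auto
        then have "pow_dep (Suc d) ((w \<oplus> c) \<otimes> (a \<otimes> inv (ad a (w \<oplus> c))))" using w cc by (intro dep) auto
        then show ?thesis by (simp only: ab f_def c(2))
      qed
      show "x \<oplus> ad a r \<in> ?M" if x: "x \<in> ?M" and r: "r \<in> carrier R" for x r
      proof -
        obtain c where c: "c \<in> centralizer a" "x = (w \<oplus> c) \<otimes> f" using x by blast
        have cc: "c \<in> carrier R" using centralizer_carrier[OF c(1)] .
        have "x \<oplus> ad a r = (w \<oplus> (c \<oplus> ad a r \<otimes> inv f)) \<otimes> f"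
          unfolding c(2) using w cc f a r by (simp add: l_distr m_assoc a_assoc)
        moreover have "c \<oplus> ad a r \<otimes> inv f \<in> centralizer a" using c adC[OF r] fC a by simp
        ultimately show ?thesis by blast
      qed
      \<comment> \<open>No member of the family commutes with \<open>a\<close>: otherwise
        \<open>w\<close> would, because \<open>f\<close> and \<open>c\<close> do.\<close>
      show "\<exists>r\<in>carrier R. ad a r \<notin> centralizer a" if x: "x \<in> ?M" "x \<in> centralizer a" for x
      proof -
        obtain c where c: "c \<in> centralizer a" "x = (w \<oplus> c) \<otimes> f" using x by blast
        have cc: "c \<in> carrier R" using centralizer_carrier[OF c(1)] .
        have "x \<otimes> inv f \<ominus> c \<in> centralizer a" using c x fC a by simp
        moreover have "x \<otimes> inv f = w \<oplus> c" unfolding c(2) using w cc f by simp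
        moreover have "(w \<oplus> c) \<ominus> c = w" using w cc by algebra
        ultimately show ?thesis using w by simp
      qed
    qed
  qed
qed

section \<open>Torsion over a finite center\<close>


text \<open>Subtracting \<open>\<chi> q\<close> times the relation for \<open>m\<close> from the one
  for \<open>Suc m\<close> removes the node \<open>q\<close>. Only the nodes have to commute with
  one another; the \<open>y i\<close> are arbitrary. The lemma serves for counting zeros of
  polynomials, for power sums of roots of unity and as independence of characters.\<close>

lemma vandermonde:
  assumes "finite I" "\<And>i. i \<in> I \<Longrightarrow> \<chi> i \<in> carrier R" "\<And>i. i \<in> I \<Longrightarrow> y i \<in> carrier R" "inj_on \<chi> I"
    "\<And>i j. i \<in> I \<Longrightarrow> j \<in> I \<Longrightarrow> \<chi> i \<otimes> \<chi> j = \<chi> j \<otimes> \<chi> i"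
    "\<And>m::nat. (\<Oplus>i\<in>I. \<chi> i [^] m \<otimes> y i) = \<zero>"
  shows "\<forall>i\<in>I. y i = \<zero>"
  using assms
proof (induction I arbitrary: y rule: finite_induct)
  case (insert q I)
  note \<chi> = insert.prems(1) and y = insert.prems(2) and comm = insert.prems(4)
  have q: "\<chi> q \<in> carrier R" using \<chi> by simp
  define y' where "y' i = (\<chi> i \<ominus> \<chi> q) \<otimes> y i" for i
  have y': "y' i \<in> carrier R" if "i \<in> insert q I" for i using \<chi>[OF that] y[OF that] q by (simp add: y'_def)
  have rel: "(\<Oplus>i\<in>I. \<chi> i [^] m \<otimes> y' i) = \<zero>" for m :: nat
  proof -
    have "(\<Oplus>i\<in>insert q I. \<chi> i [^] m \<otimes> y' i)
        = (\<Oplus>i\<in>insert q I. \<chi> i [^] Suc m \<otimes> y i \<ominus> \<chi> q \<otimes> (\<chi> i [^] m \<otimes> y i))"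
    proof (rule finsum_cong')
      fix i assume i: "i \<in> insert q I"
      note c = \<chi>[OF i] y[OF i] q
      have "\<chi> i [^] m \<otimes> \<chi> q = \<chi> q \<otimes> \<chi> i [^] m"
        using pow_commute[OF c(1,3) comm[OF insertI1 i]] by simp
      then show "\<chi> i [^] m \<otimes> y' i = \<chi> i [^] Suc m \<otimes> y i \<ominus> \<chi> q \<otimes> (\<chi> i [^] m \<otimes> y i)"
        unfolding y'_def a_minus_def using c by (simp add: l_distr r_distr l_minus r_minus m_assoc[symmetric])
    qed (use \<chi> y q in auto)
    also have "\<dots> = (\<Oplus>i\<in>insert q I. \<chi> i [^] Suc m \<otimes> y i) \<ominus> (\<Oplus>i\<in>insert q I. \<chi> q \<otimes> (\<chi> i [^] m \<otimes> y i))"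
      using \<chi> y q by (intro finsum_minus) auto
    also have "(\<Oplus>i\<in>insert q I. \<chi> q \<otimes> (\<chi> i [^] m \<otimes> y i)) = \<chi> q \<otimes> (\<Oplus>i\<in>insert q I. \<chi> i [^] m \<otimes> y i)"
      using \<chi> y q insert.hyps by (intro finsum_rdistr[symmetric]) auto
    also have "(\<Oplus>i\<in>insert q I. \<chi> i [^] Suc m \<otimes> y i) \<ominus> \<chi> q \<otimes> (\<Oplus>i\<in>insert q I. \<chi> i [^] m \<otimes> y i) = \<zero>"
      using insert.prems(5)[of "Suc m"] insert.prems(5)[of m] q by (simp add: a_minus_def del: nat_pow_Suc)
    finally have "(\<Oplus>i\<in>insert q I. \<chi> i [^] m \<otimes> y' i) = \<zero>" .
    moreover have "(\<Oplus>i\<in>insert q I. \<chi> i [^] m \<otimes> y' i) = \<chi> q [^] m \<otimes> y' q \<oplus> (\<Oplus>i\<in>I. \<chi> i [^] m \<otimes> y' i)"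
      using insert.hyps \<chi> y' by (intro finsum_insert) auto
    moreover have "y' q = \<zero>" using q y[of q] by (simp add: y'_def a_minus_def r_neg)
    moreover have "(\<Oplus>i\<in>I. \<chi> i [^] m \<otimes> y' i) \<in> carrier R" using \<chi> y' by (intro finsum_closed) auto
    ultimately show ?thesis using q by simp
  qed
  have "\<forall>i\<in>I. y' i = \<zero>"
    by (rule insert.IH) (use \<chi> y' insert.prems(3) comm rel in \<open>auto simp: inj_on_def\<close>)
  moreover have "\<chi> i \<ominus> \<chi> q \<noteq> \<zero>" if "i \<in> I" for i
    using insert.prems(3) insert.hyps(2) that \<chi> by (auto simp: inj_on_def r_right_minus_eq)
  ultimately have yI: "y i = \<zero>" if "i \<in> I" for i
  proof -
    have c: "\<chi> i \<ominus> \<chi> q \<in> carrier R" "y i \<in> carrier R" using that \<chi> y q by auto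
    have "(\<chi> i \<ominus> \<chi> q) \<otimes> y i = \<zero>" using \<open>\<forall>i\<in>I. y' i = \<zero>\<close> that by (simp add: y'_def)
    then show ?thesis using integral_iff[OF c] \<open>i \<in> I \<Longrightarrow> \<chi> i \<ominus> \<chi> q \<noteq> \<zero>\<close> that by blast
  qed
  have "\<zero> = (\<Oplus>i\<in>insert q I. \<chi> i [^] (0::nat) \<otimes> y i)" using insert.prems(5)[of 0] by simp
  also have "\<dots> = y q \<oplus> (\<Oplus>i\<in>I. \<chi> i [^] (0::nat) \<otimes> y i)"
    using insert.hyps \<chi> y by (subst finsum_insert) auto
  also have "(\<Oplus>i\<in>I. \<chi> i [^] (0::nat) \<otimes> y i) = \<zero>" using yI by (intro add.finprod_one_eqI) auto
  finally show ?case using yI y[of q] by simp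
qed simp

section \<open>Geometric sums and elements of bounded order\<close>

lemma geometric_sum:
  assumes "x \<in> carrier R"
  shows "(\<Oplus>i\<in>{..<n}. x [^] i) \<otimes> (x \<ominus> \<one>) = x [^] (n::nat) \<ominus> \<one>"
proof (induction n)
  case (Suc n)
  have s: "(\<Oplus>i\<in>{..<n}. x [^] i) \<in> carrier R" using assms by (intro finsum_closed) auto
  have "(\<Oplus>i\<in>{..<Suc n}. x [^] i) = x [^] n \<oplus> (\<Oplus>i\<in>{..<n}. x [^] i)"
    unfolding lessThan_Suc using assms by (intro finsum_insert) auto
  then have "(\<Oplus>i\<in>{..<Suc n}. x [^] i) \<otimes> (x \<ominus> \<one>) = x [^] n \<otimes> (x \<ominus> \<one>) \<oplus> (x [^] n \<ominus> \<one>)"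
    using s assms Suc by (simp add: l_distr)
  also have "\<dots> = x [^] n \<otimes> x \<ominus> \<one>"
  proof -
    have c: "x [^] n \<in> carrier R" using assms by simp
    have "x [^] n \<otimes> (x \<ominus> \<one>) = x [^] n \<otimes> x \<ominus> x [^] n"
      using assms c by (simp add: a_minus_def r_distr r_minus)
    then show ?thesis using assms c by algebra
  qed
  finally show ?case by simp
qed (use assms in \<open>simp add: a_minus_def r_neg\<close>)

lemma geometric_sum_root_of_unity:
  assumes "x \<in> carrier R" "x \<noteq> \<one>" "x [^] (n::nat) = \<one>"
  shows "(\<Oplus>i\<in>{..<n}. x [^] i) = \<zero>"
proof -
  have "(\<Oplus>i\<in>{..<n}. x [^] i) \<otimes> (x \<ominus> \<one>) = \<zero>"
    using geometric_sum[OF assms(1), of n] assms(3) by (simp add: a_minus_def r_neg)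
  moreover have "x \<ominus> \<one> \<noteq> \<zero>" using assms by (simp add: r_right_minus_eq)
  moreover have "(\<Oplus>i\<in>{..<n}. x [^] i) \<in> carrier R" using assms(1) by (intro finsum_closed) auto
  ultimately show ?thesis using assms by simp
qed

lemma finsum_cyclic_shift:
  assumes "\<And>i. g i \<in> carrier R" "g n = g 0"
  shows "(\<Oplus>i\<in>{..<n}. g (Suc i)) = (\<Oplus>i\<in>{..<n}. g i)"
proof -
  have s: "(\<Oplus>i\<in>{..<m}. g i) \<in> carrier R" "(\<Oplus>i\<in>{..<m}. g (Suc i)) \<in> carrier R" for m
    using assms by (auto intro!: finsum_closed)
  have *: "g 0 \<oplus> (\<Oplus>i\<in>{..<m}. g (Suc i)) = (\<Oplus>i\<in>{..<m}. g i) \<oplus> g m" for m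
  proof (induction m)
    case (Suc m)
    have "(\<Oplus>i\<in>{..<Suc m}. g (Suc i)) = g (Suc m) \<oplus> (\<Oplus>i\<in>{..<m}. g (Suc i))"
      "(\<Oplus>i\<in>{..<Suc m}. g i) = g m \<oplus> (\<Oplus>i\<in>{..<m}. g i)"
      unfolding lessThan_Suc using assms by (auto intro!: finsum_insert)
    then have "g 0 \<oplus> (\<Oplus>i\<in>{..<Suc m}. g (Suc i)) = g (Suc m) \<oplus> (g 0 \<oplus> (\<Oplus>i\<in>{..<m}. g (Suc i)))"
      using s assms(1) by (simp add: a_lcomm)
    also have "\<dots> = (\<Oplus>i\<in>{..<Suc m}. g i) \<oplus> g (Suc m)"
      unfolding Suc using s assms(1) \<open>(\<Oplus>i\<in>{..<Suc m}. g i) = _\<close> by (simp add: a_ac)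
    finally show ?case .
  qed (use assms in simp)
  show ?thesis using *[of n] s assms by (metis a_comm add.l_cancel)
qed

lemma not_pow_dep_1: "x \<in> carrier R \<Longrightarrow> \<not> pow_dep (Suc 0) x"
  by (auto simp: lin_dep_def lessThan_Suc finsum_insert)

lemma power_in_pow_span:
  assumes x: "x \<in> carrier R" and k: "pow_dep (Suc k) x" "\<not> pow_dep k x"
  shows "x [^] (i::nat) \<in> pow_span k x"
proof -
  have "k \<noteq> 0" using k(1) not_pow_dep_1[OF x] by (cases k) auto
  then have 1: "\<one> \<in> pow_span k x"
    using lin_span_base[of "{..<k}" "\<lambda>i. x [^] i" 0] x by simp
  have xs: "x \<in> pow_span k x"
  proof (cases "k = 1")
    case True
    then show ?thesis using pow_span_pow[OF x k] x by simp
  next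
    case False
    then show ?thesis using lin_span_base[of "{..<k}" "\<lambda>i. x [^] i" 1] x \<open>k \<noteq> 0\<close> by simp
  qed
  show ?thesis
  proof (induction i)
    case (Suc i)
    then show ?case using pow_span_mult[OF x k Suc xs] by simp
  qed (use 1 in simp)
qed

lemma lin_span_finite:
  assumes "finite Z" "finite I" "\<And>i. i \<in> I \<Longrightarrow> v i \<in> carrier R"
  shows "finite (lin_span Z I v) \<and> card (lin_span Z I v) \<le> card Z ^ card I"
proof -
  let ?S = "PiE I (\<lambda>_. Z)"
  let ?h = "\<lambda>\<alpha>. \<Oplus>i\<in>I. \<alpha> i \<otimes> v i"
  have S: "finite ?S" using assms by (intro finite_PiE) auto
  have sub: "lin_span Z I v \<subseteq> ?h ` ?S"
  proof
    fix p assume "p \<in> lin_span Z I v"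
    then obtain \<alpha> where a: "\<And>i. \<alpha> i \<in> Z" "p = ?h \<alpha>" by (auto simp: lin_span_def)
    have "?h (restrict \<alpha> I) = ?h \<alpha>" using a assms by (intro finsum_cong') auto
    then show "p \<in> ?h ` ?S" using a by (intro image_eqI[of _ _ "restrict \<alpha> I"]) auto
  qed
  have "card (lin_span Z I v) \<le> card (?h ` ?S)" using sub S by (intro card_mono) auto
  also have "\<dots> \<le> card ?S" using S by (rule card_image_le)
  also have "\<dots> = card Z ^ card I" using assms by (simp add: card_PiE)
  finally show ?thesis using finite_subset[OF sub] S by simp
qed

lemma pow_eq_cancel:
  assumes "t \<in> carrier R" "t \<noteq> \<zero>" "t [^] (i::nat) = t [^] (j::nat)" "i \<le> j"
  shows "t [^] (j - i) = \<one>"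
proof -
  have "t [^] i \<otimes> t [^] (j - i) = t [^] j" using assms(1,4) by (simp add: nat_pow_mult)
  then have "t [^] i \<otimes> t [^] (j - i) = t [^] i \<otimes> \<one>" using assms(1,3) by simp
  then show ?thesis using mult_left_cancel[of "t [^] i" "t [^] (j - i)" \<one>] assms(1,2) by simp
qed

text \<open>All powers of \<open>x\<close> lie in F(x), which has at most \<open>card Z ^ d\<close>
  elements, so two of the first \<open>card Z ^ d + 1\<close> powers agree. The factorial is a
  common multiple of all the orders that can arise.\<close>

lemma bounded_degree_exponent:
  assumes fin: "finite Z"
  shows "\<exists>M>0. \<forall>x\<in>carrier R. x \<noteq> \<zero> \<longrightarrow> pow_dep (Suc d) x \<longrightarrow> x [^] (M::nat) = \<one>"
proof (intro exI conjI ballI impI)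
  let ?B = "card Z ^ d"
  show "(0::nat) < fact ?B" by simp
  fix x assume x: "x \<in> carrier R" "x \<noteq> \<zero>" and dep: "pow_dep (Suc d) x"
  define l where "l = (LEAST l. pow_dep l x)"
  have l: "pow_dep l x" unfolding l_def by (rule LeastI[of "\<lambda>l. pow_dep l x", OF dep])
  have nl: "\<not> pow_dep k x" if "k < l" for k using that not_less_Least unfolding l_def by blast
  have ld: "l \<le> Suc d" unfolding l_def by (rule Least_le[of "\<lambda>l. pow_dep l x", OF dep])
  have "l \<noteq> 0" using l pow_dep_0[of x] by (intro notI) (simp only: )
  then obtain k where lk: "l = Suc k" by (cases l) auto
  have k: "pow_dep (Suc k) x" "\<not> pow_dep k x" using l nl lk by auto
  have "Z \<noteq> {}" using Z_closed(1) by blast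
  then have Zpos: "card Z \<noteq> 0" using fin by simp
  have S: "finite (pow_span k x)" "card (pow_span k x) \<le> card Z ^ k"
    using lin_span_finite[OF fin, of "{..<k}" "\<lambda>i. x [^] i"] x by auto
  have "card Z ^ k \<le> ?B" using lk ld Zpos by (intro power_increasing) auto
  then have S2: "card (pow_span k x) \<le> ?B" using S(2) by linarith
  have "\<not> inj_on (\<lambda>i. x [^] i) {..?B}"
  proof
    assume "inj_on (\<lambda>i. x [^] i) {..?B}"
    then have "card {..?B} \<le> card (pow_span k x)"
      using S(1) power_in_pow_span[OF x(1) k] by (intro card_inj_on_le[of "\<lambda>i. x [^] i"]) auto
    then show False using S2 by simp
  qed
  then obtain i j where "i \<le> ?B" "j \<le> ?B" "i \<noteq> j" "x [^] i = x [^] j" by (auto simp: inj_on_def)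
  then obtain i j where ij: "i < j" "j \<le> ?B" "x [^] i = x [^] j" by (metis linorder_neqE_nat)
  have "x [^] (j - i) = \<one>" using pow_eq_cancel[OF x ij(3)] ij by simp
  moreover have "j - i dvd fact ?B" using ij by (intro dvd_fact) auto
  ultimately show "x [^] (fact ?B :: nat) = \<one>" using x by (auto simp: nat_pow_pow[symmetric] elim!: dvdE)
qed

text \<open>If all \<open>t\<^sup>i\<close> are distinct, the polynomial \<open>((w + c)
  f)\<^sup>M - 1\<close> in \<open>c\<close> has too many zeros \<open>c =
  t\<^sup>i\<close>.\<close>

lemma common_centralizer_torsion:
  assumes M: "0 < (M::nat)" and a: "a \<in> carrier R" "a \<noteq> \<zero>" and w: "w \<in> carrier R" "w \<notin> centralizer a"
    and H: "\<And>b. b \<in> carrier R \<Longrightarrow> b \<notin> centralizer a \<Longrightarrow> (b \<otimes> (a \<otimes> inv (ad a b))) [^] M = \<one>"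
    and t: "t \<in> centralizer a" "t \<in> centralizer w" "t \<noteq> \<zero>"
  shows "\<exists>i>0. t [^] (i::nat) = \<one>"
proof (rule ccontr)
  assume nt: "\<not> ?thesis"
  have tc: "t \<in> carrier R" using t centralizer_carrier by blast
  have inj: "inj_on (\<lambda>i. t [^] i) (UNIV :: nat set)"
  proof (rule inj_onI)
    fix i j :: nat assume e: "t [^] i = t [^] j"
    show "i = j"
    proof (rule ccontr)
      assume "i \<noteq> j"
      then consider "i < j" | "j < i" by linarith
      then show False
      proof cases
        case 1
        then have "0 < j - i" "t [^] (j - i) = \<one>" using pow_eq_cancel[OF tc t(3) e] by auto
        then show False using nt by blast
      next
        case 2
        then have "0 < i - j" "t [^] (i - j) = \<one>" using pow_eq_cancel[OF tc t(3) e[symmetric]] by auto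
        then show False using nt by blast
      qed
    qed
  qed
  have w0: "ad a w \<noteq> \<zero>" using ad_eq_zero_iff[OF a(1) w(1)] w by simp
  define f where "f = a \<otimes> inv (ad a w)"
  have f: "f \<in> carrier R" "f \<noteq> \<zero>" using a w w0 by (auto simp: f_def)
  have at: "a \<in> centralizer t" "w \<in> centralizer t" using centralizer_sym a w t by auto
  have ft: "f \<in> centralizer t"
  proof -
    have "ad a w \<in> centralizer t" unfolding ad_def using at tc by simp
    then show ?thesis unfolding f_def using at tc w0 centralizer_inv[OF tc] by simp
  qed
  obtain g where g: "M = Suc g" using M by (cases M) auto
  let ?x = "w \<otimes> f"
  \<comment> \<open>The coefficient at the \<open>j\<close>-th power of \<open>c\<close> in
    \<open>((w \<oplus> c) \<otimes> f) [^] M \<ominus> \<one>\<close>, valid for \<open>c\<close>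
    commuting with \<open>w \<otimes> f\<close> and \<open>f\<close>.\<close>
  let ?B = "\<lambda>j. pow_coeff ?x f M j \<ominus> (if j = 0 then \<one> else \<zero>)"
  have B: "?B j \<in> carrier R" for j using w f by simp
  have rel: "(\<Oplus>j\<in>{..M}. (t [^] j) [^] i \<otimes> ?B j) = \<zero>" for i :: nat
  proof -
    define c where "c = t [^] i"
    have c: "c \<in> carrier R" "c \<in> centralizer a" using t a tc by (auto simp: c_def)
    have ct: "u \<otimes> c = c \<otimes> u" if "u \<in> centralizer t" for u
      unfolding c_def using that centralizer_carrier[OF that] tc centralizer_commute[OF that] by (intro pow_commute) auto
    have xt: "?x \<in> centralizer t" using at ft tc by simp
    have "ad a (w \<oplus> c) = ad a w" using a w c by (intro ad_add_centralizer) auto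
    moreover from this have "w \<oplus> c \<notin> centralizer a" using ad_eq_zero_iff[of a "w \<oplus> c"] w0 a w c by auto
    ultimately have "((w \<oplus> c) \<otimes> f) [^] M = \<one>" using H[of "w \<oplus> c"] w c by (simp add: f_def)
    moreover have "(w \<oplus> c) \<otimes> f = ?x \<oplus> c \<otimes> f" using w c f by (simp add: l_distr)
    moreover have "(?x \<oplus> c \<otimes> f) [^] M = (\<Oplus>j\<in>{..M}. c [^] j \<otimes> pow_coeff ?x f M j)"
      unfolding g using w f c ct[OF xt] ct[OF ft] by (intro pow_add_expand) auto
    ultimately have 1: "(\<Oplus>j\<in>{..M}. c [^] j \<otimes> pow_coeff ?x f M j) = \<one>" by simp
    have "(\<Oplus>j\<in>{..M}. (t [^] j) [^] i \<otimes> ?B j)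
        = (\<Oplus>j\<in>{..M}. c [^] j \<otimes> pow_coeff ?x f M j \<ominus> (if 0 = j then \<one> else \<zero>))"
    proof (rule finsum_cong')
      fix j :: nat
      have "(t [^] j) [^] i = c [^] j" unfolding c_def using tc by (simp add: nat_pow_pow mult.commute)
      then show "(t [^] j) [^] i \<otimes> ?B j = c [^] j \<otimes> pow_coeff ?x f M j \<ominus> (if 0 = j then \<one> else \<zero>)"
        using c w f by (cases j) (auto simp: a_minus_def r_distr)
    qed (use c w f in auto)
    also have "\<dots> = (\<Oplus>j\<in>{..M}. c [^] j \<otimes> pow_coeff ?x f M j) \<ominus> (\<Oplus>j\<in>{..M}. if 0 = j then \<one> else \<zero>)"
      using c w f by (intro finsum_minus) auto
    also have "(\<Oplus>j\<in>{..M}. if 0 = j then \<one> else \<zero>) = \<one>"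
      by (rule finsum_singleton) auto
    finally show ?thesis using 1 by (simp add: a_minus_def r_neg)
  qed
  \<comment> \<open>Zeros and exponents exchange roles: the \<open>j\<close>-th power of the zero
    \<open>t [^] i\<close> is the \<open>i\<close>-th power of \<open>t [^] j\<close>, so the nodes
    are the \<open>M + 1\<close> distinct elements \<open>t [^] j\<close>.\<close>
  have "\<forall>j\<in>{..M}. ?B j = \<zero>"
  proof (rule vandermonde[where \<chi> = "\<lambda>j. t [^] j"])
    show "inj_on (\<lambda>j. t [^] j) {..M}" using inj by (rule inj_on_subset) simp
    show "t [^] i \<otimes> t [^] j = t [^] j \<otimes> t [^] i" for i j :: nat using tc by (simp add: nat_pow_mult add.commute)
  qed (use tc B rel in auto)
  \<comment> \<open>The top coefficient is \<open>f [^] M\<close>; since \<open>0 < M\<close>, the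
    subtracted \<open>\<one>\<close> does not reach it.\<close>
  then have "?B M = \<zero>" by blast
  then have "f [^] M = \<zero>" using M w f by (simp add: pow_coeff_top a_minus_def)
  then show False using f by simp
qed

lemma conj_pow:
  assumes "b \<in> carrier R" "b \<noteq> \<zero>" "c \<in> carrier R"
  shows "(b \<otimes> c \<otimes> inv b) [^] (n::nat) = b \<otimes> c [^] n \<otimes> inv b"
proof (induction n)
  case (Suc n)
  have "(b \<otimes> c \<otimes> inv b) [^] Suc n = b \<otimes> c [^] n \<otimes> inv b \<otimes> (b \<otimes> c \<otimes> inv b)" using Suc by simp
  also have "\<dots> = b \<otimes> c [^] n \<otimes> (inv b \<otimes> (b \<otimes> (c \<otimes> inv b)))" using assms by (simp add: m_assoc del: nonzero_inv_cancel)
  also have "\<dots> = b \<otimes> c [^] Suc n \<otimes> inv b" using assms by (simp add: m_assoc)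
  finally show ?case .
qed (use assms in simp)

text \<open>Write \<open>a = x \<otimes> v\<close> with \<open>x\<close> the commutator and
  \<open>v\<close> the conjugate of \<open>a\<close> by \<open>b\<close>. As \<open>x\<close>
  commutes with \<open>a\<close>, it commutes with \<open>v\<close>, so the \<open>L\<close>-th
  power of \<open>a\<close> equals that of \<open>v\<close>. Thus \<open>a [^] L\<close> commutes
  with both \<open>a\<close> and \<open>b\<close>, and \<open>common_centralizer_torsion\<close>
  applies to it.\<close>

lemma commuting_commutator_torsion:
  assumes M: "0 < (M::nat)" and a: "a \<in> carrier R" "a \<noteq> \<zero>" and b: "b \<in> carrier R" "b \<notin> centralizer a"
    and H: "\<And>b. b \<in> carrier R \<Longrightarrow> b \<notin> centralizer a \<Longrightarrow> (b \<otimes> (a \<otimes> inv (ad a b))) [^] M = \<one>"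
    and L: "0 < (L::nat)" "(a \<otimes> b \<otimes> inv a \<otimes> inv b) [^] L = \<one>"
    and comm: "a \<otimes> b \<otimes> inv a \<otimes> inv b \<in> centralizer a"
  shows "\<exists>i>0. a [^] (i::nat) = \<one>"
proof -
  have b0: "b \<noteq> \<zero>" using b a by auto
  define x where "x = a \<otimes> b \<otimes> inv a \<otimes> inv b"
  define v where "v = b \<otimes> a \<otimes> inv b"
  have c: "x \<in> carrier R" "v \<in> carrier R" "v \<noteq> \<zero>" using a b b0 by (auto simp: x_def v_def)
  have axv: "x \<otimes> v = a"
  proof -
    have "x \<otimes> v = a \<otimes> b \<otimes> inv a \<otimes> (inv b \<otimes> (b \<otimes> (a \<otimes> inv b)))"
      unfolding x_def v_def using a b b0 by (simp add: m_assoc del: nonzero_inv_cancel)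
    also have "\<dots> = a" using a b b0 by (simp add: m_assoc)
    finally show ?thesis .
  qed
  have x0: "x \<noteq> \<zero>" using axv a c by auto
  have "x \<otimes> (x \<otimes> v) = x \<otimes> v \<otimes> x" using centralizer_commute[OF comm] by (simp add: axv x_def[symmetric])
  then have "x \<otimes> (x \<otimes> v) = x \<otimes> (v \<otimes> x)" using c by (simp add: m_assoc)
  then have xv: "x \<otimes> v = v \<otimes> x" using mult_left_cancel[OF c(1) x0, of "x \<otimes> v" "v \<otimes> x"] c by simp
  have "a [^] L = x [^] L \<otimes> v [^] L" using pow_mult_distrib[OF xv c(1,2)] axv by simp
  also have "\<dots> = b \<otimes> a [^] L \<otimes> inv b" using L(2) a b b0 conj_pow[OF b(1) b0 a(1), of L] by (simp add: x_def v_def)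
  finally have "a [^] L \<otimes> b = b \<otimes> a [^] L" using a b b0 by (metis m_closed nat_pow_closed nonzero_inv_cancel(4))
  then have "a [^] L \<in> centralizer b" using a by (intro centralizerI) auto
  then obtain i where "i > 0" "(a [^] L) [^] (i::nat) = \<one>"
    using common_centralizer_torsion[OF M a b H, of "a [^] L"] a by auto
  then show ?thesis using a L(1) by (intro exI[of _ "L * i"]) (auto simp: nat_pow_pow)
qed

end

section \<open>Counting through fibres\<close>

lemma card_fibres:
  assumes "finite G"
  shows "card G = (\<Sum>v\<in>f ` G. card {x\<in>G. f x = v})"
  using sum.image_gen[OF assms, of "\<lambda>_. 1::nat" f] by simp

lemma card_fibres_le:
  assumes "finite G" "\<And>y. y \<in> G \<Longrightarrow> card {x\<in>G. f x = f y} \<le> k"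
  shows "card G \<le> k * card (f ` G)"
proof -
  have "(\<Sum>v\<in>f ` G. card {x\<in>G. f x = v}) \<le> (\<Sum>v\<in>f ` G. k)"
    using assms(2) by (intro sum_mono) auto
  then show ?thesis using card_fibres[OF assms(1), of f] by (simp add: mult.commute)
qed

lemma card_fibres_ge:
  assumes "finite G" "\<And>y. y \<in> G \<Longrightarrow> k \<le> card {x\<in>G. f x = f y}"
  shows "k * card (f ` G) \<le> card G"
proof -
  have "(\<Sum>v\<in>f ` G. k) \<le> (\<Sum>v\<in>f ` G. card {x\<in>G. f x = v})"
    using assms(2) by (intro sum_mono) auto
  then show ?thesis using card_fibres[OF assms(1), of f] by (simp add: mult.commute)
qed

context skew_field
begin

lemma inverse_pow:
  assumes "a \<in> carrier R" "a \<noteq> \<zero>"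
  shows "a [^] (i::nat) \<otimes> inv a [^] i = \<one>" "inv a [^] i \<otimes> a [^] i = \<one>"
proof -
  have "a [^] i \<otimes> inv a [^] i = (a \<otimes> inv a) [^] i"
    by (rule pow_mult_distrib[symmetric]) (use assms in simp_all)
  then show "a [^] i \<otimes> inv a [^] i = \<one>" using assms by simp
  have "inv a [^] i \<otimes> a [^] i = (inv a \<otimes> a) [^] i"
    by (rule pow_mult_distrib[symmetric]) (use assms in simp_all)
  then show "inv a [^] i \<otimes> a [^] i = \<one>" using assms by simp
qed

text \<open>The sums \<open>\<rho> j\<close> are the components of \<open>r\<close> in the
  eigenspaces of right multiplication by \<open>a\<close>, up to the factor \<open>\<epsilon> = e
  \<cdot> \<one>\<close>.\<close>

lemma torsion_eigenvector:
  assumes a: "a \<in> carrier R" "a \<noteq> \<zero>" "a \<notin> Z" and tor: "0 < (e0::nat)" "a [^] e0 = \<one>"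
  shows "\<exists>b j. b \<in> carrier R \<and> b \<noteq> \<zero> \<and> b \<otimes> a = a [^] (j::nat) \<otimes> b \<and> a [^] j \<noteq> a"
proof (rule ccontr)
  assume none: "\<not> ?thesis"
  define e where "e = (LEAST e::nat. 0 < e \<and> a [^] e = \<one>)"
  have e: "0 < e" "a [^] e = \<one>"
    using LeastI[of "\<lambda>e. 0 < e \<and> a [^] e = \<one>" e0] tor unfolding e_def by auto
  have emin: "a [^] i \<noteq> \<one>" if "0 < i" "i < e" for i
    using not_less_Least[of i "\<lambda>e. 0 < e \<and> a [^] e = \<one>"] that unfolding e_def by auto
  have inj_lt: "a [^] i \<noteq> a [^] i'" if "i < i'" "i' < e" for i i'
    using pow_eq_cancel[OF a(1,2), of i i'] emin[of "i' - i"] that by auto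
  have inj: "inj_on (\<lambda>i. a [^] i) {..<e}"
  proof (rule inj_onI)
    fix x y assume xy: "x \<in> {..<e}" "y \<in> {..<e}" and eq: "a [^] x = a [^] y"
    then show "x = y" using inj_lt[of x y] inj_lt[of y x] eq by (cases x y rule: linorder_cases) auto
  qed
  obtain r where r: "r \<in> carrier R" "r \<notin> centralizer a" using ad_nonzero[OF a(1,3)] by blast
  define \<alpha> where "\<alpha> = inv a"
  have \<alpha>: "\<alpha> \<in> carrier R" "\<alpha> \<noteq> \<zero>" using a by (auto simp: \<alpha>_def)
  have a\<alpha>: "a [^] i \<otimes> \<alpha> [^] i = \<one>" for i :: nat unfolding \<alpha>_def using inverse_pow a by auto
  have \<alpha>e: "\<alpha> [^] e = \<one>" using a\<alpha>[of e] e \<alpha> by simp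
  have \<alpha>min: "\<alpha> [^] i \<noteq> \<one>" if "0 < i" "i < e" for i using a\<alpha>[of i] emin[OF that] a by auto
  define g where "g j m = \<alpha> [^] (j * m) \<otimes> (r \<otimes> a [^] m)" for j m :: nat
  have g: "g j m \<in> carrier R" for j m using \<alpha> r a by (simp add: g_def)
  define \<rho> where "\<rho> j = (\<Oplus>m\<in>{..<e}. g j m)" for j
  have \<rho>: "\<rho> j \<in> carrier R" for j unfolding \<rho>_def using g by (intro finsum_closed) auto
  have eig: "\<rho> j \<otimes> a = a [^] j \<otimes> \<rho> j" for j
  proof -
    have "\<rho> j \<otimes> a = (\<Oplus>m\<in>{..<e}. g j m \<otimes> a)"
      unfolding \<rho>_def using g a by (intro finsum_ldistr) auto
    also have "\<dots> = (\<Oplus>m\<in>{..<e}. a [^] j \<otimes> g j (Suc m))"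
    proof (rule finsum_cong')
      fix m :: nat
      have "\<alpha> [^] (j * Suc m) = \<alpha> [^] j \<otimes> \<alpha> [^] (j * m)" using \<alpha> by (simp add: nat_pow_mult)
      then have "a [^] j \<otimes> g j (Suc m) = (a [^] j \<otimes> \<alpha> [^] j) \<otimes> (\<alpha> [^] (j * m) \<otimes> (r \<otimes> a [^] Suc m))"
        unfolding g_def using \<alpha> r a by (simp add: m_assoc)
      then show "g j m \<otimes> a = a [^] j \<otimes> g j (Suc m)"
        unfolding a\<alpha> g_def using \<alpha> r a by (simp add: m_assoc)
    qed (use g a in auto)
    also have "\<dots> = a [^] j \<otimes> (\<Oplus>m\<in>{..<e}. g j (Suc m))"
      using g a by (intro finsum_rdistr[symmetric]) auto
    also have "(\<Oplus>m\<in>{..<e}. g j (Suc m)) = \<rho> j"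
    proof -
      have "\<alpha> [^] (j * e) = (\<alpha> [^] e) [^] j" using \<alpha> by (simp add: nat_pow_pow mult.commute)
      then have "g j e = g j 0" unfolding g_def using \<alpha>e e r by simp
      then show ?thesis unfolding \<rho>_def using g by (intro finsum_cyclic_shift) auto
    qed
    finally show ?thesis .
  qed
  have "a \<noteq> \<one>" using a by auto
  then have e1: "1 < e" using e a by (cases "e = 1") auto
  \<comment> \<open>Any such nonzero \<open>\<rho> j\<close> would be an eigenvector excluded by
    \<open>none\<close>, so only the component belonging to \<open>a\<close> itself can
    survive.\<close>
  have \<rho>0: "\<rho> j = \<zero>" if "j < e" "j \<noteq> 1" for j
  proof (rule ccontr)
    assume "\<rho> j \<noteq> \<zero>"
    moreover have "a [^] j \<noteq> a" using inj e1 that a by (auto simp: inj_on_def dest: bspec[where x = 1])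
    ultimately show False using none \<rho> eig by blast
  qed
  define \<epsilon> where "\<epsilon> = (\<Oplus>j\<in>{..<e}. \<one>)"
  have \<epsilon>: "\<epsilon> \<in> Z" "\<epsilon> \<in> carrier R" unfolding \<epsilon>_def by (auto intro!: Z_finsum finsum_closed)
  have "\<rho> 1 = (\<Oplus>j\<in>{..<e}. if 1 = j then \<rho> j else \<zero>)"
    using e1 \<rho> by (intro finsum_singleton[symmetric]) auto
  also have "\<dots> = (\<Oplus>j\<in>{..<e}. \<rho> j)" using \<rho> \<rho>0 by (intro finsum_cong') auto
  also have "\<dots> = (\<Oplus>m\<in>{..<e}. \<Oplus>j\<in>{..<e}. g j m)"
    unfolding \<rho>_def using g by (intro finsum_swap) auto
  \<comment> \<open>For \<open>m \<noteq> 0\<close> the sum over \<open>j\<close> is a full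
    geometric sum of the root of unity \<open>\<alpha> [^] m \<noteq> \<one>\<close> and
    vanishes.\<close>
  also have "\<dots> = (\<Oplus>m\<in>{..<e}. if 0 = m then \<epsilon> \<otimes> r else \<zero>)"
  proof (rule finsum_cong')
    fix m assume m: "m \<in> {..<e}"
    have "(\<Oplus>j\<in>{..<e}. g j m) = (\<Oplus>j\<in>{..<e}. (\<alpha> [^] m) [^] j \<otimes> (r \<otimes> a [^] m))"
      using \<alpha> r a by (intro finsum_cong') (auto simp: g_def nat_pow_pow mult.commute)
    also have "\<dots> = (\<Oplus>j\<in>{..<e}. (\<alpha> [^] m) [^] j) \<otimes> (r \<otimes> a [^] m)"
      using \<alpha> r a by (intro finsum_ldistr[symmetric]) auto
    also have "\<dots> = (if 0 = m then \<epsilon> \<otimes> r else \<zero>)"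
    proof (cases "m = 0")
      case True
      then show ?thesis using r by (simp add: \<epsilon>_def)
    next
      case False
      have "(\<alpha> [^] m) [^] e = (\<alpha> [^] e) [^] m" using \<alpha> by (simp add: nat_pow_pow mult.commute)
      then have "(\<Oplus>j\<in>{..<e}. (\<alpha> [^] m) [^] j) = \<zero>"
        using \<alpha> \<alpha>e \<alpha>min[of m] False m by (intro geometric_sum_root_of_unity) auto
      then show ?thesis using False r a by simp
    qed
    finally show "(\<Oplus>j\<in>{..<e}. g j m) = (if 0 = m then \<epsilon> \<otimes> r else \<zero>)" .
  qed (use \<epsilon> r in auto)
  also have "\<dots> = \<epsilon> \<otimes> r"
    using e \<epsilon> r by (intro finsum_singleton[of 0 "{..<e}" "\<lambda>_. \<epsilon> \<otimes> r"]) auto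
  finally have \<rho>1: "\<rho> 1 = \<epsilon> \<otimes> r" .
  \<comment> \<open>If \<open>\<epsilon>\<close> were nonzero, it could be cancelled from
    \<open>\<rho> 1 = \<epsilon> \<otimes> r\<close>, and \<open>r\<close> would commute with
    \<open>a\<close>. What remains is that the characteristic divides \<open>e\<close>.\<close>
  have "\<epsilon> = \<zero>"
  proof (rule ccontr)
    assume ne: "\<epsilon> \<noteq> \<zero>"
    have "\<epsilon> \<otimes> (r \<otimes> a) = a \<otimes> (\<epsilon> \<otimes> r)" using eig[of 1] \<rho>1 \<epsilon> r a by (simp add: m_assoc)
    also have "\<dots> = \<epsilon> \<otimes> (a \<otimes> r)" using \<epsilon> r a by (intro Z_lcomm) auto
    finally have "r \<otimes> a = a \<otimes> r" using mult_left_cancel[OF \<epsilon>(2) ne] r a by simp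
    then show False using r centralizerI by blast
  qed
  \<comment> \<open>With \<open>\<epsilon> = \<zero>\<close> all power sums of the \<open>e\<close>
    distinct roots of unity \<open>a [^] j\<close> vanish, including those where every summand is
    \<open>\<one>\<close>.\<close>
  have "\<forall>j\<in>{..<e}. a [^] j = \<zero>"
  proof (rule vandermonde[where \<chi> = "\<lambda>j. a [^] j"])
    show "(\<Oplus>j\<in>{..<e}. (a [^] j) [^] m \<otimes> a [^] j) = \<zero>" for m :: nat
    proof -
      have "(\<Oplus>j\<in>{..<e}. (a [^] j) [^] m \<otimes> a [^] j) = (\<Oplus>j\<in>{..<e}. (a [^] Suc m) [^] j)"
      proof (rule finsum_cong')
        fix j :: nat
        have "(a [^] j) [^] m \<otimes> a [^] j = a [^] (j * m + j)" using a by (simp add: nat_pow_pow nat_pow_mult)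
        also have "j * m + j = Suc m * j" by simp
        also have "a [^] (Suc m * j) = (a [^] Suc m) [^] j" by (rule nat_pow_pow[OF a(1), symmetric])
        finally show "(a [^] j) [^] m \<otimes> a [^] j = (a [^] Suc m) [^] j" .
      qed (use a in auto)
      also have "\<dots> = \<zero>"
      proof (cases "a [^] Suc m = \<one>")
        case True
        then show ?thesis using \<open>\<epsilon> = \<zero>\<close> unfolding True \<epsilon>_def by simp
      next
        case False
        have "(a [^] Suc m) [^] e = (a [^] e) [^] Suc m" using a nat_pow_pow[OF a(1)] by (simp only: mult.commute)
        then show ?thesis using a e False by (intro geometric_sum_root_of_unity) (auto simp del: nat_pow_Suc)
      qed
      finally show ?thesis .
    qed
    show "a [^] i \<otimes> a [^] j = a [^] j \<otimes> a [^] i" for i j :: nat using a by (simp add: nat_pow_mult add.commute)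
  qed (use a inj in auto)
  then show False using e a by auto
qed

section \<open>Cyclic algebras over finite fields\<close>


lemma pow_mod_order:
  assumes "a \<in> carrier R" "a [^] (e::nat) = \<one>"
  shows "a [^] (i::nat) = a [^] (i mod e)"
proof -
  have "a [^] i = a [^] (e * (i div e) + i mod e)" by simp
  also have "\<dots> = (a [^] e) [^] (i div e) \<otimes> a [^] (i mod e)"
    using assms(1) by (simp only: nat_pow_mult[OF assms(1), symmetric] nat_pow_pow[OF assms(1)])
  finally show ?thesis using assms by simp
qed

lemma skew_commute_pow_right:
  assumes a: "a \<in> carrier R" and b: "b \<in> carrier R" "b \<otimes> a = a [^] (s::nat) \<otimes> b"
  shows "b \<otimes> a [^] (i::nat) = a [^] (s * i) \<otimes> b"
proof (induction i)
  case (Suc i)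
  have "b \<otimes> a [^] Suc i = (b \<otimes> a [^] i) \<otimes> a" using a b by (simp add: m_assoc)
  also have "\<dots> = a [^] (s * i) \<otimes> (b \<otimes> a)" unfolding Suc using a b by (simp add: m_assoc)
  also have "\<dots> = a [^] (s * i + s) \<otimes> b"
    unfolding b(2) using a b(1) by (simp add: m_assoc[symmetric] nat_pow_mult)
  finally show ?case by (simp add: add.commute)
qed (use b in simp)

lemma skew_commute_pow:
  assumes a: "a \<in> carrier R" and b: "b \<in> carrier R" "b \<otimes> a = a [^] (s::nat) \<otimes> b"
  shows "b [^] (i::nat) \<otimes> a [^] (m::nat) = (a [^] (s ^ i)) [^] m \<otimes> b [^] i"
proof (induction i)
  case (Suc i)
  have "b [^] Suc i \<otimes> a [^] m = b \<otimes> (b [^] i \<otimes> a [^] m)"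
    using a b(1) by (simp only: nat_pow_Suc2 m_assoc nat_pow_closed)
  also have "\<dots> = b \<otimes> a [^] (s ^ i * m) \<otimes> b [^] i"
    unfolding Suc using a b(1) by (simp add: m_assoc nat_pow_pow)
  also have "\<dots> = a [^] (s * (s ^ i * m)) \<otimes> (b \<otimes> b [^] i)"
    unfolding skew_commute_pow_right[OF a b] using a b(1) by (simp add: m_assoc)
  also have "\<dots> = (a [^] (s ^ Suc i)) [^] m \<otimes> b [^] Suc i"
    using a b(1) by (simp only: nat_pow_Suc2 nat_pow_pow power_Suc mult.assoc)
  finally show ?case .
qed (use a in simp)

text \<open>\<open>P\<close> is the finite field generated by \<open>a\<close> and
  \<open>b\<^sup>n\<close>. Counting with Hilbert 90 gives \<open>x \<in> P\<close> of norm
  \<open>b\<^sup>-\<^sup>n\<close>. Then \<open>x b\<close> is an \<open>n\<close>-th root of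
  unity other than \<open>1\<close>, so its first \<open>n\<close> powers sum to \<open>0\<close>,
  although they are independent over \<open>P\<close>.\<close>

lemma no_finite_cyclic_algebra:
  assumes fin: "finite Z" and a: "a \<in> carrier R" "a \<noteq> \<zero>" and e: "0 < (e::nat)" "a [^] e = \<one>"
    and b: "b \<in> carrier R" "b \<noteq> \<zero>" "b \<otimes> a = a [^] (s::nat) \<otimes> b" "b \<notin> centralizer a"
    and n: "0 < n" "b [^] (n::nat) \<in> centralizer a" "inj_on (\<lambda>i. a [^] (s ^ i)) {..<n}"
    and ord: "0 < q" "(b [^] n) [^] (q::nat) = \<one>"
  shows False
proof -
  define \<beta> where "\<beta> = b [^] n"
  define c where "c = inv b"
  have \<beta>: "\<beta> \<in> carrier R" "\<beta> \<noteq> \<zero>" using b by (auto simp: \<beta>_def)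
  have c: "c \<in> carrier R" "c \<noteq> \<zero>" "b \<otimes> c = \<one>" "c \<otimes> b = \<one>" using b by (auto simp: c_def)
  have bc: "b [^] i \<otimes> c [^] i = \<one>" "c [^] i \<otimes> b [^] i = \<one>" for i :: nat
    unfolding c_def using inverse_pow[OF b(1,2)] by auto
  have bc': "b [^] i \<otimes> (c [^] i \<otimes> y) = y" "c [^] i \<otimes> (b [^] i \<otimes> y) = y" if "y \<in> carrier R" for i :: nat and y
    using b c that bc[of i] by (simp_all add: m_assoc[symmetric])
  have \<beta>b: "b \<in> centralizer \<beta>" by (rule centralizer_sym) (use b in \<open>simp_all add: \<beta>_def\<close>)
  have \<beta>a: "a \<in> centralizer \<beta>" by (rule centralizer_sym) (use n a in \<open>simp_all add: \<beta>_def\<close>)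
  define \<chi> where "\<chi> i = a [^] (s ^ i)" for i :: nat
  have \<chi>: "\<chi> i \<in> carrier R" "\<chi> i \<noteq> \<zero>" for i using a by (auto simp: \<chi>_def)
  have b_pow: "b \<otimes> a [^] i = a [^] (s * i) \<otimes> b" for i :: nat
    by (rule skew_commute_pow_right[OF a(1) b(1,3)])
  have b\<chi>: "b [^] i \<otimes> a [^] m = \<chi> i [^] m \<otimes> b [^] i" for i m :: nat
    unfolding \<chi>_def by (rule skew_commute_pow[OF a(1) b(1,3)])
  define I where "I = {..<e} \<times> {..<q}"
  define v where "v p = a [^] fst p \<otimes> \<beta> [^] snd p" for p :: "nat \<times> nat"
  \<comment> \<open>Since \<open>a\<close> and \<open>\<beta>\<close> have finite order, these
    finitely many monomials already span a ring, and over a finite center this ring is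
    finite.\<close>
  define P where "P = lin_span Z I v"
  have I: "finite I" by (simp add: I_def)
  have vc: "v p \<in> carrier R" for p using a \<beta> by (simp add: v_def)
  have PR: "p \<in> carrier R" if "p \<in> P" for p using lin_span_carrier[of I v] vc that by (auto simp: P_def)
  have Pfin: "finite P" unfolding P_def using lin_span_finite[OF fin I, of v] vc by blast
  have gen: "a [^] i \<otimes> \<beta> [^] l \<in> P" for i l :: nat
  proof -
    have "v (i mod e, l mod q) \<in> P" unfolding P_def using e ord vc I by (intro lin_span_base) (auto simp: I_def)
    then show ?thesis
      using pow_mod_order[OF a(1) e(2), of i] pow_mod_order[of \<beta> q l] \<beta> ord by (simp add: v_def \<beta>_def)
  qed
  have P1: "\<one> \<in> P" using gen[of 0 0] by simp
  have Pa: "a [^] i \<in> P" for i :: nat using gen[of i 0] a by simp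
  have P\<beta>: "\<beta> \<in> P" using gen[of 0 1] \<beta> by simp
  have P0: "\<zero> \<in> P" unfolding P_def using vc by (intro lin_span_zero)
  have Psum: "(\<Oplus>j\<in>J. q j) \<in> P" if "\<And>j. j \<in> J \<Longrightarrow> q j \<in> P" for J :: "(nat \<times> nat) set" and q
    using that vc unfolding P_def by (intro lin_span_finsum)
  have Psum': "(\<Oplus>j\<in>J. q j) \<in> P" if "\<And>j. j \<in> J \<Longrightarrow> q j \<in> P" for J :: "nat set" and q
    using that vc unfolding P_def by (intro lin_span_finsum)
  have Psm: "z \<otimes> p \<in> P" if "z \<in> Z" "p \<in> P" for z p
    using that vc I unfolding P_def by (intro lin_span_smult)
  have Pcent: "p \<in> centralizer y"
    if "p \<in> P" "y \<in> carrier R" "a \<in> centralizer y" "\<beta> \<in> centralizer y" for p y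
  proof -
    obtain \<alpha> where al: "\<And>i. \<alpha> i \<in> Z" "p = (\<Oplus>i\<in>I. \<alpha> i \<otimes> v i)" using \<open>p \<in> P\<close> by (auto simp: P_def lin_span_def)
    show ?thesis unfolding al(2) v_def using al(1) that by (intro centralizer_finsum) auto
  qed
  have ca: "p \<in> centralizer a" if "p \<in> P" for p
    by (rule Pcent[OF that a(1)]) (use a n in \<open>auto simp: \<beta>_def\<close>)
  have c\<beta>: "p \<in> centralizer \<beta>" if "p \<in> P" for p
    by (rule Pcent[OF that \<beta>(1)]) (use \<beta> \<beta>a in auto)
  have Pcomm: "p \<otimes> q = q \<otimes> p" if "p \<in> P" "q \<in> P" for p q
  proof -
    have "p \<in> centralizer q"
      by (rule Pcent[OF that(1) PR[OF that(2)]])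
        (use centralizer_sym[OF a(1) ca[OF that(2)]] centralizer_sym[OF \<beta>(1) c\<beta>[OF that(2)]] in auto)
    then show ?thesis by (rule centralizer_commute)
  qed
  have Pgen: "p \<otimes> (a [^] i \<otimes> \<beta> [^] l) \<in> P" if "p \<in> P" for p and i l :: nat
  proof -
    obtain \<alpha> where al: "\<And>i. \<alpha> i \<in> Z" "p = (\<Oplus>i\<in>I. \<alpha> i \<otimes> v i)" using \<open>p \<in> P\<close> by (auto simp: P_def lin_span_def)
    have "p \<otimes> (a [^] i \<otimes> \<beta> [^] l) = (\<Oplus>r\<in>I. \<alpha> r \<otimes> v r \<otimes> (a [^] i \<otimes> \<beta> [^] l))"
      unfolding al(2) using al(1) vc a \<beta> I by (intro finsum_ldistr) auto
    also have "\<dots> \<in> P"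
    proof (rule Psum)
      fix r :: "nat \<times> nat"
      have "\<beta> [^] snd r \<otimes> a [^] i = a [^] i \<otimes> \<beta> [^] snd r"
      proof (rule centralizer_commute)
        have "a [^] i \<in> centralizer \<beta>" using \<beta>a \<beta> by simp
        then have "\<beta> \<in> centralizer (a [^] i)" by (rule centralizer_sym[OF \<beta>(1)])
        then show "\<beta> [^] snd r \<in> centralizer (a [^] i)" using a by simp
      qed
      then have "v r \<otimes> (a [^] i \<otimes> \<beta> [^] l) = a [^] fst r \<otimes> (a [^] i \<otimes> \<beta> [^] snd r) \<otimes> \<beta> [^] l"
        unfolding v_def using a \<beta> by (simp add: m_assoc) (simp add: m_assoc[symmetric])
      also have "\<dots> = a [^] (fst r + i) \<otimes> \<beta> [^] (snd r + l)"
        using a \<beta> by (simp add: nat_pow_mult[symmetric] m_assoc)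
      finally have "\<alpha> r \<otimes> (v r \<otimes> (a [^] i \<otimes> \<beta> [^] l)) \<in> P" using gen al(1) by (simp add: Psm)
      then show "\<alpha> r \<otimes> v r \<otimes> (a [^] i \<otimes> \<beta> [^] l) \<in> P" using al(1) vc a \<beta> by (simp add: m_assoc)
    qed
    finally show ?thesis .
  qed
  have Pmult: "p \<otimes> q \<in> P" if "p \<in> P" "q \<in> P" for p q
  proof -
    obtain \<alpha> where al: "\<And>i. \<alpha> i \<in> Z" "q = (\<Oplus>i\<in>I. \<alpha> i \<otimes> v i)" using \<open>q \<in> P\<close> by (auto simp: P_def lin_span_def)
    have "p \<otimes> q = (\<Oplus>i\<in>I. p \<otimes> (\<alpha> i \<otimes> v i))"
      unfolding al(2) using al(1) vc PR[OF that(1)] I by (intro finsum_rdistr) auto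
    also have "\<dots> \<in> P"
    proof (rule Psum)
      fix i :: "nat \<times> nat"
      have "p \<otimes> (\<alpha> i \<otimes> v i) = \<alpha> i \<otimes> (p \<otimes> v i)" using al(1) vc PR[OF that(1)] by (intro Z_lcomm) auto
      then show "p \<otimes> (\<alpha> i \<otimes> v i) \<in> P" using Psm[OF al(1)] Pgen[OF that(1)] by (simp add: v_def)
    qed
    finally show ?thesis .
  qed
  have Pconj: "b \<otimes> p \<otimes> c \<in> P" if "p \<in> P" for p
  proof -
    obtain \<alpha> where al: "\<And>i. \<alpha> i \<in> Z" "p = (\<Oplus>i\<in>I. \<alpha> i \<otimes> v i)" using \<open>p \<in> P\<close> by (auto simp: P_def lin_span_def)
    have "b \<otimes> p \<otimes> c = (\<Oplus>i\<in>I. b \<otimes> (\<alpha> i \<otimes> v i)) \<otimes> c"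
      unfolding al(2) using al(1) vc b I by (subst finsum_rdistr) auto
    also have "\<dots> = (\<Oplus>i\<in>I. b \<otimes> (\<alpha> i \<otimes> v i) \<otimes> c)"
      using al(1) vc b c I by (intro finsum_ldistr) auto
    also have "\<dots> \<in> P"
    proof (rule Psum)
      fix i :: "nat \<times> nat"
      have bb: "\<beta> [^] snd i \<otimes> b = b \<otimes> \<beta> [^] snd i"
      proof (rule centralizer_commute)
        show "\<beta> [^] snd i \<in> centralizer b" unfolding \<beta>_def using b by simp
      qed
      have "b \<otimes> (\<alpha> i \<otimes> v i) \<otimes> c = \<alpha> i \<otimes> (b \<otimes> v i) \<otimes> c"
        using Z_lcomm[of "\<alpha> i" b "v i"] al(1) vc b by simp
      also have "b \<otimes> v i = a [^] (s * fst i) \<otimes> (b \<otimes> \<beta> [^] snd i)"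
        unfolding v_def using a b \<beta> b_pow[of "fst i"] by (simp add: m_assoc[symmetric])
      also have "\<dots> = a [^] (s * fst i) \<otimes> \<beta> [^] snd i \<otimes> b"
        unfolding bb[symmetric] using a b \<beta> by (simp add: m_assoc)
      also have "\<alpha> i \<otimes> (a [^] (s * fst i) \<otimes> \<beta> [^] snd i \<otimes> b) \<otimes> c = \<alpha> i \<otimes> (a [^] (s * fst i) \<otimes> \<beta> [^] snd i)"
        using al(1) a b c \<beta> by (simp add: m_assoc)
      finally show "b \<otimes> (\<alpha> i \<otimes> v i) \<otimes> c \<in> P" using Psm[OF al(1) gen] by simp
    qed
    finally show ?thesis .
  qed
  \<comment> \<open>The \<open>i\<close>-th iterate of conjugation by \<open>b\<close>, which maps
    \<open>P\<close> into itself.\<close>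
  define \<sigma> where "\<sigma> i x = b [^] i \<otimes> x \<otimes> c [^] i" for i :: nat and x
  have \<sigma>P: "\<sigma> i x \<in> P" if "x \<in> P" for i x
  proof (induction i)
    case (Suc i)
    have "\<sigma> (Suc i) x = b \<otimes> \<sigma> i x \<otimes> c"
      unfolding \<sigma>_def using b c PR[OF that] nat_pow_Suc2[OF b(1), of i] by (simp add: m_assoc)
    then show ?case using Pconj[OF Suc] by simp
  qed (use that PR in \<open>simp add: \<sigma>_def\<close>)
  \<comment> \<open>A partial norm: by \<open>N_Suc\<close> it is the product of the first
    \<open>i\<close> conjugates of \<open>x\<close>, beginning with \<open>x\<close> itself. The
    closed form relates it directly to powers of \<open>x \<otimes> b\<close>; the norm proper is
    \<open>N n\<close>.\<close>
  define N where "N i x = (x \<otimes> b) [^] i \<otimes> c [^] i" for i :: nat and x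
  have N_Suc: "N (Suc i) x = N i x \<otimes> \<sigma> i x" if "x \<in> carrier R" for i x
  proof -
    have "N (Suc i) x = (x \<otimes> b) [^] i \<otimes> (x \<otimes> (b \<otimes> (c \<otimes> c [^] i)))"
      unfolding N_def using that b c nat_pow_Suc2[OF c(1), of i] by (simp add: m_assoc)
    also have "b \<otimes> (c \<otimes> c [^] i) = c [^] i" using b c by (simp add: m_assoc[symmetric])
    finally show ?thesis unfolding N_def \<sigma>_def using that b c bc'[of _ i] by (simp add: m_assoc)
  qed
  have N0: "N 0 x = \<one>" for x by (simp add: N_def)
  have NP: "N i x \<in> P" if "x \<in> P" for i x
    by (induction i) (use that in \<open>auto simp: N0 N_Suc PR P1 intro!: Pmult \<sigma>P\<close>)
  have N_mult: "N i (x \<otimes> y) = N i x \<otimes> N i y" if "x \<in> P" "y \<in> P" for i x y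
  proof (induction i)
    case (Suc i)
    note k = PR[OF that(1)] PR[OF that(2)]
    have s: "\<sigma> i (x \<otimes> y) = \<sigma> i x \<otimes> \<sigma> i y"
      unfolding \<sigma>_def using k b c bc'[of _ i] by (simp add: m_assoc)
    note p = NP[OF that(1), of i] NP[OF that(2), of i] \<sigma>P[OF that(1), of i] \<sigma>P[OF that(2), of i]
    have "N (Suc i) (x \<otimes> y) = N i x \<otimes> (N i y \<otimes> \<sigma> i x) \<otimes> \<sigma> i y"
      unfolding N_Suc[OF m_closed[OF k]] Suc s using p[THEN PR] by (simp add: m_assoc)
    also have "N i y \<otimes> \<sigma> i x = \<sigma> i x \<otimes> N i y" using p by (intro Pcomm)
    finally show ?case unfolding N_Suc[OF k(1)] N_Suc[OF k(2)] using p[THEN PR] by (simp add: m_assoc)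
  qed (simp add: N0)
  have N_one: "N i \<one> = \<one>" for i unfolding N_def using b bc by simp
  have N_pow: "(x \<otimes> b) [^] i = N i x \<otimes> b [^] i" if "x \<in> P" for i x
    unfolding N_def using PR[OF that] b c bc by (simp add: m_assoc)
  have N_nz: "N i x \<noteq> \<zero>" if "x \<in> P" "x \<noteq> \<zero>" for i x
    unfolding N_def using PR[OF that(1)] that b c by simp
  \<comment> \<open>As a power of \<open>x \<otimes> b\<close> times the inverse of
    \<open>\<beta>\<close>, the norm commutes with \<open>x \<otimes> b\<close>. It commutes with
    \<open>x\<close> inside \<open>P\<close>, so \<open>x\<close> can be cancelled.\<close>
  have N_fix: "N n x \<in> centralizer b" if x: "x \<in> P" "x \<noteq> \<zero>" for x
  proof -
    define u where "u = x \<otimes> b"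
    define w where "w = N n x"
    have k: "x \<in> carrier R" "u \<in> carrier R" "w \<in> carrier R" using PR x b NP by (auto simp: u_def w_def)
    have "\<beta> \<in> centralizer u" unfolding u_def
      by (rule centralizer_sym[OF \<beta>(1) centralizer_mult[OF \<beta>(1) c\<beta>[OF x(1)] \<beta>b]])
    moreover have "c [^] n = inv \<beta>"
      using bc(1)[of n] \<beta> c nonzero_inv_cancel(1)[OF \<beta>, of "c [^] n"] by (simp add: \<beta>_def)
    ultimately have "c [^] n \<in> centralizer u" using centralizer_inv[OF k(2)] \<beta> by simp
    then have "w \<in> centralizer u" unfolding w_def N_def u_def[symmetric] using k by simp
    then have "w \<otimes> (x \<otimes> b) = x \<otimes> b \<otimes> w" using centralizer_commute by (simp add: u_def)
    then have "w \<otimes> x \<otimes> b = x \<otimes> (b \<otimes> w)" using k b by (simp add: m_assoc)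
    then have "x \<otimes> (w \<otimes> b) = x \<otimes> (b \<otimes> w)" using Pcomm[OF NP[OF x(1), of n] x(1)] k b by (simp add: w_def m_assoc)
    then have "w \<otimes> b = b \<otimes> w" using mult_left_cancel[OF k(1) x(2)] k b by simp
    then show ?thesis using k by (intro centralizerI) (auto simp: w_def)
  qed
  define G where "G = P - {\<zero>}"
  define G0 where "G0 = {g \<in> G. g \<in> centralizer b}"
  define K where "K = {g \<in> G. N n g = \<one>}"
  \<comment> \<open>This is the quotient of \<open>y\<close> by its conjugate
    \<open>b \<otimes> y \<otimes> c\<close>, as in Hilbert 90; \<open>K\<close> is the kernel of
    the norm and \<open>G0\<close> the group of fixed points.\<close>
  define \<tau> where "\<tau> y = y \<otimes> b \<otimes> inv y \<otimes> c" for y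
  have G: "finite G" "finite G0" "finite K" using Pfin by (auto simp: G_def G0_def K_def)
  have GR: "g \<in> carrier R" "g \<noteq> \<zero>" "g \<in> P" if "g \<in> G" for g using that PR by (auto simp: G_def)
  have Gm: "g \<otimes> h \<in> G" if "g \<in> G" "h \<in> G" for g h using that Pmult PR by (auto simp: G_def)
  have G1: "\<one> \<in> G" using P1 by (simp add: G_def)
  have Ginv: "inv g \<in> G" if g: "g \<in> G" for g
  proof -
    have "inj_on (\<lambda>x. g \<otimes> x) P"
      using GR[OF g] PR mult_left_cancel[of g] by (auto simp: inj_on_def)
    moreover have "(\<lambda>x. g \<otimes> x) ` P \<subseteq> P" using GR[OF g] Pmult by auto
    ultimately have "(\<lambda>x. g \<otimes> x) ` P = P" using endo_inj_surj[OF Pfin] by blast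
    then obtain h where h: "h \<in> P" "g \<otimes> h = \<one>" using P1 by (metis imageE)
    then have "inv g = h" using GR[OF g] PR[OF h(1)] nonzero_inv_cancel(1)[of g h] by simp
    moreover have "inv g \<noteq> \<zero>" using nonzero_inv(4) GR[OF g] by blast
    ultimately show ?thesis using h by (simp add: G_def)
  qed
  have hilbert90: "K \<subseteq> \<tau> ` G"
  proof
    fix k assume "k \<in> K"
    then have k: "k \<in> G" "N n k = \<one>" by (auto simp: K_def)
    note kk = GR[OF k(1)]
    define u where "u = k \<otimes> b"
    have u: "u \<in> carrier R" using kk b by (simp add: u_def)
    have un: "u [^] n = \<beta>" unfolding u_def N_pow[OF kk(3)] k(2) using b by (simp add: \<beta>_def)
    \<comment> \<open>The summands of the Lagrange resolvent \<open>Y m\<close>. Conjugation by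
      \<open>u\<close> on the left and \<open>c\<close> on the right advances \<open>i\<close> by
      one, and \<open>u [^] n = \<beta>\<close> closes the cycle.\<close>
    define g where "g m i = u [^] i \<otimes> a [^] m \<otimes> c [^] i" for m i :: nat
    have gN: "g m i = N i k \<otimes> (\<chi> i [^] m)" for m i
    proof -
      have "g m i = N i k \<otimes> (b [^] i \<otimes> a [^] m) \<otimes> c [^] i"
        unfolding g_def u_def N_pow[OF kk(3)] using NP[OF kk(3), THEN PR] a b c by (simp add: m_assoc)
      also have "\<dots> = N i k \<otimes> (\<chi> i [^] m) \<otimes> (b [^] i \<otimes> c [^] i)"
        unfolding b\<chi> using NP[OF kk(3), THEN PR] \<chi> b c by (simp add: m_assoc)
      finally show ?thesis unfolding bc using NP[OF kk(3), THEN PR] \<chi> by simp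
    qed
    have \<chi>P: "\<chi> i [^] m \<in> P" for i m :: nat using Pa a by (simp add: \<chi>_def nat_pow_pow)
    have gP: "g m i \<in> P" for m i unfolding gN by (intro Pmult NP kk \<chi>P)
    define Y where "Y m = (\<Oplus>i\<in>{..<n}. g m i)" for m
    have YP: "Y m \<in> P" for m unfolding Y_def using gP by (intro Psum')
    \<comment> \<open>Independence of the distinct characters \<open>\<chi> i\<close>: if all
      resolvents vanished, so would every coefficient \<open>N i k\<close>, yet \<open>N 0 k\<close>
      is \<open>\<one>\<close>.\<close>
    have "\<exists>m. Y m \<noteq> \<zero>"
    proof (rule ccontr)
      assume "\<not> ?thesis"
      then have Y0: "(\<Oplus>i\<in>{..<n}. g m i) = \<zero>" for m by (simp add: Y_def)
      have "\<forall>i\<in>{..<n}. N i k = \<zero>"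
      proof (rule vandermonde[where \<chi> = \<chi>])
        show "inj_on \<chi> {..<n}" using n(3) by (simp add: \<chi>_def[abs_def])
        show "\<chi> i \<otimes> \<chi> j = \<chi> j \<otimes> \<chi> i" for i j unfolding \<chi>_def using Pcomm[OF Pa Pa] .
        show "(\<Oplus>i\<in>{..<n}. \<chi> i [^] m \<otimes> N i k) = \<zero>" for m :: nat
        proof -
          have "(\<Oplus>i\<in>{..<n}. \<chi> i [^] m \<otimes> N i k) = (\<Oplus>i\<in>{..<n}. g m i)"
            unfolding gN using Pcomm[OF \<chi>P NP[OF kk(3)]] NP[OF kk(3), THEN PR] \<chi>
            by (intro finsum_cong') auto
          then show ?thesis using Y0 by simp
        qed
      qed (use \<chi> NP[OF kk(3), THEN PR] in auto)
      then have "N 0 k = \<zero>" using n(1) by blast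
      then show False by (simp add: N0)
    qed
    then obtain m where Ym: "Y m \<noteq> \<zero>" by blast
    then have YG: "Y m \<in> G" using YP by (simp add: G_def)
    note yy = GR[OF YG]
    have gR: "g m i \<in> carrier R" for i using gP[THEN PR] .
    have "u \<otimes> Y m \<otimes> c = (\<Oplus>i\<in>{..<n}. u \<otimes> g m i) \<otimes> c"
      unfolding Y_def using u gR by (subst finsum_rdistr) auto
    also have "\<dots> = (\<Oplus>i\<in>{..<n}. u \<otimes> g m i \<otimes> c)"
      using u c gR by (intro finsum_ldistr) auto
    also have "\<dots> = (\<Oplus>i\<in>{..<n}. g m (Suc i))"
    proof (rule finsum_cong')
      fix i :: nat
      show "u \<otimes> g m i \<otimes> c = g m (Suc i)"
        unfolding g_def using u a c nat_pow_Suc2[OF u, of i] by (simp add: m_assoc)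
    qed (use u c gR in auto)
    also have "\<dots> = Y m"
    proof -
      have "\<beta> \<otimes> a [^] m \<otimes> c [^] n = a [^] m \<otimes> (\<beta> \<otimes> c [^] n)"
        using Pcomm[OF P\<beta> Pa[of m]] a \<beta> c by (simp add: m_assoc)
      then have "g m n = g m 0" unfolding g_def un using bc(1)[of n] a by (simp add: \<beta>_def)
      then show ?thesis unfolding Y_def using gR by (intro finsum_cyclic_shift)
    qed
    finally have "k \<otimes> b \<otimes> Y m \<otimes> c = Y m" by (simp add: u_def)
    then have "k \<otimes> b \<otimes> Y m \<otimes> c \<otimes> b = Y m \<otimes> b" by simp
    then have "k \<otimes> b \<otimes> Y m = Y m \<otimes> b" using kk b c yy by (simp add: m_assoc)
    then have "k \<otimes> b \<otimes> Y m \<otimes> inv (Y m) \<otimes> c = \<tau> (Y m)" by (simp add: \<tau>_def)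
    moreover have "k \<otimes> b \<otimes> Y m \<otimes> inv (Y m) \<otimes> c = k" using kk b c yy by (simp add: m_assoc)
    ultimately have "k = \<tau> (Y m)" by simp
    then show "k \<in> \<tau> ` G" using YG by (rule image_eqI)
  qed
  have "card {x \<in> G. N n x = N n y} \<le> card K" if y: "y \<in> G" for y
  proof (rule card_inj_on_le[of "\<lambda>x. inv y \<otimes> x"])
    note iy = Ginv[OF y]
    show "inj_on (\<lambda>x. inv y \<otimes> x) {x \<in> G. N n x = N n y}"
      using GR[OF iy] GR mult_left_cancel[of "inv y"] by (auto simp: inj_on_def)
    show "(\<lambda>x. inv y \<otimes> x) ` {x \<in> G. N n x = N n y} \<subseteq> K"
    proof (rule image_subsetI)
      fix x assume "x \<in> {x \<in> G. N n x = N n y}"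
      then have x: "x \<in> G" "N n x = N n y" by auto
      have "N n (inv y \<otimes> x) = N n (inv y) \<otimes> N n y"
        using N_mult[OF GR(3)[OF iy] GR(3)[OF x(1)], of n] x(2) by simp
      also have "\<dots> = N n (inv y \<otimes> y)" by (rule N_mult[OF GR(3)[OF iy] GR(3)[OF y], symmetric])
      finally show "inv y \<otimes> x \<in> K" using Gm[OF iy x(1)] GR[OF y] N_one by (simp add: K_def)
    qed
  qed (use G in auto)
  then have le: "card G \<le> card K * card (N n ` G)" by (rule card_fibres_le[OF G(1)])
  have "card G0 \<le> card {x \<in> G. \<tau> x = \<tau> y}" if y: "y \<in> G" for y
  proof (rule card_inj_on_le[of "\<lambda>g. y \<otimes> g"])
    show "inj_on (\<lambda>g. y \<otimes> g) G0"
      using GR[OF y] GR mult_left_cancel[of y] by (auto simp: inj_on_def G0_def)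
    show "(\<lambda>g. y \<otimes> g) ` G0 \<subseteq> {x \<in> G. \<tau> x = \<tau> y}"
    proof (rule image_subsetI)
      fix g assume "g \<in> G0"
      then have g: "g \<in> G" "g \<in> centralizer b" by (auto simp: G0_def)
      note k = GR[OF y] GR[OF g(1)] GR[OF Ginv[OF y]] GR[OF Ginv[OF g(1)]]
      have i: "inv (y \<otimes> g) = inv g \<otimes> inv y"
      proof -
        have "(y \<otimes> g) \<otimes> (inv g \<otimes> inv y) = \<one>" using k by (simp add: m_assoc)
        then have "inv (y \<otimes> g) \<otimes> ((y \<otimes> g) \<otimes> (inv g \<otimes> inv y)) = inv (y \<otimes> g)" using k by simp
        then show ?thesis using k nonzero_inv_cancel(1)[of "y \<otimes> g" "inv g \<otimes> inv y"] by simp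
      qed
      have "\<tau> (y \<otimes> g) = y \<otimes> (g \<otimes> b) \<otimes> inv g \<otimes> inv y \<otimes> c"
        unfolding \<tau>_def i using k b c by (simp add: m_assoc)
      also have "g \<otimes> b = b \<otimes> g" by (rule centralizer_commute[OF g(2)])
      also have "y \<otimes> (b \<otimes> g) \<otimes> inv g \<otimes> inv y \<otimes> c = \<tau> y"
        unfolding \<tau>_def using k b c by (simp add: m_assoc)
      finally show "y \<otimes> g \<in> {x \<in> G. \<tau> x = \<tau> y}" using Gm[OF y g(1)] by simp
    qed
  qed (use G in auto)
  then have ge: "card G0 * card (\<tau> ` G) \<le> card G" by (rule card_fibres_ge[OF G(1)])
  have K0: "0 < card K" using G(3) G1 N_one by (auto simp: K_def card_gt_0_iff)
  \<comment> \<open>Together with \<open>le\<close> and \<open>ge\<close> this bounds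
    \<open>card G0\<close> by the number of norms. Norms lie in \<open>G0\<close>, so every fixed
    element is one.\<close>
  have "card K \<le> card (\<tau> ` G)" using hilbert90 G by (intro card_mono) auto
  then have "card K * card G0 \<le> card K * card (N n ` G)"
    using le ge by (metis le_trans mult.commute mult_le_mono2)
  then have "card G0 \<le> card (N n ` G)" using K0 by simp
  moreover have sub: "N n ` G \<subseteq> G0" using N_fix NP N_nz by (auto simp: G0_def G_def)
  ultimately have surj: "N n ` G = G0" using G by (intro card_seteq) auto
  have "\<beta> \<in> G" using P\<beta> \<beta> by (simp add: G_def)
  then have "inv \<beta> \<in> G" by (rule Ginv)
  moreover have "inv \<beta> \<in> centralizer b"
    using centralizer_inv[OF b(1) _ \<beta>(2)] b by (simp add: \<beta>_def)
  ultimately have "inv \<beta> \<in> N n ` G" unfolding surj by (simp add: G0_def)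
  then obtain x where x: "x \<in> G" "N n x = inv \<beta>" by (metis imageE)
  note xx = GR[OF x(1)]
  define u where "u = x \<otimes> b"
  have u: "u \<in> carrier R" using xx b by (simp add: u_def)
  have un: "u [^] n = \<one>" unfolding u_def N_pow[OF xx(3)] x(2) using \<beta> by (simp add: \<beta>_def)
  \<comment> \<open>Otherwise \<open>b\<close> would be the inverse of an element of
    \<open>P\<close> and commute with \<open>a\<close>.\<close>
  have "u \<noteq> \<one>"
  proof
    assume "u = \<one>"
    then have "inv x \<otimes> (x \<otimes> b) = inv x" using xx by (simp add: u_def)
    then have "b = inv x" using xx b by simp
    then show False using b(4) ca[OF GR(3)[OF Ginv[OF x(1)]]] by simp
  qed
  then have s0: "(\<Oplus>i\<in>{..<n}. u [^] i) = \<zero>" using geometric_sum_root_of_unity[OF u _ un] by blast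
  have uR: "N i x \<otimes> b [^] i \<in> carrier R" for i using NP[OF xx(3), THEN PR] b by simp
  \<comment> \<open>Moving \<open>a [^] m\<close> to the left past \<open>b [^] i\<close> produces
    the factor \<open>\<chi> i [^] m\<close>. Hence multiplying the vanishing sum of the powers of
    \<open>u\<close> by \<open>a [^] m\<close> on the right supplies all the moments.\<close>
  have "\<forall>i\<in>{..<n}. N i x \<otimes> b [^] i = \<zero>"
  proof (rule vandermonde[where \<chi> = \<chi>])
    show "inj_on \<chi> {..<n}" using n(3) by (simp add: \<chi>_def[abs_def])
    show "\<chi> i \<otimes> \<chi> j = \<chi> j \<otimes> \<chi> i" for i j unfolding \<chi>_def using Pcomm[OF Pa Pa] .
    show "(\<Oplus>i\<in>{..<n}. \<chi> i [^] m \<otimes> (N i x \<otimes> b [^] i)) = \<zero>" for m :: nat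
    proof -
      have "(\<Oplus>i\<in>{..<n}. \<chi> i [^] m \<otimes> (N i x \<otimes> b [^] i)) = (\<Oplus>i\<in>{..<n}. u [^] i \<otimes> a [^] m)"
      proof (rule finsum_cong')
        fix i :: nat
        have \<chi>P: "\<chi> i [^] m \<in> P" using Pa a by (simp add: \<chi>_def nat_pow_pow)
        have "\<chi> i [^] m \<otimes> (N i x \<otimes> b [^] i) = (\<chi> i [^] m \<otimes> N i x) \<otimes> b [^] i"
          using NP[OF xx(3), THEN PR] b \<chi> by (simp add: m_assoc)
        also have "\<dots> = N i x \<otimes> (\<chi> i [^] m \<otimes> b [^] i)"
          unfolding Pcomm[OF \<chi>P NP[OF xx(3)]] using NP[OF xx(3), THEN PR] b \<chi> by (simp add: m_assoc)
        also have "\<dots> = u [^] i \<otimes> a [^] m"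
          unfolding b\<chi>[symmetric] u_def N_pow[OF xx(3)] using NP[OF xx(3), THEN PR] b a by (simp add: m_assoc)
        finally show "\<chi> i [^] m \<otimes> (N i x \<otimes> b [^] i) = u [^] i \<otimes> a [^] m" .
      qed (use u a in auto)
      also have "\<dots> = (\<Oplus>i\<in>{..<n}. u [^] i) \<otimes> a [^] m"
        using u a by (intro finsum_ldistr[symmetric]) auto
      finally show ?thesis using s0 a by simp
    qed
  qed (use \<chi> uR in auto)
  then have "N 0 x \<otimes> b [^] (0::nat) = \<zero>" using n(1) by blast
  then show False by (simp add: N0)
qed

section \<open>Commutators with a subnormal subgroup\<close>


text \<open>The eigenvector \<open>b\<close> conjugates \<open>a\<close> to a power of
  \<open>a\<close>, and \<open>a\<close> has finitely many powers, so some \<open>b [^] n\<close>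
  commutes with \<open>a\<close>. It also commutes with \<open>b\<close>, hence is torsion by
  \<open>common_centralizer_torsion\<close>; these are the data of a finite cyclic algebra.\<close>

lemma torsion_contradiction:
  assumes fin: "finite Z" and a: "a \<in> carrier R" "a \<noteq> \<zero>" "a \<notin> Z"
    and e: "0 < (e::nat)" "a [^] e = \<one>" and M: "0 < (M::nat)"
    and H: "\<And>b. b \<in> carrier R \<Longrightarrow> b \<notin> centralizer a \<Longrightarrow> (b \<otimes> (a \<otimes> inv (ad a b))) [^] M = \<one>"
  shows False
proof -
  obtain b s where b: "b \<in> carrier R" "b \<noteq> \<zero>" "b \<otimes> a = a [^] (s::nat) \<otimes> b" "a [^] s \<noteq> a"
    using torsion_eigenvector[OF a e] by blast
  have ba: "b \<notin> centralizer a"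
  proof
    assume "b \<in> centralizer a"
    then have "a [^] s \<otimes> b = a \<otimes> b" using centralizer_commute b(3) by metis
    then show False using mult_right_cancel[OF b(1,2), of "a [^] s" a] a b(4) by simp
  qed
  \<comment> \<open>When \<open>b [^] i\<close> and \<open>b [^] j\<close> conjugate
    \<open>a\<close> to the same element, their quotient centralizes \<open>a\<close>.\<close>
  have diff: "b [^] (j - i) \<in> centralizer a" if "a [^] (s ^ i) = a [^] (s ^ j)" "i < j" for i j
  proof -
    let ?d = "b [^] (j - i)"
    have bp: "b [^] i \<otimes> a = a [^] (s ^ i) \<otimes> b [^] i" for i :: nat
      using skew_commute_pow[OF a(1) b(1,3), of i 1] a by simp
    have d: "b [^] j = b [^] i \<otimes> ?d" using b(1) that by (simp add: nat_pow_mult)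
    have "b [^] i \<otimes> (?d \<otimes> a) = b [^] j \<otimes> a" unfolding d using a b(1) by (simp add: m_assoc)
    also have "\<dots> = a [^] (s ^ i) \<otimes> b [^] j" using bp[of j] that(1) by simp
    also have "\<dots> = a [^] (s ^ i) \<otimes> b [^] i \<otimes> ?d" using d a b(1) by (simp add: m_assoc)
    also have "\<dots> = b [^] i \<otimes> (a \<otimes> ?d)" unfolding bp[symmetric] using a b(1) by (simp add: m_assoc)
    finally have "?d \<otimes> a = a \<otimes> ?d"
      using mult_left_cancel[of "b [^] i" "?d \<otimes> a" "a \<otimes> ?d"] a b(1,2) by simp
    then show ?thesis using b(1) by (intro centralizerI) auto
  qed
  have "\<exists>n>0. b [^] (n::nat) \<in> centralizer a"
  proof -
    have "range (\<lambda>i. a [^] (s ^ i)) \<subseteq> (\<lambda>i. a [^] i) ` {..<e}"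
    proof (rule image_subsetI)
      fix i :: nat
      show "a [^] (s ^ i) \<in> (\<lambda>i. a [^] i) ` {..<e}"
        using pow_mod_order[OF a(1) e(2), of "s ^ i"] e(1) by (intro image_eqI[of _ _ "s ^ i mod e"]) auto
    qed
    then have "finite (range (\<lambda>i. a [^] (s ^ i)))" by (rule finite_subset) simp
    then have "\<not> inj (\<lambda>i::nat. a [^] (s ^ i))" using finite_imageD infinite_UNIV_nat by blast
    then obtain i j where "i \<noteq> j" "a [^] (s ^ i) = a [^] (s ^ j)" by (auto simp: inj_def)
    then obtain i j where "i < j" "a [^] (s ^ i) = a [^] (s ^ j)" by (metis linorder_neqE_nat)
    then show ?thesis using diff[of i j] by (intro exI[of _ "j - i"]) simp
  qed
  then obtain n0 where n0: "0 < n0 \<and> b [^] (n0::nat) \<in> centralizer a" by blast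
  \<comment> \<open>The least exponent makes the first \<open>n\<close> conjugates of
    \<open>a\<close> distinct, as the independence of characters requires.\<close>
  define n where "n = (LEAST n::nat. 0 < n \<and> b [^] n \<in> centralizer a)"
  have n: "0 < n" "b [^] n \<in> centralizer a"
    using LeastI[of "\<lambda>n. 0 < n \<and> b [^] n \<in> centralizer a", OF n0] unfolding n_def by auto
  have nmin: "b [^] i \<notin> centralizer a" if "0 < i" "i < n" for i
    using not_less_Least[of i "\<lambda>n. 0 < n \<and> b [^] n \<in> centralizer a"] that unfolding n_def by auto
  have ne: "a [^] (s ^ i) \<noteq> a [^] (s ^ j)" if "i < j" "j < n" for i j
    using diff[of i j] nmin[of "j - i"] that by auto
  have inj: "inj_on (\<lambda>i. a [^] (s ^ i)) {..<n}"
  proof (rule inj_onI)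
    fix i j assume "i \<in> {..<n}" "j \<in> {..<n}" "a [^] (s ^ i) = a [^] (s ^ j)"
    then show "i = j" using ne[of i j] ne[of j i] by (cases i j rule: linorder_cases) auto
  qed
  have "\<exists>i>0. (b [^] n) [^] (i::nat) = \<one>"
    by (rule common_centralizer_torsion[OF M a(1,2) b(1) ba H n(2)]) (use b in auto)
  then obtain q where "0 < q" "(b [^] n) [^] (q::nat) = \<one>" by blast
  then show False by (rule no_finite_cyclic_algebra[OF fin a(1,2) e b(1-3) ba n inj])
qed

text \<open>Both \<open>x\<close> and the inverse of \<open>x \<ominus> \<one>\<close> lie in F(x),
  where any \<open>Suc d\<close> powers of one element are dependent for reasons of
  dimension.\<close>

lemma commutator_pow_dep:
  assumes a: "a \<in> carrier R" "a \<noteq> \<zero>" and b: "b \<in> carrier R" "b \<noteq> \<zero>"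
    and x: "x = a \<otimes> b \<otimes> inv a \<otimes> inv b"
    and dim: "n \<le> d" "dimension n Z (generate_field R (insert x Z))"
  shows "pow_dep (Suc d) x"
    and "b \<notin> centralizer a \<Longrightarrow> pow_dep (Suc d) (b \<otimes> (a \<otimes> inv (ad a b)))"
proof -
  let ?E = "generate_field R (insert x Z)"
  have pow: "y [^] (i::nat) \<in> ?E" if "y \<in> ?E" for y i
    by (induction i) (auto intro: generate_field.intros that)
  have dep: "pow_dep (Suc d) y" if "y \<in> ?E" for y
    using dim pow[OF that] by (intro dimension_lin_dep[OF dim(2)]) auto
  have xE: "x \<in> ?E" by (intro generate_field.incl) simp
  then show "pow_dep (Suc d) x" by (rule dep)
  assume nc: "b \<notin> centralizer a"
  define y where "y = x \<ominus> \<one>"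
  have ad0: "ad a b \<noteq> \<zero>" "ad a b \<in> carrier R" using ad_eq_zero_iff[OF a(1) b(1)] nc a b by auto
  have y: "y = ad a b \<otimes> (inv a \<otimes> inv b)"
    unfolding y_def x ad_def using a b by (simp add: a_minus_def l_distr l_minus m_assoc)
  have yE: "y \<in> ?E"
    unfolding y_def a_minus_def by (intro generate_field.eng_add xE generate_field.a_inv generate_field.one)
  have yc: "y \<in> carrier R" "y \<noteq> \<zero>" using y ad0 a b by auto
  have "y \<otimes> (b \<otimes> (a \<otimes> inv (ad a b))) = \<one>" unfolding y using ad0 a b by (simp add: m_assoc)
  then have "inv y = b \<otimes> (a \<otimes> inv (ad a b))"
    using nonzero_inv_cancel(1)[OF yc, of "b \<otimes> (a \<otimes> inv (ad a b))"] yc ad0 a b by simp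
  moreover have "inv y \<in> ?E" using yE yc by (intro generate_field.m_inv)
  ultimately show "pow_dep (Suc d) (b \<otimes> (a \<otimes> inv (ad a b)))" using dep by metis
qed

end

theorem theorem4p2:
  fixes D (structure) and F N :: "'a set" and d :: nat
  assumes "skew_field D"
    and "F = ring_center D"
    and "d > 0"
    and "subnormal N (units_of D)"
    and "\<not> N \<subseteq> F"
    and "algebraic_of_bounded_degree D F d
           {a \<otimes> b \<otimes> inv a \<otimes> inv b | a b. a \<in> N \<and> b \<in> carrier (units_of D)}"
  shows "\<exists>n \<le> d\<^sup>2. ring.dimension D n F (carrier D)"
proof -
  interpret skew_field D by fact
  have F: "F = ring_center D" by fact
  let ?U = "units_of D"
  obtain r C where C: "C 0 = carrier ?U" "C r = N" "\<And>i. i < r \<Longrightarrow> C (Suc i) \<lhd> ?U\<lparr>carrier := C i\<rparr>"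
    and grp: "group ?U"
    using assms(4) unfolding subnormal_def by blast
  have sub: "subgroup (C i) ?U" if "i \<le> r" for i
    using that
  proof (induction i)
    case 0
    then show ?case using group.subgroup_self[OF grp] C(1) by simp
  next
    case (Suc i)
    then show ?case
      using group.incl_subgroup[OF grp, of "C i" "C (Suc i)"] normal_imp_subgroup[OF C(3)] by simp
  qed
  have U: "carrier ?U = carrier D - {\<zero>}" using skew_field_Units by (simp add: units_of_def)
  have Um: "x \<otimes>\<^bsub>?U\<^esub> y = x \<otimes> y" for x y by (simp add: units_of_def)
  have Ui: "inv\<^bsub>?U\<^esub> x = inv x" if "x \<in> carrier D" "x \<noteq> \<zero>" for x
    using units_of_inv[OF nonzero_Units[OF that]] .
  have CD: "x \<in> carrier D" "x \<noteq> \<zero>" if "x \<in> C i" "i \<le> r" for x i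
    using subgroup.subset[OF sub[OF that(2)]] that(1) U by auto
  have dec: "C (Suc i) \<subseteq> C i" if "i < r" for i
    using subgroup.subset[OF normal_imp_subgroup[OF C(3)[OF that]]] by simp
  have anti: "N \<subseteq> C i" if "i \<le> r" for i
    using that
  proof (induction rule: inc_induct)
    case (step i)
    then show ?case using dec[of i] by blast
  qed (use C(2) in simp)
  have conj: "b \<otimes> h \<otimes> inv b \<in> C (Suc i)" if i: "i < r" and b: "b \<in> C i" and h: "h \<in> C (Suc i)" for i b h
  proof -
    have "b \<otimes>\<^bsub>?U\<lparr>carrier := C i\<rparr>\<^esub> h \<otimes>\<^bsub>?U\<lparr>carrier := C i\<rparr>\<^esub> inv\<^bsub>?U\<lparr>carrier := C i\<rparr>\<^esub> b \<in> C (Suc i)"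
      by (rule normal.inv_op_closed2[OF C(3)[OF i] _ h]) (use b in simp)
    moreover have "inv\<^bsub>?U\<lparr>carrier := C i\<rparr>\<^esub> b = inv b"
      using group.m_inv_consistent[OF grp sub b] Ui CD[OF b] i by simp
    ultimately show ?thesis by (simp add: Um)
  qed
  have dep: "pow_dep (Suc d) (a \<otimes> b \<otimes> inv a \<otimes> inv b)"
    "b \<notin> centralizer a \<Longrightarrow> pow_dep (Suc d) (b \<otimes> (a \<otimes> inv (ad a b)))"
    if a: "a \<in> N" and b: "b \<in> carrier D" "b \<noteq> \<zero>" for a b
  proof -
    have "a \<otimes> b \<otimes> inv a \<otimes> inv b \<in> {a \<otimes> b \<otimes> inv a \<otimes> inv b | a b. a \<in> N \<and> b \<in> carrier (units_of D)}"
      using a b U by blast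
    then obtain n where n: "n \<le> d" "dimension n Z (generate_field D (insert (a \<otimes> b \<otimes> inv a \<otimes> inv b) Z))"
      using assms(6) unfolding algebraic_of_bounded_degree_def F by blast
    have ac: "a \<in> carrier D" "a \<noteq> \<zero>" using CD[of a r] a C(2) by auto
    show "pow_dep (Suc d) (a \<otimes> b \<otimes> inv a \<otimes> inv b)"
      "b \<notin> centralizer a \<Longrightarrow> pow_dep (Suc d) (b \<otimes> (a \<otimes> inv (ad a b)))"
      using commutator_pow_dep[OF ac b refl n] by blast+
  qed
  have nz: "b \<noteq> \<zero>" if "b \<notin> centralizer a" "a \<in> carrier D" for a b using that by auto
  obtain a where a: "a \<in> N" "a \<notin> Z" using assms(5) F by blast
  have ac: "a \<in> carrier D" "a \<noteq> \<zero>" using CD[of a r] a C(2) by auto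
  show ?thesis
  proof (cases "finite Z")
    case False
    show ?thesis unfolding F
      by (rule infinite_center_bound[OF ac(1) a(2) False assms(3)]) (use dep(2)[OF a(1)] nz ac in blast)
  next
    case True
    obtain M where M: "0 < (M::nat)" "\<And>x. x \<in> carrier D \<Longrightarrow> x \<noteq> \<zero> \<Longrightarrow> pow_dep (Suc d) x \<Longrightarrow> x [^] M = \<one>"
      using bounded_degree_exponent[OF True, of d] by blast
    have H: "(b \<otimes> (x \<otimes> inv (ad x b))) [^] M = \<one>"
      if x: "x \<in> N" and b: "b \<in> carrier D" "b \<notin> centralizer x" for x b
    proof -
      have xc: "x \<in> carrier D" "x \<noteq> \<zero>" using CD[of x r] x C(2) by auto
      have "ad x b \<noteq> \<zero>" "ad x b \<in> carrier D" using ad_eq_zero_iff[OF xc(1) b(1)] b xc by auto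
      then show ?thesis using dep(2)[OF x b(1) nz[OF b(2) xc(1)] b(2)] nz[OF b(2) xc(1)] b xc by (intro M(2)) auto
    qed
    have tors: False if "x \<in> N" "x \<notin> Z" "0 < (e::nat)" "x [^] e = \<one>" for x e
    proof -
      have "x \<in> carrier D" "x \<noteq> \<zero>" using CD[of x r] that(1) C(2) by auto
      then show False using that by (intro torsion_contradiction[OF True _ _ that(2-4) M(1) H[OF that(1)]])
    qed
    \<comment> \<open>If the commutator of \<open>a\<close> with some noncommuting \<open>b\<close>
      commutes with \<open>a\<close>, then \<open>a\<close> itself is a noncentral torsion element
      of \<open>N\<close>. Both cases below produce such a \<open>b\<close>.\<close>
    have comm_tors: False
      if b: "b \<in> carrier D" "b \<notin> centralizer a" and c: "a \<otimes> b \<otimes> inv a \<otimes> inv b \<in> centralizer a" for b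
    proof -
      have b0: "b \<noteq> \<zero>" using nz[OF b(2) ac(1)] .
      have "(a \<otimes> b \<otimes> inv a \<otimes> inv b) [^] M = \<one>"
        using ac b(1) b0 by (intro M(2) dep(1)[OF a(1)]) auto
      then obtain i where "i > 0" "a [^] (i::nat) = \<one>"
        using commuting_commutator_torsion[OF M(1) ac b H[OF a(1)] M(1) _ c] by blast
      then show False using tors[OF a] by blast
    qed
    have False
    proof (cases "\<exists>b\<in>N. b \<notin> centralizer a")
      case True
      then obtain b where b: "b \<in> N" "b \<notin> centralizer a" by blast
      have bc: "b \<in> carrier D" "b \<noteq> \<zero>" using CD[of b r] b C(2) by auto
      \<comment> \<open>A commutator of two elements of \<open>N\<close> stays in \<open>N\<close>
        and is torsion, so \<open>tors\<close> makes it central; in particular it commutes with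
        \<open>a\<close>.\<close>
      define x where "x = a \<otimes> b \<otimes> inv a \<otimes> inv b"
      have NU: "subgroup N ?U" using sub[of r] C(2) by simp
      have "inv a \<in> N" "inv b \<in> N"
        using subgroup.m_inv_closed[OF NU] a(1) b(1) Ui[OF ac] Ui[OF bc] by metis+
      then have xN: "x \<in> N"
        using subgroup.m_closed[OF NU] a(1) b(1) unfolding x_def Um by blast
      have xM: "x [^] M = \<one>"
        unfolding x_def using ac bc by (intro M(2) dep(1)[OF a(1)]) auto
      have "x \<in> Z" using tors[OF xN _ M(1) xM] by blast
      then have "x \<in> centralizer a" using ac by simp
      then show False using comm_tors[OF bc(1) b(2)] by (simp add: x_def)
    next
      case False
      then have "C r \<subseteq> centralizer a" using C(2) by blast
      \<comment> \<open>The chain starts outside \<open>centralizer a\<close> and ends inside it;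
        \<open>j\<close> is the first term inside. An element \<open>b\<close> of the preceding term
        that does not commute with \<open>a\<close> conjugates \<open>a\<close> into
        \<open>C j\<close> by normality. So the conjugate commutes with \<open>a\<close>, and
        therefore the commutator does too.\<close>
      define j where "j = (LEAST j. C j \<subseteq> centralizer a)"
      have j: "C j \<subseteq> centralizer a" unfolding j_def by (rule LeastI) fact
      have jr: "j \<le> r" unfolding j_def by (rule Least_le) fact
      have "j \<noteq> 0"
      proof
        assume "j = 0"
        then have "y \<in> centralizer a" if "y \<in> carrier D" for y
          using j that C(1) U centralizer_closed(1)[OF ac(1)] by (cases "y = \<zero>") auto
        then show False using ad_nonzero[OF ac(1) a(2)] by blast
      qed
      then obtain i where i: "j = Suc i" by (cases j) auto
      have "\<not> C i \<subseteq> centralizer a" using not_less_Least[of i "\<lambda>j. C j \<subseteq> centralizer a"] i unfolding j_def by auto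
      then obtain b where b: "b \<in> C i" "b \<notin> centralizer a" by blast
      have bc: "b \<in> carrier D" "b \<noteq> \<zero>" using CD[OF b(1)] i jr by auto
      define v where "v = b \<otimes> a \<otimes> inv b"
      have "v \<in> C (Suc i)" unfolding v_def using conj[OF _ b(1)] anti[OF jr] a(1) i jr by auto
      then have v: "v \<in> centralizer a" using j i by blast
      have vc: "v \<in> carrier D" "v \<noteq> \<zero>" using bc ac by (auto simp: v_def)
      have "v \<otimes> (b \<otimes> (inv a \<otimes> inv b)) = \<one>" unfolding v_def using bc ac by (simp add: m_assoc)
      then have "inv v = b \<otimes> (inv a \<otimes> inv b)"
        using nonzero_inv_cancel(1)[OF vc, of "b \<otimes> (inv a \<otimes> inv b)"] vc bc ac by simp
      then have "a \<otimes> inv v = a \<otimes> b \<otimes> inv a \<otimes> inv b" using bc ac by (simp add: m_assoc)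
      moreover have "a \<otimes> inv v \<in> centralizer a" using centralizer_inv[OF ac(1) v vc(2)] ac by simp
      ultimately show False using comm_tors[OF bc(1) b(2)] by simp
    qed
    then show ?thesis by blast
  qed
qed

end
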